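(* For every irrational $\alpha$ there exists a continuous function $F:\mathbb{S}^3\to\mathbb{C}$ (the restriction to $\mathbb{S}^3$ of an admissible function on $\mathbb{C}\times\mathbb{C}$, see context) such that the flow $(\Psi_t)_{t\in\mathbb{R}}$ on $\mathbb{S}^3$ given by $$z_1'=2\pi i\alpha z_1-F(z_1,z_2)\overline{z_2},\qquad z_2'=2\pi i z_2+F(z_1,z_2)\overline{z_1}$$ is transitive, i.e. has a dense orbit, and for each $s_-,s_+\in\{-,+\}$ the set $HC_{s_-s_+}$ of points whose $\omega$-limit set is equal to $\mathbb{S}^1_{s_+}$ and whose $\alpha$-limit set is equal to $\mathbb{S}^1_{s_-}$ is dense in $\mathbb{S}^3$. If $\alpha\in DC(a)$ for some $a\ge1$ then for every $0<\gamma<1/((1+a)a)$ the function $F$ can be chosen $\gamma$-Hölder continuous. Moreover, for almost every $\alpha$ (with $F$ suitably chosen) the Hausdorff dimension of each set $HC_{s_-s_+}$ is no smaller than $5/2$.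
   Context: $\mathbb{S}^3=\{(z_1,z_2)\in\mathbb{C}\times\mathbb{C}:|z_1|^2+|z_2|^2=1\}$, $\mathbb{S}^1_-=\{(z_1,z_2)\in\mathbb{S}^3:|z_1|=1,z_2=0\}$, $\mathbb{S}^1_+=\{(z_1,z_2)\in\mathbb{S}^3:z_1=0,|z_2|=1\}$. A function $F:\mathbb{C}\times\mathbb{C}\to\mathbb{C}$ is admissible if it is continuous, satisfies $F(t_1z_1,t_2z_2)=t_1t_2F(z_1,z_2)$ for all $t_1,t_2>0$, and $\overline{z_1}\,\overline{z_2}F(z_1,z_2)\in\mathbb{R}$ for all $z_1,z_2$; equivalently $F(z_1,z_2)=z_1z_2\psi(\omega,\theta)$ for $z_1=|z_1|e^{2\pi i\omega}$, $z_2=|z_2|e^{2\pi i\theta}$, with $\psi:(\mathbb{R}/\mathbb{Z})^2\to\mathbb{R}$ continuous. For such $F$ the system has unique global solutions and leaves $\mathbb{S}^3$ invariant. For $a\ge1$, $DC(a)$ is the set of irrational $\alpha$ for which there is $C>0$ with $|\alpha-\frac pq|\ge\frac1{C|q|^{1+a}}$ for all $p,q\in\mathbb{Z}$, $q\neq0$. *)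

theory Defs
  imports "HOL-Analysis.Analysis"
begin

definition S3 :: "(complex \<times> complex) set" where
  "S3 = {(z1, z2). (cmod z1)\<^sup>2 + (cmod z2)\<^sup>2 = 1}"

datatype side = Minus_side | Plus_side

fun circle_of :: "side \<Rightarrow> (complex \<times> complex) set" where
  "circle_of Minus_side = {(z1, z2) \<in> S3. cmod z1 = 1 \<and> z2 = 0}"
| "circle_of Plus_side = {(z1, z2) \<in> S3. z1 = 0 \<and> cmod z2 = 1}"

definition admissible :: "(complex \<times> complex \<Rightarrow> complex) \<Rightarrow> bool" where
  "admissible F \<longleftrightarrow>
     continuous_on UNIV F \<and>
     (\<forall>t1 t2 z1 z2. 0 < t1 \<longrightarrow> 0 < t2 \<longrightarrow>
        F (of_real t1 * z1, of_real t2 * z2) = of_real t1 * of_real t2 * F (z1, z2)) \<and>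
     (\<forall>z1 z2. cnj z1 * cnj z2 * F (z1, z2) \<in> \<real>)"

definition vector_field ::
  "real \<Rightarrow> (complex \<times> complex \<Rightarrow> complex) \<Rightarrow> complex \<times> complex \<Rightarrow> complex \<times> complex" where
  "vector_field \<alpha> F = (\<lambda>(z1, z2).
     (2 * of_real pi * \<i> * of_real \<alpha> * z1 - F (z1, z2) * cnj z2,
      2 * of_real pi * \<i> * z2 + F (z1, z2) * cnj z1))"

definition solves_from ::
  "real \<Rightarrow> (complex \<times> complex \<Rightarrow> complex) \<Rightarrow> complex \<times> complex \<Rightarrow> (real \<Rightarrow> complex \<times> complex) \<Rightarrow> bool" where
  "solves_from \<alpha> F x u \<longleftrightarrow>
     u 0 = x \<and> (\<forall>t. (u has_vector_derivative vector_field \<alpha> F (u t)) (at t))"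

(* The equivalence says that the orbit t \<mapsto> \<Psi> t x is a global solution starting at x and that
   it is the only one; in particular the values of \<Psi> on S3 are determined by \<alpha> and F. *)
definition is_flow ::
  "real \<Rightarrow> (complex \<times> complex \<Rightarrow> complex) \<Rightarrow> (real \<Rightarrow> complex \<times> complex \<Rightarrow> complex \<times> complex) \<Rightarrow> bool" where
  "is_flow \<alpha> F \<Psi> \<longleftrightarrow>
     (\<forall>x\<in>S3. (\<forall>u. solves_from \<alpha> F x u \<longleftrightarrow> u = (\<lambda>t. \<Psi> t x)) \<and> (\<forall>t. \<Psi> t x \<in> S3))"

definition transitive_flow :: "(real \<Rightarrow> complex \<times> complex \<Rightarrow> complex \<times> complex) \<Rightarrow> bool" where
  "transitive_flow \<Psi> \<longleftrightarrow> (\<exists>x\<in>S3. S3 \<subseteq> closure (range (\<lambda>t. \<Psi> t x)))"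

definition omega_limit_set :: "(real \<Rightarrow> 'a::topological_space) \<Rightarrow> 'a set" where
  "omega_limit_set u =
     {y. \<exists>\<tau>::nat \<Rightarrow> real. filterlim \<tau> at_top sequentially \<and> (\<lambda>n. u (\<tau> n)) \<longlonglongrightarrow> y}"

definition alpha_limit_set :: "(real \<Rightarrow> 'a::topological_space) \<Rightarrow> 'a set" where
  "alpha_limit_set u =
     {y. \<exists>\<tau>::nat \<Rightarrow> real. filterlim \<tau> at_bot sequentially \<and> (\<lambda>n. u (\<tau> n)) \<longlonglongrightarrow> y}"

definition HC ::
  "(real \<Rightarrow> complex \<times> complex \<Rightarrow> complex \<times> complex) \<Rightarrow> side \<Rightarrow> side \<Rightarrow> (complex \<times> complex) set" where
  "HC \<Psi> s_minus s_plus =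
     {x \<in> S3. omega_limit_set (\<lambda>t. \<Psi> t x) = circle_of s_plus \<and>
              alpha_limit_set (\<lambda>t. \<Psi> t x) = circle_of s_minus}"

definition DC :: "real \<Rightarrow> real set" where
  "DC a = {\<alpha>. \<alpha> \<notin> \<rat> \<and>
     (\<exists>C>0. \<forall>p q::int. q \<noteq> 0 \<longrightarrow>
        \<bar>\<alpha> - of_int p / of_int q\<bar> \<ge> 1 / (C * \<bar>of_int q\<bar> powr (1 + a)))}"

definition hoelder_on :: "real \<Rightarrow> 'a::metric_space set \<Rightarrow> ('a \<Rightarrow> 'b::metric_space) \<Rightarrow> bool" where
  "hoelder_on \<gamma> S f \<longleftrightarrow> (\<exists>C. \<forall>x\<in>S. \<forall>y\<in>S. dist (f x) (f y) \<le> C * dist x y powr \<gamma>)"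

(* The case s = 0 is separate because 0 powr 0 = 0, whereas a singleton must have weight 1. *)
definition hausdorff_weight :: "real \<Rightarrow> 'a::metric_space set \<Rightarrow> ennreal" where
  "hausdorff_weight s U =
     (if s = 0 then (if U = {} then 0 else 1) else ennreal (diameter U powr s))"

(* Boundedness is required explicitly because diameter is unspecified on unbounded sets. *)
definition hausdorff_content :: "real \<Rightarrow> real \<Rightarrow> 'a::metric_space set \<Rightarrow> ennreal" where
  "hausdorff_content s \<delta> A =
     (INF U \<in> {U::nat \<Rightarrow> 'a set. A \<subseteq> (\<Union>i. U i) \<and> (\<forall>i. bounded (U i) \<and> diameter (U i) \<le> \<delta>)}.
        (\<Sum>i. hausdorff_weight s (U i)))"

definition hausdorff_measure :: "real \<Rightarrow> 'a::metric_space set \<Rightarrow> ennreal" where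
  "hausdorff_measure s A = (SUP \<delta>\<in>{0<..}. hausdorff_content s \<delta> A)"

definition hausdorff_dim :: "'a::metric_space set \<Rightarrow> ennreal" where
  "hausdorff_dim A = Inf {ennreal s | s. 0 \<le> s \<and> hausdorff_measure s A = 0}"

end

theory Submission
  imports Defs
begin

text \<open>Writing \<open>z1 = r1 * cis (2 * pi * \<omega>)\<close>, \<open>z2 = r2 * cis (2 * pi * \<theta>)\<close>, \<open>F = z1 * z2 * \<psi> \<omega> \<theta>\<close> and
  \<open>h = ln (r2 / r1)\<close>, the system off the two circles becomes \<open>\<omega>' = \<alpha>\<close>, \<open>\<theta>' = 1\<close>, \<open>h' = \<psi> \<omega> \<theta>\<close>.
  Take \<open>\<psi>\<close> to be the sum over \<open>k\<close> of \<open>2 * pi * 2 ^ k * d k * sin (2 * pi * (q k * \<omega> - p k * \<theta>))\<close>, where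
  \<open>d k = q k * \<alpha> - p k\<close> is close to \<open>1 / 4 ^ k\<close>; then \<open>h\<close> is a sum of increments of cosines with periods close to
  \<open>4 ^ k\<close> and amplitudes \<open>2 ^ k\<close>. If all phases \<open>q k * \<omega> - p k * \<theta>\<close> are close to 0 modulo 1, every increment is
  essentially nonnegative and \<open>h\<close> tends to infinity in both time directions. If they are all close to 1/4, the
  increments are sines; at time about \<open>4 ^ n\<close> the terms with \<open>k > n\<close> are still in their linear regime and
  outweigh all the others, so \<open>h\<close> tends to opposite infinities. The phases 1/2 and 3/4 reverse the signs.
  These conditions are invariant under the base rotation up to bounded changes of \<open>h\<close>, hence hold densely; a dense
  orbit follows from the Baire category theorem and the intermediate value theorem.
  For Diophantine \<open>\<alpha>\<close> one can take \<open>q k\<close> of size at most \<open>4 ^ (a * k)\<close>, which gives the Hoelder exponent.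
  If \<open>q k\<close> is instead a rapidly growing chain of divisors, the admissible \<open>\<omega>\<close> contain a Cantor set that
  maps onto an interval with Hoelder exponent 1/2; with the flow direction and \<open>h\<close> this gives dimension 5/2.\<close>

section \<open>Inhomogeneous Diophantine approximation\<close>

text \<open>The scales 2 and 4 balance two demands: the coefficients of \<psi> have size about 2 ^ k
  / 4 ^ k, so its series converges uniformly, while its primitive has terms of amplitude 2 ^ k and
  may be unbounded. At time t about 4 ^ n the earlier terms, term n and the later, still linear
  terms all contribute at the same order 2 ^ n: at worst about -(2 ^ n) from the earlier ones
  against about 2 * pi * t / 2 ^ n from the later ones. No limit separates these, hence the explicit
  constants and the tolerance 1/1000. \<open>F\<close> is only known to be continuous, so uniqueness
  of solutions does not come from a Lipschitz condition. It comes from the coordinates solving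
  scalar linear equations, once rotation is removed, whose coefficients are bounded because the norm
  is conserved. In the Diophantine case coefficients decay like 1 / 2 ^ k and frequencies grow at
  most like 4 powr (a * k), so every Hoelder exponent below 1 / (2 * a) is reached; this covers the
  range below 1 / ((1 + a) * a). In 5/2, flow time and height count 1 each and the Cantor set counts
  1/2.\<close>

lemma inhomogeneous_approx:
  fixes \<beta> \<sigma> x :: real and p q :: int
  assumes "coprime p q" and "0 < q" and \<sigma>: "\<sigma> = of_int q * \<beta> - of_int p"
    and "\<sigma> \<noteq> 0" and "\<bar>\<sigma>\<bar> \<le> 1 / of_int q"
  shows "\<exists>(j::nat) (l::int). \<bar>real j * \<beta> - of_int l - x\<bar> \<le> \<bar>\<sigma>\<bar> \<and>
    real j \<le> of_int q + 2 / \<bar>\<sigma>\<bar>"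
proof -
  \<comment> \<open>\<open>r / q\<close> lies between 1/q and 2/q away from \<open>x\<close>, on the
    side from which steps of size \<sigma> lead towards \<open>x\<close>. The extra unit absorbs
    \<open>i * \<sigma>\<close>, which is at most 1 in absolute value, so that
    \<open>e / \<sigma>\<close> below is nonnegative.\<close>
  define r :: int where
    "r = (if \<sigma> > 0 then \<lfloor>x * of_int q\<rfloor> - 1 else \<lceil>x * of_int q\<rceil> + 1)"
  obtain u v :: int where uv: "u * p + v * q = 1"
    using bezout_int[of p q] assms(1) by auto
  \<comment> \<open>Since \<open>p\<close> is invertible modulo \<open>q\<close>, some index
    \<open>i\<close> below \<open>q\<close> puts \<open>i * \<beta>\<close> at \<open>r / q\<close>
    modulo 1, up to the deviation \<open>i * \<sigma> / q\<close>.\<close>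
  define i where "i = (u * r) mod q"
  have i: "0 \<le> i" "i < q" using \<open>0 < q\<close> by (auto simp: i_def)
  have "(i * p - r) mod q = (u * r * p - r) mod q"
    unfolding i_def by (metis mod_diff_left_eq mod_mult_left_eq)
  also have "u * r * p - r = q * (- r * v)"
    using uv by algebra
  finally have "(i * p - r) mod q = (q * (- r * v)) mod q" .
  then have "(i * p - r) mod q = 0" by (metis mod_mult_self1_is_0)
  then have "q dvd i * p - r" by (simp only: dvd_eq_mod_eq_0)
  then obtain l where l: "i * p - r = q * l" by (rule dvdE)
  have q0: "real_of_int q > 0" using \<open>0 < q\<close> by simp
  define e where "e = x - (of_int i * \<beta> - of_int l)"
  have \<beta>: "\<beta> = (of_int p + \<sigma>) / of_int q" using \<sigma> q0 by (simp add: field_simps)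
  have rr: "real_of_int i * of_int p - of_int r = of_int q * of_int l"
    using l by (metis of_int_diff of_int_mult)
  have cur: "of_int i * \<beta> - of_int l = of_int r / of_int q + of_int i * \<sigma> / of_int q"
    unfolding \<beta> using q0 rr by (simp add: field_simps)
  have i': "0 \<le> real_of_int i" "real_of_int i / of_int q \<le> 1" using i q0 by (auto simp: field_simps)
  have qe: "of_int q * e = x * of_int q - of_int r - of_int i * \<sigma>"
    unfolding e_def cur using q0 by (simp add: field_simps)
  have i\<sigma>: "\<bar>of_int i * \<sigma>\<bar> \<le> 1"
  proof -
    have "\<bar>of_int i * \<sigma>\<bar> \<le> of_int q * (1 / of_int q)"
      unfolding abs_mult by (rule mult_mono) (use i assms(5) in auto)
    then show ?thesis using q0 by simp
  qed
  have e\<sigma>: "0 \<le> e / \<sigma> \<and> e / \<sigma> \<le> 2 / (of_int q * \<bar>\<sigma>\<bar>)"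
  proof (cases "\<sigma> > 0")
    case True
    have "0 \<le> real_of_int i * \<sigma>" using True i by simp
    moreover have "of_int r \<le> x * of_int q - 1" "x * of_int q - 2 \<le> of_int r"
      using True by (auto simp: r_def; linarith)+
    ultimately have "0 \<le> of_int q * e" "of_int q * e \<le> 2" unfolding qe using i\<sigma> by linarith+
    then have "0 \<le> e" "e \<le> 2 / of_int q" using q0 by (auto simp: field_simps zero_le_mult_iff)
    then show ?thesis using True q0 by (simp add: field_simps)
  next
    case False
    then have neg: "\<sigma> < 0" using assms(4) by simp
    have "real_of_int i * \<sigma> \<le> 0" using neg i by (simp add: mult_nonneg_nonpos)
    moreover have "x * of_int q + 1 \<le> of_int r" "of_int r \<le> x * of_int q + 2"
      using False by (auto simp: r_def; linarith)+
    ultimately have "of_int q * e \<le> 0" "- 2 \<le> of_int q * e" unfolding qe using i\<sigma> by linarith+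
    then have "e \<le> 0" "- 2 / of_int q \<le> e" using q0 by (auto simp: field_simps mult_le_0_iff)
    then show ?thesis using neg q0 by (simp add: field_simps)
  qed
  \<comment> \<open>Adding \<open>q\<close> to the index moves the point by \<sigma> modulo 1. After
    \<open>m\<close> such moves the error is at most one step, and the bound 2 / (q *
    \<bar>\<sigma>\<bar>) for \<open>m\<close> bounds the index.\<close>
  define m where "m = nat \<lfloor>e / \<sigma>\<rfloor>"
  have "real m = of_int \<lfloor>e / \<sigma>\<rfloor>" using e\<sigma> by (simp add: m_def)
  then have m: "real m \<le> e / \<sigma>" "e / \<sigma> \<le> real m + 1" by linarith+
  have "\<bar>e / \<sigma> - real m\<bar> * \<bar>\<sigma>\<bar> \<le> 1 * \<bar>\<sigma>\<bar>" by (rule mult_right_mono) (use m in auto)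
  then have mm: "\<bar>e - real m * \<sigma>\<bar> \<le> \<bar>\<sigma>\<bar>"
    using assms(4) by (simp add: abs_mult[symmetric] left_diff_distrib)
  define j where "j = nat i + m * nat q"
  have rj: "real j = of_int i + real m * of_int q" using i \<open>0 < q\<close> by (simp add: j_def)
  have "real j * \<beta> - of_int (l + int m * p) - x = real m * \<sigma> - e"
    unfolding rj e_def \<sigma> by (simp add: algebra_simps)
  then have 1: "\<bar>real j * \<beta> - of_int (l + int m * p) - x\<bar> \<le> \<bar>\<sigma>\<bar>" using mm by simp
  have "real m * of_int q \<le> 2 / (of_int q * \<bar>\<sigma>\<bar>) * of_int q"
    by (rule mult_right_mono) (use m e\<sigma> q0 in auto)
  also have "\<dots> = 2 / \<bar>\<sigma>\<bar>" using q0 by simp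
  finally have "real j \<le> of_int q + 2 / \<bar>\<sigma>\<bar>" unfolding rj using i by simp
  with 1 show ?thesis by blast
qed

lemma irrational_int_combination:
  fixes \<alpha> :: real and m n :: int
  assumes "\<alpha> \<notin> \<rat>" "m \<noteq> 0"
  shows "of_int m * \<alpha> - of_int n \<noteq> 0" and "of_int m * \<alpha> \<notin> \<rat>"
proof -
  show *: "of_int m * \<alpha> \<notin> \<rat>"
  proof
    assume "of_int m * \<alpha> \<in> \<rat>"
    then have "of_int m * \<alpha> / of_int m \<in> \<rat>" by (intro Rats_divide Rats_of_int)
    then show False using assms by simp
  qed
  show "of_int m * \<alpha> - of_int n \<noteq> 0"
  proof
    assume "of_int m * \<alpha> - of_int n = 0"
    then have "of_int m * \<alpha> = of_int n" by simp
    then show False using * by (metis Rats_of_int)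
  qed
qed

text \<open>Aiming at \<open>x - J * \<beta>\<close> and then raising the index by \<open>J\<close>
  makes the index as large as desired; Dirichlet's theorem supplies a small \<sigma>.\<close>

lemma inhomogeneous_approx_beyond:
  fixes \<beta> x \<epsilon> :: real and J :: nat
  assumes "\<beta> \<notin> \<rat>" "\<epsilon> > 0"
  shows "\<exists>(j::nat) (l::int). j \<ge> J \<and> \<bar>real j * \<beta> - of_int l - x\<bar> < \<epsilon>"
proof -
  obtain N :: nat where N: "1 / real N < \<epsilon>" "N > 0"
    by (metis assms(2) gr_zeroI inverse_eq_divide real_arch_inverse)
  obtain p q where pq: "coprime p q" "0 < q" "q \<le> int N" "\<bar>of_int q * \<beta> - of_int p\<bar> < 1 / real N"
    using Dirichlet_approx_coprime[OF N(2)] by metis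
  have \<sigma>0: "of_int q * \<beta> - of_int p \<noteq> 0" using irrational_int_combination(1)[OF assms(1)] pq(2) by simp
  have "1 / real N \<le> 1 / of_int q" using pq N by (simp add: frac_le)
  then have "\<bar>of_int q * \<beta> - of_int p\<bar> \<le> 1 / of_int q" using pq by linarith
  from inhomogeneous_approx[OF pq(1,2) refl \<sigma>0 this, of "x - real J * \<beta>"]
  obtain j :: nat and l :: int where
    jl: "\<bar>real j * \<beta> - of_int l - (x - real J * \<beta>)\<bar> \<le> \<bar>of_int q * \<beta> - of_int p\<bar>" by blast
  have "real j * \<beta> - of_int l - (x - real J * \<beta>) = real (j + J) * \<beta> - of_int l - x"
    by (simp add: algebra_simps)
  then have "\<bar>real (j + J) * \<beta> - of_int l - x\<bar> < \<epsilon>" using jl pq(4) N by linarith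
  then show ?thesis by (intro exI[of _ "j + J"] exI[of _ l]) simp
qed

text \<open>Denominators are taken congruent to 1 modulo 4 so that \<open>q k * c\<close> and \<open>c\<close> agree modulo 1
  for every \<open>c\<close> that is a multiple of 1/4.\<close>
definition near_resonance :: "real \<Rightarrow> nat \<Rightarrow> nat \<Rightarrow> int \<Rightarrow> bool" where
  "near_resonance \<alpha> k q p \<longleftrightarrow> q mod 4 = 1 \<and>
     \<bar>real q * \<alpha> - of_int p - 1 / 4 ^ k\<bar> \<le> 1 / (1000 * 4 ^ k)"

text \<open>The new denominator is \<open>q * (1 + 4 * j)\<close>: a multiple of \<open>q\<close>,
  again 1 modulo 4, and large once \<open>j\<close> is. The condition on \<open>j\<close> is an
  inhomogeneous approximation by multiples of the irrational number
  \<open>4 * q * \<alpha>\<close>.\<close>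

lemma near_resonance_refine:
  fixes \<alpha> :: real and q R k :: nat
  assumes "\<alpha> \<notin> \<rat>" "q mod 4 = 1"
  shows "\<exists>q' p'. near_resonance \<alpha> k q' p' \<and> q dvd q' \<and> R * q \<le> q'"
proof -
  have q: "q > 0" using assms(2) by (auto intro: gr0I)
  have "of_int (4 * int q) * \<alpha> \<notin> \<rat>" by (rule irrational_int_combination(2)[OF assms(1)]) (use q in simp)
  then have "real (4 * q) * \<alpha> \<notin> \<rat>" by simp
  then obtain j :: nat and l :: int where jl: "j \<ge> R"
    "\<bar>real j * (real (4 * q) * \<alpha>) - of_int l - (1 / 4 ^ k - real q * \<alpha>)\<bar> < 1 / (1000 * 4 ^ k)"
    using inhomogeneous_approx_beyond[of "real (4 * q) * \<alpha>" "1 / (1000 * 4 ^ k)" R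
        "1 / 4 ^ k - real q * \<alpha>"] by auto
  define q' where "q' = q * (1 + 4 * j)"
  have "real q' * \<alpha> - of_int l - 1 / 4 ^ k
      = real j * (real (4 * q) * \<alpha>) - of_int l - (1 / 4 ^ k - real q * \<alpha>)"
    by (simp add: q'_def algebra_simps)
  then have "\<bar>real q' * \<alpha> - of_int l - 1 / 4 ^ k\<bar> \<le> 1 / (1000 * 4 ^ k)" using jl by simp
  moreover have "q' mod 4 = 1"
  proof -
    have "q' = q + 4 * (q * j)" by (simp add: q'_def algebra_simps)
    then show ?thesis using assms(2) by simp
  qed
  moreover have "R * q \<le> q'" unfolding q'_def using jl(1)
    by (subst mult.commute) (rule mult_left_mono, auto)
  ultimately show ?thesis unfolding near_resonance_def by (metis dvd_triv_left q'_def)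
qed

lemma divisibility_chain_exists:
  fixes \<alpha> :: real and R :: nat
  assumes "\<alpha> \<notin> \<rat>"
  shows "\<exists>q p. (\<forall>k. near_resonance \<alpha> k (q k) (p k)) \<and> (\<forall>k. q k dvd q (Suc k)) \<and>
    (\<forall>k. R * q k \<le> q (Suc k))"
proof -
  have "\<exists>q. \<forall>k. (\<exists>p. near_resonance \<alpha> k (q k) p) \<and> (q k dvd q (Suc k) \<and> R * q k \<le> q (Suc k))"
  proof (rule dependent_nat_choice)
    show "\<exists>q. \<exists>p. near_resonance \<alpha> 0 q p"
      using near_resonance_refine[OF assms, of 1 0 0] by auto
    show "\<exists>q'. (\<exists>p. near_resonance \<alpha> (Suc k) q' p) \<and> (q dvd q' \<and> R * q \<le> q')"
      if "\<exists>p. near_resonance \<alpha> k q p" for q k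
    proof -
      have "q mod 4 = 1" using that by (auto simp: near_resonance_def)
      from near_resonance_refine[OF assms this] show ?thesis by blast
    qed
  qed
  then obtain q where q: "\<And>k. \<exists>p. near_resonance \<alpha> k (q k) p"
    "\<And>k. q k dvd q (Suc k) \<and> R * q k \<le> q (Suc k)" by auto
  then obtain p where "\<And>k. near_resonance \<alpha> k (q k) (p k)" by metis
  then show ?thesis using q(2) by blast
qed

text \<open>Multiples of \<open>4 * \<alpha>\<close> are used so that the denominator has the form
  \<open>1 + 4 * j\<close>. Dirichlet's denominator is of order at most 4 ^ k, and the Diophantine
  condition keeps \<bar>\<sigma>\<bar> above a constant times 4 powr (- a * k). As
  \<open>a \<ge> 1\<close>, the index bound q' + 2 / \<bar>\<sigma>\<bar> is then of order 4 powr (a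
  * k).\<close>

lemma Diophantine_denominator_bound:
  fixes \<alpha> a :: real
  assumes "\<alpha> \<in> DC a" "a \<ge> 1"
  shows "\<exists>K>0. \<forall>k. \<exists>q p. near_resonance \<alpha> k q p \<and> real q \<le> K * (4 powr a) ^ k"
proof -
  from assms(1) obtain C where C: "C > 0" and irr: "\<alpha> \<notin> \<rat>"
    and dc: "\<And>p q::int. q \<noteq> 0 \<Longrightarrow> \<bar>\<alpha> - of_int p / of_int q\<bar> \<ge> 1 / (C * \<bar>of_int q\<bar> powr (1 + a))"
    unfolding DC_def by blast
  define K where "K = 1 + 4 * (1000 + 2 * C * 4000 powr a)"
  have "\<exists>q p. near_resonance \<alpha> k q p \<and> real q \<le> K * (4 powr a) ^ k" for k
  proof -
    \<comment> \<open>With this \<open>N\<close> the Dirichlet error 1/N is exactly the tolerance of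
      \<open>near_resonance\<close>.\<close>
    define N :: nat where "N = 1000 * 4 ^ k"
    have N0: "N > 0" by (simp add: N_def)
    obtain p' q' where pq: "coprime p' q'" "0 < q'" "q' \<le> int N"
      "\<bar>of_int q' * (4 * \<alpha>) - of_int p'\<bar> < 1 / real N"
      using Dirichlet_approx_coprime[OF N0] by metis
    define \<sigma> where "\<sigma> = of_int q' * (4 * \<alpha>) - of_int p'"
    have q1: "real_of_int q' \<ge> 1" using pq(2) by simp
    have qN: "real_of_int q' \<le> real N" using pq(3) by (metis of_int_le_iff of_int_of_nat_eq)
    have lower: "1 / (C * (4 * real N) powr a) \<le> \<bar>\<sigma>\<bar>"
    proof -
      have "1 / (C * (4 * real N) powr a) \<le> 1 / (C * (4 * of_int q') powr a)"
        using C q1 qN assms(2) N0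
        by (intro divide_left_mono mult_left_mono powr_mono2 mult_pos_pos) auto
      also have "\<dots> = (4 * of_int q') * (1 / (C * \<bar>of_int (4 * q')\<bar> powr (1 + a)))"
        using q1 C by (simp add: powr_add)
      also have "\<dots> \<le> (4 * of_int q') * \<bar>\<alpha> - of_int p' / of_int (4 * q')\<bar>"
        using dc[of "4 * q'" p'] q1 by (intro mult_left_mono) auto
      also have "\<dots> = \<bar>(4 * of_int q') * (\<alpha> - of_int p' / of_int (4 * q'))\<bar>"
        using q1 by (simp add: abs_mult)
      also have "(4 * of_int q') * (\<alpha> - of_int p' / of_int (4 * q')) = \<sigma>"
        using q1 by (simp add: \<sigma>_def field_simps)
      finally show ?thesis .
    qed
    have Cpos: "C * (4 * real N) powr a > 0" using C N0 by simp
    then have \<sigma>0: "\<sigma> \<noteq> 0" using lower by (auto simp: divide_le_0_iff)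
    have "1 / real N \<le> 1 / of_int q'" using qN q1 by (simp add: frac_le)
    then have "\<bar>\<sigma>\<bar> \<le> 1 / of_int q'" using pq(4) by (simp add: \<sigma>_def)
    from inhomogeneous_approx[OF pq(1,2) \<sigma>_def \<sigma>0 this, of "1 / 4 ^ k - \<alpha>"]
    obtain j :: nat and l :: int where jl:
      "\<bar>real j * (4 * \<alpha>) - of_int l - (1 / 4 ^ k - \<alpha>)\<bar> \<le> \<bar>\<sigma>\<bar>" "real j \<le> of_int q' + 2 / \<bar>\<sigma>\<bar>"
      by blast
    define q where "q = 1 + 4 * j"
    have "real q * \<alpha> - of_int l - 1 / 4 ^ k = real j * (4 * \<alpha>) - of_int l - (1 / 4 ^ k - \<alpha>)"
      by (simp add: q_def algebra_simps)
    then have "near_resonance \<alpha> k q l"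
      using jl(1) pq(4) unfolding near_resonance_def
      by (simp add: q_def \<sigma>_def N_def)
    moreover have "real q \<le> K * (4 powr a) ^ k"
    proof -
      have pw: "(4::real) ^ k \<le> (4 powr a) ^ k"
        using powr_mono[of 1 a "4::real"] assms(2) by (intro power_mono) auto
      have "1 / \<bar>\<sigma>\<bar> \<le> 1 / (1 / (C * (4 * real N) powr a))"
        by (rule divide_left_mono) (use lower Cpos \<sigma>0 in auto)
      then have "2 / \<bar>\<sigma>\<bar> \<le> 2 * C * (4 * real N) powr a" by simp
      also have "(4 * real N) powr a = 4000 powr a * (4 powr a) ^ k"
      proof -
        have "(4 * real N) powr a = 4000 powr a * (4 ^ k) powr a" by (simp add: N_def powr_mult)
        also have "((4::real) ^ k) powr a = (4 powr a) ^ k"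
          by (simp add: powr_realpow[symmetric] powr_powr mult.commute)
        finally show ?thesis .
      qed
      finally have *: "2 / \<bar>\<sigma>\<bar> \<le> 2 * C * 4000 powr a * (4 powr a) ^ k" by simp
      have "real_of_int q' \<le> 1000 * (4 powr a) ^ k" using qN pw by (simp add: N_def)
      then have "real j \<le> 1000 * (4 powr a) ^ k + 2 * C * 4000 powr a * (4 powr a) ^ k"
        using jl(2) * by linarith
      moreover have "1 \<le> (4 powr a) ^ k" using pw one_le_power[of "4::real" k] by linarith
      ultimately show ?thesis unfolding q_def K_def by (simp add: algebra_simps)
    qed
    ultimately show ?thesis by blast
  qed
  moreover have "C * 4000 powr a \<ge> 0" using C by simp
  then have "K > 0" by (simp add: K_def add_pos_nonneg)
  ultimately show ?thesis by blast
qed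

section \<open>Lower bounds for lacunary series of increments\<close>

lemma sin_ge_cubic:
  fixes a :: real
  assumes "0 \<le> a"
  shows "a - a ^ 3 / 6 \<le> sin a"
proof -
  have "(\<Sum>m<3. sin_coeff m * a ^ m) = a" by (simp add: sin_coeff_def numeral_3_eq_3)
  then have "\<bar>sin a - a\<bar> \<le> a ^ 3 / 6"
    using Maclaurin_sin_bound[of a 3] assms by (simp add: fact_numeral)
  then show ?thesis by linarith
qed

text \<open>The range 8/5 slightly exceeds pi/2, so that it covers a quarter turn together with its
  relative error; 57/100 is just below 1 - (8/5)^2 / 6 from the cubic bound.\<close>

lemma sin_ge_linear:
  fixes a :: real
  assumes "0 \<le> a" "a \<le> 8 / 5"
  shows "57 / 100 * a \<le> sin a"
proof -
  have "a * a\<^sup>2 \<le> a * (8 / 5)\<^sup>2"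
    by (rule mult_left_mono) (use assms in \<open>auto intro: power_mono\<close>)
  then have "a ^ 3 \<le> a * (64 / 25)" by (simp add: power3_eq_cube power2_eq_square)
  then show ?thesis using sin_ge_cubic[OF assms(1)] assms(1) by linarith
qed

lemma one_minus_cos_le: "1 - cos a \<le> \<bar>a\<bar>" for a :: real
proof -
  have "1 - cos a = 2 * (sin (a / 2))\<^sup>2" using cos_double_sin[of "a / 2"] by simp
  also have "\<dots> = 2 * (\<bar>sin (a / 2)\<bar> * \<bar>sin (a / 2)\<bar>)" by (simp add: power2_eq_square)
  also have "\<dots> \<le> 2 * (\<bar>sin (a / 2)\<bar> * 1)" by (intro mult_left_mono) auto
  also have "\<dots> \<le> \<bar>a\<bar>" using abs_sin_x_le_abs_x[of "a / 2"] by simp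
  finally show ?thesis .
qed

lemma cos_near_one: "\<bar>b\<bar> \<le> 1 / 1000 \<Longrightarrow> 999 / 1000 \<le> cos b" for b :: real
  using one_minus_cos_le[of b] by linarith

lemma geometric_half_tail:
  fixes c :: real
  shows "(\<lambda>m. c / 2 ^ (m + Suc n)) sums (c / 2 ^ n)"
proof -
  have "(\<lambda>m. c / 2 ^ Suc n * (1 / 2) ^ m) sums (c / 2 ^ Suc n * (1 / (1 - 1 / 2)))"
    by (intro sums_mult geometric_sums) simp
  then show ?thesis by (simp add: power_add field_simps)
qed

text \<open>Terms before \<open>n\<close> are controlled by their amplitude only, terms after
  \<open>n\<close> by their linear behaviour. Both sums are geometric; with \<open>c\<close> of
  order 4 ^ n both are of order 2 ^ n.\<close>

lemma suminf_ge_split: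
  fixes f :: "nat \<Rightarrow> real" and A :: real
  assumes "summable f"
    and low: "\<And>k. k < n \<Longrightarrow> f k \<ge> - A * 2 ^ k"
    and high: "\<And>k. k > n \<Longrightarrow> f k \<ge> c / 2 ^ k"
    and "A \<ge> 0"
  shows "suminf f \<ge> c / 2 ^ n + f n - A * 2 ^ n"
proof -
  have "c / 2 ^ n \<le> (\<Sum>m. f (m + Suc n))"
  proof (rule sums_le[OF _ geometric_half_tail summable_sums])
    show "c / 2 ^ (m + Suc n) \<le> f (m + Suc n)" for m using high[of "m + Suc n"] by simp
    show "summable (\<lambda>m. f (m + Suc n))" using assms(1) by (subst summable_iff_shift)
  qed
  moreover have "- A * 2 ^ n \<le> (\<Sum>k<n. f k)"
  proof -
    have "- A * 2 ^ n \<le> (\<Sum>k<n. - A * 2 ^ k)"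
    proof -
      have "(\<Sum>k<n. (2::real) ^ k) = 2 ^ n - 1"
        by (induction n) auto
      then show ?thesis using assms(4) by (simp add: sum_distrib_left[symmetric] sum_negf right_diff_distrib)
    qed
    also have "\<dots> \<le> (\<Sum>k<n. f k)" by (rule sum_mono) (use low in auto)
    finally show ?thesis .
  qed
  ultimately show ?thesis using suminf_split_initial_segment[OF assms(1), of "Suc n"] by simp
qed

text \<open>By the addition formula the perturbation \<open>b\<close> costs a factor
  \<open>cos b\<close> and a term of size at most \<open>a / 1000\<close>, which lowers the slope
  from 57/100 to 56/100.\<close>

lemma odd_increment_lower:
  fixes a b :: real
  assumes "\<bar>b\<bar> \<le> 1 / 1000" "0 \<le> a" "a \<le> 8 / 5"
  shows "sin (a + b) - sin b \<ge> 56 / 100 * a"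
proof -
  have "sin (a + b) - sin b = sin a * cos b - (1 - cos a) * sin b"
    by (simp add: sin_add algebra_simps)
  moreover have "(57 / 100 * a) * (999 / 1000) \<le> sin a * cos b"
    using sin_ge_linear[OF assms(2,3)] assms(2) cos_near_one[OF assms(1)]
    by (intro mult_mono) linarith+
  moreover have "(1 - cos a) * sin b \<le> a * (1 / 1000)"
  proof -
    have "(1 - cos a) * sin b \<le> \<bar>1 - cos a\<bar> * \<bar>sin b\<bar>" by (metis abs_ge_self abs_mult)
    also have "\<dots> \<le> a * (1 / 1000)"
      using one_minus_cos_le[of a] abs_sin_x_le_abs_x[of b] assms by (intro mult_mono) auto
    finally show ?thesis .
  qed
  ultimately show ?thesis using assms(2) by linarith
qed

text \<open>For \<open>b = 0\<close> the increment is 1 - cos a and never negative. The three bounds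
  serve three ranges of indices: a loss linear in \<open>a\<close> for late terms, a loss of at most
  1/1000 for early ones, and a definite gain when \<open>a\<close> is of moderate size.\<close>

lemma even_increment_lower:
  fixes a b :: real
  assumes "\<bar>b\<bar> \<le> 1 / 1000"
  shows "cos b - cos (a + b) \<ge> - \<bar>a\<bar> / 1000"
    and "cos b - cos (a + b) \<ge> - 1 / 1000"
    and "38 / 100 \<le> \<bar>a\<bar> \<Longrightarrow> \<bar>a\<bar> \<le> 8 / 5 \<Longrightarrow> cos b - cos (a + b) \<ge> 4 / 100"
proof -
  have eq: "cos b - cos (a + b) = (1 - cos a) * cos b + sin a * sin b"
    by (simp add: cos_add algebra_simps)
  have c: "999 / 1000 \<le> cos b" using cos_near_one[OF assms] .
  have "\<bar>sin a * sin b\<bar> \<le> \<bar>a\<bar> * (1 / 1000)"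
    unfolding abs_mult using abs_sin_x_le_abs_x[of a] abs_sin_x_le_abs_x[of b] assms
    by (intro mult_mono) auto
  then have s: "sin a * sin b \<ge> - \<bar>a\<bar> / 1000" by linarith
  have "(1 - cos a) * cos b \<ge> 0" using c by (intro mult_nonneg_nonneg) auto
  then show "cos b - cos (a + b) \<ge> - \<bar>a\<bar> / 1000" using s eq by linarith
  show "cos b - cos (a + b) \<ge> - 1 / 1000" using c cos_le_one[of "a + b"] by linarith
  assume a: "38 / 100 \<le> \<bar>a\<bar>" "\<bar>a\<bar> \<le> 8 / 5"
  have "sin (\<bar>a\<bar> / 2) \<ge> 16 / 100"
  proof -
    have "(\<bar>a\<bar> / 2) * (\<bar>a\<bar> / 2)\<^sup>2 \<le> (\<bar>a\<bar> / 2) * (8 / 10)\<^sup>2"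
      by (rule mult_left_mono) (use a in \<open>auto intro: power_mono\<close>)
    then have "(\<bar>a\<bar> / 2) ^ 3 \<le> (\<bar>a\<bar> / 2) * (64 / 100)" by (simp add: power3_eq_cube power2_eq_square)
    then show ?thesis using sin_ge_cubic[of "\<bar>a\<bar> / 2"] a by linarith
  qed
  then have "(16 / 100)\<^sup>2 \<le> (sin (\<bar>a\<bar> / 2))\<^sup>2" by (intro power_mono) auto
  moreover have "1 - cos a = 2 * (sin (\<bar>a\<bar> / 2))\<^sup>2"
    using cos_double_sin[of "\<bar>a\<bar> / 2"] by simp
  ultimately have d: "1 - cos a \<ge> 5 / 100" by (simp add: power2_eq_square)
  have "(5 / 100) * (999 / 1000) \<le> (1 - cos a) * cos b"
    by (rule mult_mono) (use d c in auto)
  then show "cos b - cos (a + b) \<ge> 4 / 100" using s eq a by linarith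
qed

text \<open>This is the balance at time \<open>x * 4 ^ n\<close>, divided by 2 ^ n:
  \<open>7 / 2 * x\<close> from the later terms, the sine from term \<open>n\<close>, and -1 as the
  worst case of all earlier terms.\<close>

lemma main_window_bound:
  fixes x :: real
  assumes "1 / 4 \<le> x" "x \<le> 1"
  shows "7 / 2 * x + sin (2 * pi * x) - 1 \<ge> 1 / 5"
proof (cases "x \<le> 1 / 2")
  case True
  have "sin (2 * pi * x) = sin (2 * pi * (1 / 2 - x))"
  proof -
    have "2 * pi * (1 / 2 - x) = pi - 2 * pi * x" by (simp add: algebra_simps)
    then show ?thesis by (simp only: sin_pi_minus)
  qed
  also have "\<dots> \<ge> 57 / 100 * (2 * pi * (1 / 2 - x))"
  proof (rule sin_ge_linear)
    have "2 * pi * (1 / 2 - x) \<le> 2 * pi * (1 / 4)" using assms by (intro mult_left_mono) auto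
    also have "\<dots> \<le> 8 / 5" using pi_approx(2) by simp
    finally show "2 * pi * (1 / 2 - x) \<le> 8 / 5" .
  qed (use True in simp)
  finally have "sin (2 * pi * x) \<ge> 57 / 100 * (2 * pi * (1 / 2 - x))" .
  moreover have "pi * (1 / 2 - x) \<ge> 314 / 100 * (1 / 2 - x)"
    using True pi_approx by (intro mult_right_mono) auto
  moreover define w where "w = pi * (1 / 2 - x)"
  moreover have "57 / 100 * (2 * pi * (1 / 2 - x)) = 57 / 50 * w" by (simp add: w_def)
  ultimately have "sin (2 * pi * x) \<ge> 57 / 50 * w" "w \<ge> 314 / 100 * (1 / 2 - x)" by simp_all
  then have "sin (2 * pi * x) \<ge> 57 / 50 * (314 / 100 * (1 / 2 - x))" by simp
  also have "57 / 50 * (314 / 100 * (1 / 2 - x)) = 8949 / 5000 - 8949 / 2500 * x" by simp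
  finally show ?thesis using True by simp
next
  \<comment> \<open>Below, the tangent at 1/2 and the trivial bound -1 for the sine give one
    decreasing and one increasing lower bound; they cross near x = 0.66, where both still exceed
    1/5.\<close>
  case False
  have "sin (2 * pi * x) = - sin (2 * pi * (x - 1 / 2))"
  proof -
    have "2 * pi * x = 2 * pi * (x - 1 / 2) + pi" by (simp add: algebra_simps)
    then show ?thesis by (metis sin_periodic_pi)
  qed
  moreover have "sin (2 * pi * (x - 1 / 2)) \<le> 2 * pi * (x - 1 / 2)"
    by (rule sin_x_le_x) (use False in simp)
  moreover have "pi * (x - 1 / 2) \<le> 315 / 100 * (x - 1 / 2)"
    using False pi_approx by (intro mult_right_mono) auto
  ultimately have "sin (2 * pi * x) \<ge> 63 / 20 - 63 / 10 * x" by (simp add: field_simps)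
  moreover have "sin (2 * pi * x) \<ge> - 1" by simp
  ultimately show ?thesis by linarith
qed

lemma relative_deviation:
  fixes v u :: real
  assumes "\<bar>v - u\<bar> \<le> \<bar>u\<bar> / 1000"
  shows "\<bar>v\<bar> \<le> 1001 / 1000 * \<bar>u\<bar>" "\<bar>v\<bar> \<ge> 999 / 1000 * \<bar>u\<bar>" "u \<ge> 0 \<Longrightarrow> v \<ge> 0"
  using assms by linarith+

text \<open>The three contributions are those of \<open>main_window_bound\<close>. Its margin 1/5
  also pays for the errors 1/50 in term \<open>n\<close> and 1/1000 in the earlier terms, and at
  least 1/10 remains.\<close>

lemma odd_series_lower:
  fixes d b :: "nat \<Rightarrow> real" and t x :: real
  assumes d: "\<And>k. \<bar>d k - 1 / 4 ^ k\<bar> \<le> 1 / (1000 * 4 ^ k)"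
    and b: "\<And>k. \<bar>b k\<bar> \<le> 1 / 1000"
    and x: "1 / 4 \<le> x" "x \<le> 1" and t: "t = x * 4 ^ n"
    and summ: "summable (\<lambda>k. 2 ^ k * (sin (2 * pi * (t * d k) + b k) - sin (b k)))"
  shows "(\<Sum>k. 2 ^ k * (sin (2 * pi * (t * d k) + b k) - sin (b k))) \<ge> 2 ^ n / 10"
proof -
  let ?f = "\<lambda>k. 2 ^ k * (sin (2 * pi * (t * d k) + b k) - sin (b k))"
  have t0: "t > 0" using x t by simp
  have td: "\<bar>t * d k - t / 4 ^ k\<bar> \<le> (t / 4 ^ k) / 1000" for k
  proof -
    have "\<bar>t * (d k - 1 / 4 ^ k)\<bar> \<le> t * (1 / (1000 * 4 ^ k))"
      unfolding abs_mult using t0 d[of k] by (intro mult_mono) auto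
    then show ?thesis by (simp add: right_diff_distrib)
  qed
  have sb: "\<bar>sin (b k)\<bar> \<le> 1 / 1000" for k using abs_sin_x_le_abs_x[of "b k"] b[of k] by linarith
  have low: "?f k \<ge> - (1001 / 1000) * 2 ^ k" for k
  proof -
    have "2 ^ k * (sin (2 * pi * (t * d k) + b k) - sin (b k)) \<ge> 2 ^ k * (- (1001 / 1000))"
      using sb[of k] sin_ge_minus_one[of "2 * pi * (t * d k) + b k"]
      by (intro mult_left_mono) (auto simp del: sin_ge_minus_one)
    then show ?thesis by (simp add: mult.commute)
  qed
  \<comment> \<open>For \<open>k > n\<close> the angle is at most about a quarter turn, within the
    range of \<open>odd_increment_lower\<close>. The slope 7/2 is what is left of 2 * pi after the
    factors 56/100 and 999/1000.\<close>
  have high: "?f k \<ge> (7 / 2 * t) / 2 ^ k" if "k > n" for k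
  proof -
    have "t / 4 ^ k \<le> 4 ^ n / 4 ^ k" using x t by (intro divide_right_mono) auto
    also have "\<dots> \<le> 4 ^ n / 4 ^ Suc n"
      using that by (intro divide_left_mono power_increasing) auto
    finally have tk: "t / 4 ^ k \<le> 1 / 4" by simp
    have tk0: "t / 4 ^ k \<ge> 0" using t0 by simp
    have dev: "\<bar>t * d k - t / 4 ^ k\<bar> \<le> \<bar>t / 4 ^ k\<bar> / 1000" using td[of k] tk0 by linarith
    have lo0: "t * d k \<ge> 0" by (rule relative_deviation(3)[OF dev tk0])
    have lo: "t * d k \<ge> 999 / 1000 * (t / 4 ^ k)"
      using relative_deviation(2)[OF dev] lo0 tk0 by (metis abs_of_nonneg)
    have "t * d k \<le> 1001 / 1000 * (t / 4 ^ k)"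
      using relative_deviation(1)[OF dev] lo0 tk0 by (metis abs_of_nonneg)
    also have "\<dots> \<le> 1001 / 1000 * (1 / 4)" by (rule mult_left_mono) (use tk in auto)
    finally have hi: "t * d k \<le> 1001 / 4000" by simp
    have A: "2 * pi * (t * d k) \<le> 8 / 5"
    proof -
      have "pi * (t * d k) \<le> 315 / 100 * (1001 / 4000)"
        using pi_approx hi lo0 by (intro mult_mono) auto
      then show ?thesis by simp
    qed
    have "sin (2 * pi * (t * d k) + b k) - sin (b k) \<ge> 56 / 100 * (2 * pi * (t * d k))"
      by (rule odd_increment_lower) (use b A lo0 in auto)
    moreover have "314 / 100 * (999 / 1000 * (t / 4 ^ k)) \<le> pi * (t * d k)"
      by (rule mult_mono[OF _ lo]) (use pi_approx t0 in simp_all)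
    moreover have "7 / 2 * (t / 4 ^ k) \<le> 2 * 56 / 100 * (314 / 100 * (999 / 1000 * (t / 4 ^ k)))"
      using tk0 by simp
    ultimately have "sin (2 * pi * (t * d k) + b k) - sin (b k) \<ge> 7 / 2 * (t / 4 ^ k)"
      by linarith
    then have "?f k \<ge> 2 ^ k * (7 / 2 * (t / 4 ^ k))" by (intro mult_left_mono) auto
    also have "2 ^ k * (7 / 2 * (t / 4 ^ k)) = (7 / 2 * t) / 2 ^ k"
      by (simp add: field_simps flip: power_mult_distrib)
    finally show ?thesis .
  qed
  have tn: "t / 4 ^ n = x" using t by simp
  have mid: "?f n \<ge> 2 ^ n * (sin (2 * pi * x) - 1 / 50)"
  proof (rule mult_left_mono)
    define e where "e = 2 * pi * (t * d n) + b n - 2 * pi * x"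
    have "\<bar>t * d n - x\<bar> \<le> 1 / 1000" using td[of n] x unfolding tn by linarith
    then have "pi * \<bar>t * d n - x\<bar> \<le> 315 / 100 * (1 / 1000)" using pi_approx by (intro mult_mono) auto
    moreover have "\<bar>2 * pi * (t * d n - x)\<bar> = 2 * (pi * \<bar>t * d n - x\<bar>)" by (simp add: abs_mult)
    moreover have "e = 2 * pi * (t * d n - x) + b n" by (simp add: e_def algebra_simps)
    ultimately have e: "\<bar>e\<bar> \<le> 9 / 1000" using b[of n] by linarith
    have "sin (2 * pi * x + e) = sin (2 * pi * x) * cos e + cos (2 * pi * x) * sin e"
      by (rule sin_add)
    moreover have "\<bar>cos (2 * pi * x) * sin e\<bar> \<le> 1 * \<bar>e\<bar>"
      unfolding abs_mult using abs_sin_x_le_abs_x[of e] by (intro mult_mono) auto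
    moreover have "\<bar>sin (2 * pi * x) * (1 - cos e)\<bar> \<le> 1 * \<bar>e\<bar>"
      unfolding abs_mult using one_minus_cos_le[of e] by (intro mult_mono) auto
    moreover have "sin (2 * pi * x) * (1 - cos e) = sin (2 * pi * x) - sin (2 * pi * x) * cos e"
      by (simp add: algebra_simps)
    moreover have "sin (2 * pi * (t * d n) + b n) = sin (2 * pi * x + e)" by (simp add: e_def)
    ultimately show "sin (2 * pi * (t * d n) + b n) - sin (b n) \<ge> sin (2 * pi * x) - 1 / 50"
      using e sb[of n] by linarith
  qed simp
  have "suminf ?f \<ge> (7 / 2 * t) / 2 ^ n + ?f n - 1001 / 1000 * 2 ^ n"
    by (rule suminf_ge_split[OF summ low high]) auto
  moreover have "(7 / 2 * t) / 2 ^ n = 2 ^ n * (7 / 2 * x)"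
    unfolding t by (simp add: field_simps flip: power_mult_distrib)
  ultimately have "suminf ?f \<ge> 2 ^ n * (7 / 2 * x + (sin (2 * pi * x) - 1 / 50) - 1001 / 1000)"
    using mid by (simp add: distrib_left right_diff_distrib mult.commute)
  moreover have "2 ^ n * (7 / 2 * x + (sin (2 * pi * x) - 1 / 50) - 1001 / 1000) \<ge> 2 ^ n * (1 / 10)"
    using main_window_bound[OF x] by (intro mult_left_mono) auto
  ultimately have "suminf ?f \<ge> 2 ^ n * (1 / 10)" by linarith
  then show ?thesis by simp
qed

text \<open>Term \<open>n\<close> may have completed a full period and gained nothing, so the
  decisive term is the next one: its angle is between about 1/16 and 1/4 of a turn, where the cosine
  has dropped noticeably. The losses of all other terms carry a factor of order 1/1000.\<close>

lemma even_series_lower: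
  fixes d b :: "nat \<Rightarrow> real" and t x :: real
  assumes d: "\<And>k. \<bar>d k - 1 / 4 ^ k\<bar> \<le> 1 / (1000 * 4 ^ k)"
    and b: "\<And>k. \<bar>b k\<bar> \<le> 1 / 1000"
    and x: "1 / 4 \<le> x" "x \<le> 1" and t: "\<bar>t\<bar> = x * 4 ^ n"
    and summ: "summable (\<lambda>k. 2 ^ k * (cos (b k) - cos (2 * pi * (t * d k) + b k)))"
  shows "(\<Sum>k. 2 ^ k * (cos (b k) - cos (2 * pi * (t * d k) + b k))) \<ge> 2 ^ n / 100"
proof -
  let ?f = "\<lambda>k. 2 ^ k * (cos (b k) - cos (2 * pi * (t * d k) + b k))"
  have t0: "\<bar>t\<bar> > 0" using x t by simp
  have td: "\<bar>t * d k\<bar> \<le> 1001 / 1000 * (\<bar>t\<bar> / 4 ^ k)" "\<bar>t * d k\<bar> \<ge> 999 / 1000 * (\<bar>t\<bar> / 4 ^ k)" for k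
  proof -
    have "\<bar>t * (d k - 1 / 4 ^ k)\<bar> \<le> \<bar>t\<bar> * (1 / (1000 * 4 ^ k))"
      unfolding abs_mult using d[of k] by (intro mult_mono) auto
    then have "\<bar>t * d k - t / 4 ^ k\<bar> \<le> (\<bar>t\<bar> / 4 ^ k) / 1000" by (simp add: right_diff_distrib)
    then have dev: "\<bar>t * d k - t / 4 ^ k\<bar> \<le> \<bar>t / 4 ^ k\<bar> / 1000" by simp
    show "\<bar>t * d k\<bar> \<le> 1001 / 1000 * (\<bar>t\<bar> / 4 ^ k)" "\<bar>t * d k\<bar> \<ge> 999 / 1000 * (\<bar>t\<bar> / 4 ^ k)"
      using relative_deviation(1,2)[OF dev] by simp_all
  qed
  have any: "?f k \<ge> - (1 / 1000) * 2 ^ k" for k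
  proof -
    have "2 ^ k * (cos (b k) - cos (2 * pi * (t * d k) + b k)) \<ge> 2 ^ k * (- 1 / 1000)"
      by (intro mult_left_mono even_increment_lower(2)[OF b]) auto
    then show ?thesis by (simp add: mult.commute)
  qed
  have high: "?f k \<ge> (- (7 / 1000) * \<bar>t\<bar>) / 2 ^ k" for k
  proof -
    have w: "2 * (315 / 100 * (1001 / 1000 * w)) \<le> 7 * w" if "0 \<le> w" for w :: real
      using that by simp
    have "pi * \<bar>t * d k\<bar> \<le> 315 / 100 * (1001 / 1000 * (\<bar>t\<bar> / 4 ^ k))"
      using td(1)[of k] pi_approx by (intro mult_mono) auto
    moreover have "2 * (315 / 100 * (1001 / 1000 * (\<bar>t\<bar> / 4 ^ k))) \<le> 7 * (\<bar>t\<bar> / 4 ^ k)" by (rule w) simp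
    moreover have "\<bar>2 * pi * (t * d k)\<bar> = 2 * (pi * \<bar>t * d k\<bar>)" by (simp add: abs_mult)
    ultimately have "\<bar>2 * pi * (t * d k)\<bar> \<le> 7 * (\<bar>t\<bar> / 4 ^ k)" by linarith
    then have "- (7 * (\<bar>t\<bar> / 4 ^ k)) / 1000 \<le> - \<bar>2 * pi * (t * d k)\<bar> / 1000" by simp
    then have "cos (b k) - cos (2 * pi * (t * d k) + b k) \<ge> - (7 * (\<bar>t\<bar> / 4 ^ k)) / 1000"
      using even_increment_lower(1)[OF b, of "2 * pi * (t * d k)" k] by (rule order_trans)
    then have "?f k \<ge> 2 ^ k * (- (7 * (\<bar>t\<bar> / 4 ^ k)) / 1000)" by (intro mult_left_mono) auto
    also have "2 ^ k * (- (7 * (\<bar>t\<bar> / 4 ^ k)) / 1000) = (- (7 / 1000) * \<bar>t\<bar>) / 2 ^ k"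
      by (simp add: field_simps flip: power_mult_distrib)
    finally show ?thesis .
  qed
  have mid: "?f (Suc n) \<ge> 2 ^ Suc n * (4 / 100)"
  proof (intro mult_left_mono even_increment_lower(3)[OF b])
    have tn: "\<bar>t\<bar> / 4 ^ Suc n = x / 4" using t by simp
    have "\<bar>t * d (Suc n)\<bar> \<le> 1001 / 4000" "\<bar>t * d (Suc n)\<bar> \<ge> 999 / 16000"
      using td[of "Suc n"] x unfolding tn by linarith+
    then have "pi * \<bar>t * d (Suc n)\<bar> \<le> 315 / 100 * (1001 / 4000)" "pi * \<bar>t * d (Suc n)\<bar> \<ge> 314 / 100 * (999 / 16000)"
      using pi_approx by (intro mult_mono; simp)+
    then show "38 / 100 \<le> \<bar>2 * pi * (t * d (Suc n))\<bar>" "\<bar>2 * pi * (t * d (Suc n))\<bar> \<le> 8 / 5"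
      by (simp_all add: abs_mult)
  qed simp
  have "suminf ?f \<ge> (- (7 / 1000) * \<bar>t\<bar>) / 2 ^ Suc n + ?f (Suc n) - 1 / 1000 * 2 ^ Suc n"
    by (rule suminf_ge_split[OF summ any high]) auto
  moreover have "(- (7 / 1000) * \<bar>t\<bar>) / 2 ^ Suc n = 2 ^ n * (- (7 / 2000) * x)"
    unfolding t by (simp add: field_simps flip: power_mult_distrib)
  ultimately have "suminf ?f \<ge> 2 ^ n * (- (7 / 2000) * x + 8 / 100 - 2 / 1000)"
    using mid by (simp add: distrib_left right_diff_distrib mult.commute)
  moreover have "2 ^ n * (- (7 / 2000) * x + 8 / 100 - 2 / 1000) \<ge> 2 ^ n * (1 / 100)"
    using x by (intro mult_left_mono) auto
  ultimately have "suminf ?f \<ge> 2 ^ n * (1 / 100)" by linarith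
  then show ?thesis by simp
qed

lemma quarter_window_exists:
  fixes t :: real
  assumes "4 ^ m \<le> t"
  shows "\<exists>n\<ge>m. \<exists>x. 1 / 4 \<le> x \<and> x \<le> 1 \<and> t = x * 4 ^ n"
proof -
  obtain N where N: "t < 4 ^ N" using real_arch_pow[of 4 t] by auto
  define n where "n = (LEAST n. t \<le> 4 ^ n)"
  have n: "t \<le> 4 ^ n" unfolding n_def by (rule LeastI[of _ N]) (use N in simp)
  have least: "\<not> t \<le> 4 ^ i" if "i < n" for i using not_less_Least[OF that[unfolded n_def]] .
  have "n \<ge> m"
  proof (rule ccontr)
    assume "\<not> m \<le> n"
    then have "(4::real) ^ n < 4 ^ m" by (intro power_strict_increasing) auto
    then show False using n assms by linarith
  qed
  moreover have "1 / 4 \<le> t / 4 ^ n"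
  proof (cases n)
    \<comment> \<open>Minimality of \<open>n\<close> says nothing here; the lower bound comes from
      \<open>4 ^ m \<le> t\<close> instead.\<close>
    case 0
    moreover have "1 \<le> t" using assms one_le_power[of "4::real" m] by linarith
    ultimately show ?thesis by simp
  next
    case (Suc i)
    then have "4 ^ i < t" using least[of i] by simp
    then show ?thesis using Suc by (simp add: field_simps)
  qed
  ultimately show ?thesis using n
    by (intro exI[of _ n] conjI exI[of _ "t / 4 ^ n"]) (auto simp: field_simps)
qed

section \<open>The height cocycle\<close>

lemma abs_cos_diff_le: "\<bar>cos a - cos b\<bar> \<le> \<bar>a - b\<bar>" for a b :: real
proof -
  have "\<bar>cos a - cos b\<bar> = 2 * (\<bar>sin ((a + b) / 2)\<bar> * \<bar>sin ((b - a) / 2)\<bar>)"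
    by (simp add: cos_diff_cos abs_mult)
  also have "\<dots> \<le> 2 * (1 * \<bar>(b - a) / 2\<bar>)"
    by (intro mult_left_mono mult_mono abs_sin_x_le_abs_x) auto
  finally show ?thesis by simp
qed

locale resonant_cascade =
  fixes \<alpha> :: real and q :: "nat \<Rightarrow> nat" and p :: "nat \<Rightarrow> int"
  assumes irrational: "\<alpha> \<notin> \<rat>"
    and resonance: "near_resonance \<alpha> k (q k) (p k)"
begin

definition phase :: "nat \<Rightarrow> real \<Rightarrow> real \<Rightarrow> real" where
  "phase k \<omega> \<theta> = real (q k) * \<omega> - of_int (p k) * \<theta>"

definition drift :: "nat \<Rightarrow> real" where
  "drift k = real (q k) * \<alpha> - of_int (p k)"

definition amp :: "nat \<Rightarrow> real" where
  "amp k = 2 * pi * 2 ^ k * drift k"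

definition psi :: "real \<Rightarrow> real \<Rightarrow> real" where
  "psi \<omega> \<theta> = (\<Sum>k. amp k * sin (2 * pi * phase k \<omega> \<theta>))"

text \<open>The series must be one of increments: the cosines with weights 2 ^ k alone do not form a
  convergent series. The increments are the integrals of the terms of \<open>psi\<close> along the
  base flow, the factor \<open>drift k\<close> in \<open>amp k\<close> being cancelled by
  integration.\<close>

definition height :: "real \<Rightarrow> real \<Rightarrow> real \<Rightarrow> real" where
  "height t \<omega> \<theta> = (\<Sum>k. 2 ^ k * (cos (2 * pi * phase k \<omega> \<theta>)
     - cos (2 * pi * (phase k \<omega> \<theta> + t * drift k))))"

text \<open>At points with a vanishing coordinate \<open>angular\<close> has a junk value, but \<open>F\<close> vanishes there.\<close>
definition angular :: "complex \<times> complex \<Rightarrow> real" where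
  "angular z = (\<Sum>k. amp k * Im (sgn (fst z) ^ q k * sgn (snd z) powi (- p k)))"

definition F :: "complex \<times> complex \<Rightarrow> complex" where
  "F = (\<lambda>(z1, z2). z1 * z2 * of_real (angular (z1, z2)))"

lemma q_mod: "q k mod 4 = 1" and q_pos: "q k > 0"
proof -
  show "q k mod 4 = 1" using resonance[of k] by (simp add: near_resonance_def)
  then show "q k > 0" by (auto intro: gr0I)
qed

lemma drift_near: "\<bar>drift k - 1 / 4 ^ k\<bar> \<le> 1 / (1000 * 4 ^ k)"
  using resonance[of k] by (simp add: near_resonance_def drift_def)

lemma drift_pos: "drift k > 0" and drift_le: "drift k \<le> 2 / 4 ^ k"
proof -
  obtain u :: real where u: "u = 1 / 4 ^ k" by simp
  have "\<bar>drift k - u\<bar> \<le> u / 1000" "u > 0" using drift_near[of k] u by simp_all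
  then have "drift k > 0" "drift k \<le> 2 * u" by linarith+
  then show "drift k > 0" "drift k \<le> 2 / 4 ^ k" using u by simp_all
qed

lemma amp_pos: "amp k > 0" and amp_le: "amp k \<le> 4 * pi / 2 ^ k"
proof -
  show "amp k > 0" using drift_pos by (simp add: amp_def)
  have "2 * pi * 2 ^ k * drift k \<le> 2 * pi * 2 ^ k * (2 / 4 ^ k)"
    by (intro mult_left_mono drift_le) simp
  also have "\<dots> = 4 * pi / 2 ^ k" by (simp add: field_simps flip: power_mult_distrib)
  finally show "amp k \<le> 4 * pi / 2 ^ k" by (simp add: amp_def)
qed

lemma summable_amp: "summable amp"
proof (rule summable_comparison_test')
  have "summable (\<lambda>k. 4 * pi * (1 / 2) ^ k)" by (intro summable_mult summable_geometric) simp
  then show "summable (\<lambda>k. 4 * pi / 2 ^ k)" by (simp add: power_divide)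
  show "norm (amp k) \<le> 4 * pi / 2 ^ k" if "k \<ge> 0" for k using amp_le[of k] amp_pos[of k] by simp
qed

lemma summable_amp_bounded:
  assumes "\<And>k. \<bar>g k\<bar> \<le> 1"
  shows "summable (\<lambda>k. amp k * g k)" and "\<bar>\<Sum>k. amp k * g k\<bar> \<le> suminf amp"
proof -
  have le: "norm (amp k * g k) \<le> amp k" for k
    using mult_left_mono[OF assms, of "amp k" k] amp_pos[of k] by (simp add: abs_mult)
  show "summable (\<lambda>k. amp k * g k)"
    by (rule summable_comparison_test'[OF summable_amp, of 0]) (use le in auto)
  show "\<bar>\<Sum>k. amp k * g k\<bar> \<le> suminf amp"
    using norm_suminf_le[OF le summable_amp] by simp
qed

lemma psi_bound: "\<bar>psi \<omega> \<theta>\<bar> \<le> suminf amp"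
  unfolding psi_def by (rule summable_amp_bounded(2)) simp

text \<open>A mean value estimate. It trades the growing weight 2 ^ k for the summable
  \<open>amp k\<close>, at the price of a factor \<bar>t\<bar>, uniformly in the base point.\<close>

lemma height_term_bound:
  "\<bar>2 ^ k * (cos (2 * pi * y) - cos (2 * pi * (y + t * drift k)))\<bar> \<le> \<bar>t\<bar> * amp k"
proof -
  have "\<bar>cos (2 * pi * y) - cos (2 * pi * (y + t * drift k))\<bar> \<le> \<bar>2 * pi * (t * drift k)\<bar>"
    using abs_cos_diff_le[of "2 * pi * y" "2 * pi * (y + t * drift k)"] by (simp add: algebra_simps)
  then have "2 ^ k * \<bar>cos (2 * pi * y) - cos (2 * pi * (y + t * drift k))\<bar> \<le> 2 ^ k * \<bar>2 * pi * (t * drift k)\<bar>"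
    by (intro mult_left_mono) auto
  also have "\<dots> = \<bar>t\<bar> * amp k" using drift_pos[of k] by (simp add: amp_def abs_mult)
  finally show ?thesis by (simp add: abs_mult)
qed

lemma summable_height:
  "summable (\<lambda>k. 2 ^ k * (cos (2 * pi * y k) - cos (2 * pi * (y k + t * drift k))))"
  by (rule summable_comparison_test'[OF summable_mult[OF summable_amp, of "\<bar>t\<bar>"], of 0])
    (use height_term_bound in auto)

lemma height_0 [simp]: "height 0 \<omega> \<theta> = 0"
  by (simp add: height_def)

lemma phase_flow: "phase k (\<omega> + \<alpha> * t) (\<theta> + t) = phase k \<omega> \<theta> + t * drift k"
  by (simp add: phase_def drift_def algebra_simps)

text \<open>Along the base flow every phase grows linearly, so the increments over consecutive time
  intervals telescope term by term.\<close>

lemma height_add: "height (s + t) \<omega> \<theta> = height s \<omega> \<theta> + height t (\<omega> + \<alpha> * s) (\<theta> + s)"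
  unfolding height_def phase_flow
  by (subst suminf_add[OF summable_height summable_height])
    (simp add: algebra_simps)

lemma height_has_derivative:
  "((\<lambda>t. height t \<omega> \<theta>) has_real_derivative psi (\<omega> + \<alpha> * t) (\<theta> + t)) (at t)"
proof -
  define f where "f = (\<lambda>k t. 2 ^ k * (cos (2 * pi * phase k \<omega> \<theta>)
     - cos (2 * pi * (phase k \<omega> \<theta> + t * drift k))))"
  define f' where "f' = (\<lambda>k t. amp k * sin (2 * pi * (phase k \<omega> \<theta> + t * drift k)))"
  have "((\<lambda>t. \<Sum>k. f k t) has_field_derivative (\<Sum>k. f' k t)) (at t)"
  proof (rule has_field_derivative_series'(2)[of UNIV f f' 0])
    show "(f k has_field_derivative f' k t) (at t within UNIV)" for k t
      unfolding f_def f'_def amp_def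
      by (rule derivative_eq_intros refl | simp)+
    show "uniformly_convergent_on UNIV (\<lambda>n t. \<Sum>k<n. f' k t)"
    proof (rule Weierstrass_m_test'[OF _ summable_amp])
      show "norm (f' k t) \<le> amp k" for k t
      proof -
        have "amp k * \<bar>sin (2 * pi * (phase k \<omega> \<theta> + t * drift k))\<bar> \<le> amp k * 1"
          using amp_pos[of k] by (intro mult_left_mono) auto
        then show ?thesis using amp_pos[of k] by (simp add: f'_def abs_mult)
      qed
    qed
    show "summable (\<lambda>k. f k 0)" by (simp add: f_def)
  qed auto
  then show ?thesis unfolding f_def f'_def height_def psi_def phase_flow .
qed

lemma continuous_on_height: "continuous_on UNIV (\<lambda>w. height t (fst w) (snd w))"
proof -
  have "uniform_limit UNIV (\<lambda>n w. \<Sum>k<n. 2 ^ k * (cos (2 * pi * phase k (fst w) (snd w))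
     - cos (2 * pi * (phase k (fst w) (snd w) + t * drift k)))) (\<lambda>w. height t (fst w) (snd w)) sequentially"
    unfolding height_def
    by (rule Weierstrass_m_test[OF _ summable_mult[OF summable_amp, of "\<bar>t\<bar>"]])
      (use height_term_bound in auto)
  then show ?thesis
    by (rule uniform_limit_theorem[rotated])
      (auto intro!: always_eventually continuous_intros simp: phase_def)
qed

text \<open>One tolerance serves all \<open>k\<close>. The number \<open>c\<close> counts turns,
  whereas the error \<open>b\<close> is an angle in radians.\<close>

definition resonant_start :: "real \<Rightarrow> real \<Rightarrow> real \<Rightarrow> bool" where
  "resonant_start c \<omega> \<theta> \<longleftrightarrow>
     (\<forall>k. \<exists>b (n::int). 2 * pi * phase k \<omega> \<theta> = 2 * pi * c + b + 2 * pi * of_int n \<and> \<bar>b\<bar> \<le> 1 / 1000)"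

text \<open>Whole turns are invisible to the cosine, so each phase may be replaced by
  \<open>c\<close> plus its small error. This is the form in which the bounds for lacunary series
  apply.\<close>

lemma resonant_start_height:
  assumes "resonant_start c \<omega> \<theta>"
  shows "\<exists>b. (\<forall>k. \<bar>b k\<bar> \<le> 1 / 1000) \<and>
    (\<forall>t. summable (\<lambda>k. 2 ^ k * (cos (2 * pi * c + b k) - cos (2 * pi * c + (2 * pi * (t * drift k) + b k))))) \<and>
    (\<forall>t. height t \<omega> \<theta> = (\<Sum>k. 2 ^ k * (cos (2 * pi * c + b k)
          - cos (2 * pi * c + (2 * pi * (t * drift k) + b k)))))"
proof -
  obtain b and n :: "nat \<Rightarrow> int" where b: "\<And>k. \<bar>b k\<bar> \<le> 1 / 1000"
    and n: "\<And>k. 2 * pi * phase k \<omega> \<theta> = 2 * pi * c + b k + 2 * pi * of_int (n k)"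
    using assms unfolding resonant_start_def by metis
  have per: "cos (x + 2 * pi * of_int i) = cos x" for x :: real and i :: int
    using cos_int_2pin[of i] sin_int_2pin[of i] by (simp add: cos_add mult.commute)
  have eq: "2 ^ k * (cos (2 * pi * phase k \<omega> \<theta>) - cos (2 * pi * (phase k \<omega> \<theta> + t * drift k)))
      = 2 ^ k * (cos (2 * pi * c + b k) - cos (2 * pi * c + (2 * pi * (t * drift k) + b k)))" for k t
  proof -
    have "2 * pi * (phase k \<omega> \<theta> + t * drift k)
        = (2 * pi * c + (2 * pi * (t * drift k) + b k)) + 2 * pi * of_int (n k)"
      unfolding distrib_left n by simp
    then show ?thesis by (simp only: n per)
  qed
  show ?thesis
  proof (intro exI[of _ b] conjI allI b)
    show "summable (\<lambda>k. 2 ^ k * (cos (2 * pi * c + b k) - cos (2 * pi * c + (2 * pi * (t * drift k) + b k))))" for t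
      using summable_height[of "\<lambda>k. phase k \<omega> \<theta>" t] unfolding eq .
  qed (simp add: height_def eq)
qed

lemma height_even:
  assumes "resonant_start 0 \<omega> \<theta>" "4 ^ m \<le> \<bar>t\<bar>"
  shows "height t \<omega> \<theta> \<ge> 2 ^ m / 100"
proof -
  have c: "2 * pi * 0 + x = x" for x :: real by simp
  obtain b where b: "\<And>k. \<bar>b k\<bar> \<le> 1 / 1000"
    and s: "\<And>t. summable (\<lambda>k. 2 ^ k * (cos (b k) - cos (2 * pi * (t * drift k) + b k)))"
    and h: "\<And>t. height t \<omega> \<theta> = (\<Sum>k. 2 ^ k * (cos (b k) - cos (2 * pi * (t * drift k) + b k)))"
    using resonant_start_height[OF assms(1), unfolded c] by blast
  obtain n x where n: "n \<ge> m" "1 / 4 \<le> x" "x \<le> 1" "\<bar>t\<bar> = x * 4 ^ n"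
    using quarter_window_exists[OF assms(2)] by blast
  have "(2::real) ^ m / 100 \<le> 2 ^ n / 100" using n(1) by (simp add: power_increasing)
  also have "\<dots> \<le> height t \<omega> \<theta>" unfolding h by (rule even_series_lower[OF drift_near b n(2-4) s])
  finally show ?thesis .
qed

text \<open>At a quarter turn the cosine increments become sine increments. The backward estimate is
  the forward one for the errors \<open>- b k\<close>, because the sine is odd.\<close>

lemma height_odd:
  assumes "resonant_start (1 / 4) \<omega> \<theta>" "4 ^ m \<le> t"
  shows "height t \<omega> \<theta> \<ge> 2 ^ m / 10" and "height (- t) \<omega> \<theta> \<le> - (2 ^ m / 10)"
proof -
  have c: "cos (2 * pi * (1 / 4) + x) = - sin x" for x :: real
    by (simp add: cos_add)
  obtain b where b: "\<And>k. \<bar>b k\<bar> \<le> 1 / 1000"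
    and s: "\<And>t. summable (\<lambda>k. 2 ^ k * (- sin (b k) - - sin (2 * pi * (t * drift k) + b k)))"
    and h: "\<And>t. height t \<omega> \<theta> = (\<Sum>k. 2 ^ k * (- sin (b k) - - sin (2 * pi * (t * drift k) + b k)))"
    using resonant_start_height[OF assms(1), unfolded c] by blast
  have e: "- sin (b k) - - sin (2 * pi * (t * drift k) + b k)
     = sin (2 * pi * (t * drift k) + b k) - sin (b k)" for k t by simp
  obtain n x where n: "n \<ge> m" "1 / 4 \<le> x" "x \<le> 1" "t = x * 4 ^ n"
    using quarter_window_exists[OF assms(2)] by blast
  have mn: "(2::real) ^ m / 10 \<le> 2 ^ n / 10" using n(1) by (simp add: power_increasing)
  show "height t \<omega> \<theta> \<ge> 2 ^ m / 10"
    unfolding h e by (rule order_trans[OF mn odd_series_lower[OF drift_near b n(2-4) s[unfolded e]]])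
  have odd: "2 ^ k * (sin (2 * pi * (- t * drift k) + b k) - sin (b k))
     = - (2 ^ k * (sin (2 * pi * (t * drift k) + - b k) - sin (- b k)))" for k
  proof -
    have "2 * pi * (- t * drift k) + b k = - (2 * pi * (t * drift k) + - b k)" by simp
    then have "sin (2 * pi * (- t * drift k) + b k) = - sin (2 * pi * (t * drift k) + - b k)"
      by (simp only: sin_minus)
    then show ?thesis by (simp add: algebra_simps)
  qed
  have s': "summable (\<lambda>k. 2 ^ k * (sin (2 * pi * (t * drift k) + - b k) - sin (- b k)))"
    using s[of "- t", unfolded e odd] by (simp only: summable_minus_iff)
  have b': "\<bar>- b k\<bar> \<le> 1 / 1000" for k using b[of k] by simp
  have "height (- t) \<omega> \<theta> = - (\<Sum>k. 2 ^ k * (sin (2 * pi * (t * drift k) + - b k) - sin (- b k)))"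
    unfolding h e odd by (rule suminf_minus[OF s'])
  then show "height (- t) \<omega> \<theta> \<le> - (2 ^ m / 10)"
    using order_trans[OF mn odd_series_lower[OF drift_near b' n(2-4) s']] by simp
qed

text \<open>Every \<open>q k\<close> is odd, so moving \<omega> by 1/2 moves every phase by 1/2
  modulo 1 and changes the sign of every cosine at once.\<close>

lemma height_half_shift:
  assumes "resonant_start (c + 1 / 2) \<omega> \<theta>"
  obtains \<omega>' \<theta>' where "resonant_start c \<omega>' \<theta>'" "\<And>t. height t \<omega> \<theta> = - height t \<omega>' \<theta>'"
proof -
  have odd: "odd (q k)" for k using q_mod[of k] by presburger
  have ph: "phase k (\<omega> - 1 / 2) \<theta> = phase k \<omega> \<theta> - 1 / 2 - real (q k div 2)" for k
  proof -
    have "real (q k) = 2 * real (q k div 2) + 1"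
      using odd[of k] by (metis odd_two_times_div_two_succ of_nat_1 of_nat_add of_nat_mult of_nat_numeral)
    then show ?thesis by (simp add: phase_def algebra_simps)
  qed
  have flip: "cos (2 * pi * (y - 1 / 2 - real m)) = - cos (2 * pi * y)" for y m
  proof -
    have "2 * pi * (y - 1 / 2 - real m) = (2 * pi * y - pi) - 2 * pi * real m" by (simp add: algebra_simps)
    then show ?thesis
      using cos_2npi[of m] sin_2npi[of m] by (simp add: cos_diff mult.commute mult.left_commute)
  qed
  have "resonant_start c (\<omega> - 1 / 2) \<theta>"
    unfolding resonant_start_def ph
  proof
    fix k
    obtain b and n :: int where bn:
      "2 * pi * phase k \<omega> \<theta> = 2 * pi * (c + 1 / 2) + b + 2 * pi * of_int n" "\<bar>b\<bar> \<le> 1 / 1000"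
      using assms unfolding resonant_start_def by blast
    have "2 * pi * (phase k \<omega> \<theta> - 1 / 2 - real (q k div 2))
      = 2 * pi * c + b + 2 * pi * of_int (n - int (q k div 2))"
      unfolding right_diff_distrib bn by (simp add: algebra_simps)
    then show "\<exists>b (n::int). 2 * pi * (phase k \<omega> \<theta> - 1 / 2 - real (q k div 2)) = 2 * pi * c + b + 2 * pi * of_int n
       \<and> \<bar>b\<bar> \<le> 1 / 1000" using bn(2) by blast
  qed
  moreover have "height t \<omega> \<theta> = - height t (\<omega> - 1 / 2) \<theta>" for t
  proof -
    have "2 * pi * (phase k \<omega> \<theta> - 1 / 2 - real (q k div 2) + t * drift k)
      = 2 * pi * ((phase k \<omega> \<theta> + t * drift k) - 1 / 2 - real (q k div 2))" for k
      by (simp add: algebra_simps)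
    then have "2 ^ k * (cos (2 * pi * phase k (\<omega> - 1 / 2) \<theta>) - cos (2 * pi * (phase k (\<omega> - 1 / 2) \<theta> + t * drift k)))
      = - (2 ^ k * (cos (2 * pi * phase k \<omega> \<theta>) - cos (2 * pi * (phase k \<omega> \<theta> + t * drift k))))" for k
      unfolding ph by (simp only: flip) (simp add: algebra_simps)
    then have "height t (\<omega> - 1 / 2) \<theta> = - height t \<omega> \<theta>"
      unfolding height_def by (simp only: suminf_minus[OF summable_height])
    then show ?thesis by simp
  qed
  ultimately show ?thesis by (rule that)
qed

end

section \<open>The vector field\<close>

lemma norm_sgn_power_int_le: "norm (sgn z ^ m * sgn w powi n) \<le> 1" for z w :: complex
proof -
  have "norm (sgn w powi n) \<le> 1"
  proof (cases "w = 0")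
    \<comment> \<open>\<open>0 powi n\<close> is 1 for \<open>n = 0\<close> and 0 otherwise, so the
      bound also holds at a vanishing coordinate.\<close>
    case True
    then show ?thesis by (cases "n = 0") auto
  qed (simp add: norm_power_int norm_sgn)
  moreover have "norm (sgn z ^ m) \<le> 1" by (simp add: norm_power norm_sgn power_le_one)
  ultimately have "norm (sgn z ^ m) * norm (sgn w powi n) \<le> 1 * 1" by (intro mult_mono) auto
  then show ?thesis by (simp add: norm_mult)
qed

text \<open>On the unit circle the inverse is the conjugate, which is an isometry; this reduces
  negative exponents to natural powers.\<close>

lemma unit_power_int_diff:
  fixes a b :: complex
  assumes "norm a = 1" "norm b = 1"
  shows "norm (a powi n - b powi n) \<le> \<bar>of_int n\<bar> * norm (a - b)"
proof (cases "n \<ge> 0")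
  case True
  then show ?thesis
    using norm_power_diff[of a b "nat n"] assms by (simp add: power_int_def)
next
  case False
  have inv: "inverse z = cnj z" if "norm z = 1" for z :: complex
    using complex_norm_square[of z] that by (intro inverse_unique) simp
  have "norm (cnj a ^ nat (- n) - cnj b ^ nat (- n)) \<le> real (nat (- n)) * norm (cnj a - cnj b)"
    using norm_power_diff[of "cnj a" "cnj b" "nat (- n)"] assms by simp
  also have "norm (cnj a - cnj b) = norm (a - b)" by (metis complex_cnj_diff complex_mod_cnj)
  finally show ?thesis using False assms by (simp add: power_int_def inv)
qed

text \<open>\<open>sgn\<close> is not Lipschitz near 0, but becomes so after multiplication by the
  modulus. This is how the factor \<open>z1 * z2\<close> of \<open>F\<close> tames the angular
  oscillation near the two circles.\<close>

lemma norm_mult_sgn_diff: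
  fixes z w :: complex
  shows "norm z * norm (sgn z - sgn w) \<le> 2 * norm (z - w)"
proof -
  have z: "of_real (norm u) * sgn u = u" for u :: complex by (simp add: sgn_eq)
  have "norm z * norm (sgn z - sgn w) = norm (of_real (norm z) * (sgn z - sgn w))"
    by (simp add: norm_mult)
  also have "of_real (norm z) * (sgn z - sgn w) = (z - w) + of_real (norm w - norm z) * sgn w"
    using z[of z] z[of w] by (simp add: algebra_simps)
  also have "norm \<dots> \<le> norm (z - w) + \<bar>norm w - norm z\<bar> * norm (sgn w)"
    by (rule norm_triangle_le) (simp add: norm_mult del: of_real_diff)
  also have "\<dots> \<le> norm (z - w) + norm (z - w) * 1"
    using norm_triangle_ineq3[of w z]
    by (intro add_mono mult_mono) (auto simp: norm_sgn norm_minus_commute)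
  finally show ?thesis by simp
qed

text \<open>Gronwall's argument in both time directions: the square of \<open>f\<close>, weighted by
  an exponential, is monotone. The coefficient may be any bounded function, in particular one that
  depends on an unknown solution.\<close>

lemma linear_ode_zero:
  fixes f c :: "real \<Rightarrow> real"
  assumes der: "\<And>t. (f has_real_derivative c t * f t) (at t)"
    and c: "\<And>t. \<bar>c t\<bar> \<le> M" and "f s = 0"
  shows "f t = 0"
proof (cases "s \<le> t")
  case True
  have "(f t)\<^sup>2 * exp (- 2 * M * t) \<le> (f s)\<^sup>2 * exp (- 2 * M * s)"
  proof (rule DERIV_nonpos_imp_nonincreasing[OF True], intro exI conjI)
    fix x
    show "((\<lambda>t. (f t)\<^sup>2 * exp (- 2 * M * t)) has_real_derivative
        2 * (c x - M) * (f x)\<^sup>2 * exp (- 2 * M * x)) (at x)"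
      by (rule derivative_eq_intros der refl | simp)+ (simp add: algebra_simps power2_eq_square)
    show "2 * (c x - M) * (f x)\<^sup>2 * exp (- 2 * M * x) \<le> 0"
    proof -
      have "2 * (c x - M) \<le> 0" using c[of x] by simp
      then have "2 * (c x - M) * (f x)\<^sup>2 \<le> 0" by (rule mult_nonpos_nonneg) simp
      then show ?thesis by (rule mult_nonpos_nonneg) simp
    qed
  qed
  then show ?thesis using assms(3) by (simp add: mult_le_0_iff)
next
  case False
  then have ts: "t \<le> s" by simp
  have "(f t)\<^sup>2 * exp (2 * M * t) \<le> (f s)\<^sup>2 * exp (2 * M * s)"
  proof (rule DERIV_nonneg_imp_nondecreasing[OF ts], intro exI conjI)
    fix x
    show "((\<lambda>t. (f t)\<^sup>2 * exp (2 * M * t)) has_real_derivative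
        2 * (c x + M) * (f x)\<^sup>2 * exp (2 * M * x)) (at x)"
      by (rule derivative_eq_intros der refl | simp)+ (simp add: algebra_simps power2_eq_square)
    show "2 * (c x + M) * (f x)\<^sup>2 * exp (2 * M * x) \<ge> 0"
    proof -
      have "2 * (c x + M) \<ge> 0" using c[of x] by simp
      then have "2 * (c x + M) * (f x)\<^sup>2 \<ge> 0" by (rule mult_nonneg_nonneg) simp
      then show ?thesis by (rule mult_nonneg_nonneg) simp
    qed
  qed
  then show ?thesis using assms(3) by (simp add: mult_le_0_iff)
qed

text \<open>A solution that changed sign would have a zero by the intermediate value theorem, and
  would then vanish identically.\<close>

lemma linear_ode_pos:
  fixes f c :: "real \<Rightarrow> real"
  assumes der: "\<And>t. (f has_real_derivative c t * f t) (at t)"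
    and c: "\<And>t. \<bar>c t\<bar> \<le> M" and "f s > 0"
  shows "f t > 0"
proof (rule ccontr)
  assume "\<not> f t > 0"
  have "continuous_on UNIV f"
    using der by (meson DERIV_isCont continuous_at_imp_continuous_on)
  then have "connected (range f)" by (intro connected_continuous_image) auto
  then have "0 \<in> range f"
    using connectedD_interval[of "range f" "f t" "f s" 0] \<open>\<not> f t > 0\<close> assms(3) by auto
  then obtain r where "f r = 0" by auto
  then show False using linear_ode_zero[OF der c, of r s] assms(3) by simp
qed

lemma polar_has_vector_derivative:
  assumes "(f has_real_derivative f') (at t)" "(g has_real_derivative g') (at t)"
  shows "((\<lambda>t. of_real (f t) * cis (g t)) has_vector_derivative
    of_real f' * cis (g t) + of_real (f t) * (\<i> * of_real g' * cis (g t))) (at t)"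
proof -
  have 1: "((\<lambda>t. complex_of_real (f t)) has_vector_derivative of_real f') (at t)"
    using assms(1) by (simp add: has_real_derivative_iff_has_vector_derivative has_vector_derivative_of_real)
  have "((\<lambda>t. cis (g t)) has_derivative (\<lambda>x. (x * g') *\<^sub>R (\<i> * cis (g t)))) (at t)"
    using assms(2) unfolding has_field_derivative_def by (auto intro!: derivative_eq_intros simp: mult.commute)
  then have 2: "((\<lambda>t. cis (g t)) has_vector_derivative (\<i> * of_real g' * cis (g t))) (at t)"
    unfolding has_vector_derivative_def by (simp add: scaleR_conv_of_real mult_ac)
  show ?thesis using has_vector_derivative_mult[OF 1 2] by (simp add: algebra_simps)
qed

section \<open>Regularity of the function F and explicit orbits\<close>

context resonant_cascade
begin

lemma angular_bound: "\<bar>angular z\<bar> \<le> suminf amp"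
  unfolding angular_def
  by (rule summable_amp_bounded(2)) (meson abs_Im_le_cmod norm_sgn_power_int_le order_trans)

lemma summable_angular: "summable (\<lambda>k. amp k * Im (sgn (fst z) ^ q k * sgn (snd z) powi (- p k)))"
  by (rule summable_amp_bounded(1)) (meson abs_Im_le_cmod norm_sgn_power_int_le order_trans)

lemma angular_polar:
  assumes "r1 > 0" "r2 > 0"
  shows "angular (of_real r1 * cis (2 * pi * \<omega>), of_real r2 * cis (2 * pi * \<theta>)) = psi \<omega> \<theta>"
proof -
  have s: "sgn (of_real r * cis a) = cis a" if "r > 0" for r a
    using that by (simp add: sgn_mult sgn_of_real)
  have "cis (2 * pi * \<omega>) ^ q k * cis (2 * pi * \<theta>) powi (- p k) = cis (2 * pi * phase k \<omega> \<theta>)" for k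
  proof -
    have "real (q k) * (2 * pi * \<omega>) + of_int (- p k) * (2 * pi * \<theta>) = 2 * pi * phase k \<omega> \<theta>"
      by (simp add: phase_def algebra_simps)
    then show ?thesis by (simp only: Complex.DeMoivre cis_power_int cis_mult)
  qed
  then show ?thesis using s assms by (simp add: angular_def psi_def)
qed

lemma F_polar:
  assumes "r1 \<ge> 0" "r2 \<ge> 0"
  shows "F (of_real r1 * cis (2 * pi * \<omega>), of_real r2 * cis (2 * pi * \<theta>)) =
    of_real r1 * cis (2 * pi * \<omega>) * (of_real r2 * cis (2 * pi * \<theta>)) * of_real (psi \<omega> \<theta>)"
  using assms angular_polar[of r1 r2 \<omega> \<theta>] by (cases "r1 = 0 \<or> r2 = 0") (auto simp: F_def)

lemma continuous_on_angular: "continuous_on {z. fst z \<noteq> 0 \<and> snd z \<noteq> 0} angular"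
proof -
  let ?U = "{z :: complex \<times> complex. fst z \<noteq> 0 \<and> snd z \<noteq> 0}"
  have "uniform_limit ?U (\<lambda>n z. \<Sum>k<n. amp k * Im (sgn (fst z) ^ q k * sgn (snd z) powi (- p k)))
     angular sequentially"
    unfolding angular_def
  proof (rule Weierstrass_m_test[OF _ summable_amp])
    fix k and z :: "complex \<times> complex"
    have "\<bar>Im (sgn (fst z) ^ q k * sgn (snd z) powi (- p k))\<bar> \<le> 1"
      by (meson abs_Im_le_cmod norm_sgn_power_int_le order_trans)
    then show "norm (amp k * Im (sgn (fst z) ^ q k * sgn (snd z) powi (- p k))) \<le> amp k"
      using mult_left_mono[of _ 1 "amp k"] amp_pos[of k] by (simp add: abs_mult)
  qed
  then show ?thesis
    by (rule uniform_limit_theorem[rotated])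
      (auto intro!: always_eventually continuous_intros simp: sgn_zero_iff)
qed

text \<open>The angular factor has no limit to rely on where a coordinate vanishes, but it is
  bounded, so there the product \<open>z1 * z2\<close> forces \<open>F\<close> to 0.\<close>

lemma continuous_on_F: "continuous_on UNIV F"
proof -
  have "isCont F z" for z
  proof (cases "fst z \<noteq> 0 \<and> snd z \<noteq> 0")
    case True
    have "open {z :: complex \<times> complex. fst z \<noteq> 0 \<and> snd z \<noteq> 0}"
      by (intro open_Collect_conj open_Collect_neq continuous_intros)
    then have "isCont angular z"
      using continuous_on_angular True by (metis (mono_tags, lifting) continuous_on_eq_continuous_at mem_Collect_eq)
    then have "isCont (\<lambda>z. fst z * snd z * of_real (angular z)) z"
      by (intro continuous_intros)
    then show ?thesis by (simp add: F_def case_prod_unfold)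
  next
    case False
    then have Fz: "F z = 0" by (auto simp: F_def case_prod_unfold)
    have "((\<lambda>w. norm (fst w * snd w) * suminf amp) \<longlongrightarrow> norm (fst z * snd z) * suminf amp) (at z)"
      by (intro tendsto_intros)
    then have lim: "((\<lambda>w. norm (fst w * snd w) * suminf amp) \<longlongrightarrow> 0) (at z)" using False by auto
    have "(F \<longlongrightarrow> 0) (at z)"
    proof (rule Lim_null_comparison[OF always_eventually lim], rule allI)
      fix w
      have "norm (F w) = norm (fst w * snd w) * \<bar>angular w\<bar>"
        by (simp add: F_def case_prod_unfold norm_mult)
      also have "\<dots> \<le> norm (fst w * snd w) * suminf amp"
        by (intro mult_left_mono angular_bound) simp
      finally show "norm (F w) \<le> norm (fst w * snd w) * suminf amp" .
    qed
    then show ?thesis by (simp add: isCont_def Fz)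
  qed
  then show ?thesis by (simp add: continuous_at_imp_continuous_on)
qed

lemma admissible_F: "admissible F"
  unfolding admissible_def
proof (intro conjI allI impI continuous_on_F)
  fix t1 t2 :: real and z1 z2
  assume "0 < t1" "0 < t2"
  then have "angular (of_real t1 * z1, of_real t2 * z2) = angular (z1, z2)"
    by (simp add: angular_def sgn_mult sgn_of_real)
  then show "F (of_real t1 * z1, of_real t2 * z2) = of_real t1 * of_real t2 * F (z1, z2)"
    by (simp add: F_def)
next
  fix z1 z2
  have "cnj z1 * cnj z2 * F (z1, z2) = (z1 * cnj z1) * (z2 * cnj z2) * of_real (angular (z1, z2))"
    by (simp add: F_def)
  also have "\<dots> \<in> \<real>" by (simp only: complex_norm_square[symmetric]) (auto simp flip: of_real_mult of_real_power)
  finally show "cnj z1 * cnj z2 * F (z1, z2) \<in> \<real>" .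
qed

text \<open>The Lipschitz constant grows only linearly in the frequencies. When one of the two
  products vanishes, boundedness of the angular factor is enough; otherwise the product at
  \<open>z\<close> supplies the modulus needed by \<open>norm_mult_sgn_diff\<close>.\<close>

lemma F_term_diff:
  fixes z w :: "complex \<times> complex" and m :: nat and n :: int
  defines "e \<equiv> \<lambda>z::complex \<times> complex. sgn (fst z) ^ m * sgn (snd z) powi n"
  assumes "z \<in> S3" "w \<in> S3"
  shows "norm (fst z * snd z * of_real (Im (e z)) - fst w * snd w * of_real (Im (e w)))
    \<le> 4 * ((real m + \<bar>of_int n\<bar> + 1) * dist z w)"
proof -
  have le1: "norm (fst v) \<le> 1" "norm (snd v) \<le> 1" if "v \<in> S3" for v
  proof -
    have "(cmod (fst v))\<^sup>2 + (cmod (snd v))\<^sup>2 = 1" using that by (auto simp: S3_def)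
    then have "(cmod (fst v))\<^sup>2 \<le> 1\<^sup>2" "(cmod (snd v))\<^sup>2 \<le> 1\<^sup>2"
      by (smt (verit) one_power2 zero_le_power2)+
    then show "norm (fst v) \<le> 1" "norm (snd v) \<le> 1" by (auto intro: power2_le_imp_le)
  qed
  define d where "d = dist z w"
  have d0: "d \<ge> 0" by (simp add: d_def)
  have d1: "norm (fst z - fst w) \<le> d" and d2: "norm (snd z - snd w) \<le> d"
    unfolding d_def using dist_fst_le[of z w] dist_snd_le[of z w] by (simp_all add: dist_norm)
  have prod: "norm (fst z * snd z - fst w * snd w) \<le> 2 * d"
  proof -
    have "fst z * snd z - fst w * snd w = (fst z - fst w) * snd z + fst w * (snd z - snd w)"
      by (simp add: algebra_simps)
    then have "norm (fst z * snd z - fst w * snd w) \<le> norm (fst z - fst w) * norm (snd z) + norm (fst w) * norm (snd z - snd w)"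
      by (metis norm_mult norm_triangle_ineq)
    also have "\<dots> \<le> d * 1 + 1 * d"
      using le1[OF assms(2)] le1[OF assms(3)] d0 d1 d2 by (intro add_mono mult_mono) auto
    finally show ?thesis by simp
  qed
  have Im1: "\<bar>Im (e v)\<bar> \<le> 1" for v
    unfolding e_def by (meson abs_Im_le_cmod norm_sgn_power_int_le order_trans)
  show ?thesis
  proof (cases "fst z * snd z = 0 \<or> fst w * snd w = 0")
    case True
    have scale: "norm (v * of_real (Im (e u))) \<le> norm v" for u and v :: complex
      using mult_left_mono[OF Im1[of u], of "norm v"] by (simp add: norm_mult)
    then have "norm (fst z * snd z * of_real (Im (e z)) - fst w * snd w * of_real (Im (e w)))
      \<le> norm (fst z * snd z - fst w * snd w)"
      using True scale[where v = "fst z * snd z" and u = z] scale[where v = "fst w * snd w" and u = w]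
      by (elim disjE) (simp_all only: mult_zero_left diff_0 diff_0_right norm_minus_cancel)
    also have "\<dots> \<le> 4 * (1 * d)" using prod d0 by simp
    also have "\<dots> \<le> 4 * ((real m + \<bar>of_int n\<bar> + 1) * d)"
      using d0 by (intro mult_left_mono mult_right_mono) auto
    finally show ?thesis by (simp add: d_def)
  next
    case False
    then have unit: "norm (sgn (fst z)) = 1" "norm (sgn (snd z)) = 1" "norm (sgn (fst w)) = 1" "norm (sgn (snd w)) = 1"
      by (auto simp: norm_sgn)
    have "e z - e w = (sgn (fst z) ^ m - sgn (fst w) ^ m) * sgn (snd z) powi n
       + sgn (fst w) ^ m * (sgn (snd z) powi n - sgn (snd w) powi n)"
      by (simp add: e_def algebra_simps)
    then have "norm (e z - e w) \<le> norm ((sgn (fst z) ^ m - sgn (fst w) ^ m) * sgn (snd z) powi n)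
       + norm (sgn (fst w) ^ m * (sgn (snd z) powi n - sgn (snd w) powi n))"
      by (simp only: norm_triangle_ineq)
    also have "\<dots> = norm (sgn (fst z) ^ m - sgn (fst w) ^ m) + norm (sgn (snd z) powi n - sgn (snd w) powi n)"
      by (simp only: norm_mult norm_power norm_power_int unit power_one power_int_1_left mult_1 mult_1_right)
    also have "\<dots> \<le> real m * norm (sgn (fst z) - sgn (fst w)) + \<bar>of_int n\<bar> * norm (sgn (snd z) - sgn (snd w))"
      using unit by (intro add_mono norm_power_diff unit_power_int_diff) auto
    finally have ee: "norm (e z - e w) \<le> \<dots>" .
    have "norm (fst z * snd z) * \<bar>Im (e z) - Im (e w)\<bar> \<le> norm (fst z * snd z) * norm (e z - e w)"
      by (intro mult_left_mono) (metis abs_Im_le_cmod minus_complex.sel(2), simp)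
    also have "\<dots> \<le> norm (fst z * snd z) * (real m * norm (sgn (fst z) - sgn (fst w)) + \<bar>of_int n\<bar> * norm (sgn (snd z) - sgn (snd w)))"
      by (intro mult_left_mono ee) simp
    also have "\<dots> = real m * ((norm (fst z) * norm (sgn (fst z) - sgn (fst w))) * norm (snd z))
       + \<bar>of_int n\<bar> * ((norm (snd z) * norm (sgn (snd z) - sgn (snd w))) * norm (fst z))"
      by (simp add: norm_mult algebra_simps)
    also have "\<dots> \<le> real m * ((2 * d) * 1) + \<bar>of_int n\<bar> * ((2 * d) * 1)"
    proof -
      have "norm (fst z) * norm (sgn (fst z) - sgn (fst w)) \<le> 2 * d"
        "norm (snd z) * norm (sgn (snd z) - sgn (snd w)) \<le> 2 * d"
        using norm_mult_sgn_diff[of "fst z" "fst w"] norm_mult_sgn_diff[of "snd z" "snd w"] d1 d2 by linarith+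
      then show ?thesis using le1[OF assms(2)] d0
        by (intro add_mono mult_left_mono[OF mult_mono]) auto
    qed
    finally have part: "norm (fst z * snd z) * \<bar>Im (e z) - Im (e w)\<bar> \<le> (real m + \<bar>of_int n\<bar>) * (2 * d)"
      by (simp add: algebra_simps)
    have "fst z * snd z * of_real (Im (e z)) - fst w * snd w * of_real (Im (e w))
       = fst z * snd z * of_real (Im (e z) - Im (e w)) + (fst z * snd z - fst w * snd w) * of_real (Im (e w))"
      by (simp add: algebra_simps)
    then have "norm (fst z * snd z * of_real (Im (e z)) - fst w * snd w * of_real (Im (e w)))
       \<le> norm (fst z * snd z) * \<bar>Im (e z) - Im (e w)\<bar> + norm (fst z * snd z - fst w * snd w) * \<bar>Im (e w)\<bar>"
      by (metis norm_mult norm_of_real norm_triangle_ineq)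
    also have "\<dots> \<le> (real m + \<bar>of_int n\<bar>) * (2 * d) + (2 * d) * 1"
      by (rule add_mono[OF part mult_mono[OF prod Im1]]) (use d0 in auto)
    also have "\<dots> \<le> 4 * ((real m + \<bar>of_int n\<bar> + 1) * d)"
      using d0 by (simp add: algebra_simps)
    finally show ?thesis by (simp add: d_def)
  qed
qed

text \<open>Interpolation term by term: each term changes by at most 2 and by at most 4 * L k * dist
  z w, hence by at most 4 * (L k * dist z w) powr \<gamma>, whether or not L k * dist z w reaches 1.
  Summing with the weights \<open>amp k\<close> gives the Hoelder constant.\<close>

lemma hoelder_F:
  assumes \<gamma>: "0 < \<gamma>" "\<gamma> \<le> 1"
    and summ: "summable (\<lambda>k. amp k * (real (q k) + \<bar>of_int (p k)\<bar> + 1) powr \<gamma>)"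
  shows "hoelder_on \<gamma> S3 F"
proof -
  define L where "L k = real (q k) + \<bar>of_int (p k)\<bar> + 1" for k
  define g where "g k z = fst z * snd z * of_real (Im (sgn (fst z) ^ q k * sgn (snd z) powi (- p k)))"
    for k and z :: "complex \<times> complex"
  have L1: "L k \<ge> 1" for k by (simp add: L_def)
  have sums: "(\<lambda>k. of_real (amp k) * g k z) sums F z" for z
  proof -
    have "(\<lambda>k. complex_of_real (amp k * Im (sgn (fst z) ^ q k * sgn (snd z) powi (- p k)))) sums of_real (angular z)"
      unfolding angular_def by (intro sums_of_real summable_sums summable_angular)
    from sums_mult[OF this, of "fst z * snd z"] show ?thesis
      by (simp add: F_def g_def case_prod_unfold mult_ac)
  qed
  have "dist (F z) (F w) \<le> (4 * (\<Sum>k. amp k * L k powr \<gamma>)) * dist z w powr \<gamma>"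
    if zw: "z \<in> S3" "w \<in> S3" for z w
  proof -
    have le1: "norm (g k v) \<le> 1" if "v \<in> S3" for k v
    proof -
      have "(cmod (fst v))\<^sup>2 + (cmod (snd v))\<^sup>2 = 1" using that by (auto simp: S3_def)
      moreover have "2 * (cmod (fst v) * cmod (snd v)) \<le> (cmod (fst v))\<^sup>2 + (cmod (snd v))\<^sup>2"
        using sum_squares_bound[of "cmod (fst v)" "cmod (snd v)"] by simp
      ultimately have "cmod (fst v) * cmod (snd v) \<le> 1" by linarith
      moreover have "\<bar>Im (sgn (fst v) ^ q k * sgn (snd v) powi (- p k))\<bar> \<le> 1"
        by (meson abs_Im_le_cmod norm_sgn_power_int_le order_trans)
      ultimately have "(cmod (fst v) * cmod (snd v)) * \<bar>Im (sgn (fst v) ^ q k * sgn (snd v) powi (- p k))\<bar> \<le> 1 * 1"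
        by (intro mult_mono) auto
      then show ?thesis by (simp only: g_def norm_mult norm_of_real mult_1)
    qed
    have gd: "norm (g k z - g k w) \<le> 4 * (L k powr \<gamma> * dist z w powr \<gamma>)" for k
    proof -
      have lip: "norm (g k z - g k w) \<le> 4 * (L k * dist z w)"
        using F_term_diff[OF zw, of "q k" "- p k"] by (simp add: g_def L_def)
      have two: "norm (g k z - g k w) \<le> 2"
        using norm_triangle_ineq4[of "g k z" "g k w"] le1[OF zw(1), of k] le1[OF zw(2), of k] by linarith
      have pw: "L k powr \<gamma> * dist z w powr \<gamma> = (L k * dist z w) powr \<gamma>"
        using L1[of k] by (simp add: powr_mult)
      show ?thesis
      proof (cases "L k * dist z w \<ge> 1")
        case True
        then have "1 \<le> (L k * dist z w) powr \<gamma>" using \<gamma> by (simp add: ge_one_powr_ge_zero)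
        then show ?thesis using two unfolding pw by linarith
      next
        case False
        then have "(L k * dist z w) powr 1 \<le> (L k * dist z w) powr \<gamma>"
          using \<gamma> L1[of k] by (intro powr_mono') auto
        then have "L k * dist z w \<le> (L k * dist z w) powr \<gamma>" using L1[of k] by simp
        then show ?thesis using lip unfolding pw by linarith
      qed
    qed
    have "(\<lambda>k. of_real (amp k) * g k z - of_real (amp k) * g k w) sums (F z - F w)"
      by (rule sums_diff[OF sums sums])
    then have eq: "F z - F w = (\<Sum>k. of_real (amp k) * (g k z - g k w))"
      by (simp add: sums_unique right_diff_distrib)
    have summ': "summable (\<lambda>k. amp k * L k powr \<gamma> * (4 * dist z w powr \<gamma>))"
      using summ by (intro summable_mult2) (simp add: L_def)
    have "norm (F z - F w) \<le> (\<Sum>k. amp k * L k powr \<gamma> * (4 * dist z w powr \<gamma>))"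
      unfolding eq
    proof (rule norm_suminf_le[OF _ summ'])
      fix k
      have "norm (of_real (amp k) * (g k z - g k w)) = amp k * norm (g k z - g k w)"
        using amp_pos[of k] by (simp add: norm_mult)
      also have "\<dots> \<le> amp k * (4 * (L k powr \<gamma> * dist z w powr \<gamma>))"
        by (intro mult_left_mono gd) (use amp_pos[of k] in simp)
      finally show "norm (of_real (amp k) * (g k z - g k w)) \<le> amp k * L k powr \<gamma> * (4 * dist z w powr \<gamma>)"
        by (simp add: mult_ac)
    qed
    also have "\<dots> = (\<Sum>k. amp k * L k powr \<gamma>) * (4 * dist z w powr \<gamma>)"
      using summ by (intro suminf_mult2[symmetric]) (simp add: L_def)
    finally show ?thesis by (simp add: dist_norm mult_ac)
  qed
  then show ?thesis unfolding hoelder_on_def by blast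
qed

text \<open>The second modulus is multiplied by the exponential of the height and the pair is
  normalised again. Unlike the logarithmic coordinate, this form also makes sense on the two
  circles, where one radius is 0.\<close>

definition orbit :: "real \<Rightarrow> real \<Rightarrow> real \<Rightarrow> real \<Rightarrow> real \<Rightarrow> complex \<times> complex" where
  "orbit r1 r2 \<omega> \<theta> t =
     (let s = r2 * exp (height t \<omega> \<theta>); n = sqrt (r1\<^sup>2 + s\<^sup>2)
      in (of_real (r1 / n) * cis (2 * pi * (\<omega> + \<alpha> * t)), of_real (s / n) * cis (2 * pi * (\<theta> + t))))"

text \<open>The logarithmic derivative of \<open>s\<close> is \<open>psi\<close> along the base
  flow. Normalisation splits it into the radial rates - \<open>psi\<close> times the square of the
  second modulus and + \<open>psi\<close> times the square of the first, which are those produced by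
  \<open>F\<close> and the conjugates in the vector field.\<close>

lemma orbit_has_vector_derivative:
  assumes "r1 \<ge> 0" "r2 \<ge> 0" "r1\<^sup>2 + r2\<^sup>2 = 1"
  shows "(orbit r1 r2 \<omega> \<theta> has_vector_derivative vector_field \<alpha> F (orbit r1 r2 \<omega> \<theta> t)) (at t)"
proof -
  define s where "s t = r2 * exp (height t \<omega> \<theta>)" for t
  define n where "n t = sqrt (r1\<^sup>2 + (s t)\<^sup>2)" for t
  define h' where "h' t = psi (\<omega> + \<alpha> * t) (\<theta> + t)" for t
  have ds: "(s has_real_derivative s t * h' t) (at t)" for t
  proof -
    have "s = (\<lambda>t. r2 * exp (height t \<omega> \<theta>))" by (rule ext) (rule s_def)
    then have "(s has_real_derivative r2 * (exp (height t \<omega> \<theta>) * h' t)) (at t)"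
      unfolding h'_def by (simp only: DERIV_cmult[OF DERIV_fun_exp[OF height_has_derivative]])
    then show ?thesis by (simp only: s_def mult.assoc)
  qed
  have pos: "r1\<^sup>2 + (s t)\<^sup>2 > 0" for t
  proof (cases "r1 = 0")
    case True
    then have "r2 \<noteq> 0" using assms by auto
    then show ?thesis by (simp add: s_def True)
  next
    case False
    then show ?thesis by (simp add: add_pos_nonneg)
  qed
  then have n0: "n t > 0" for t by (simp add: n_def)
  have n2: "(n t)\<^sup>2 = r1\<^sup>2 + (s t)\<^sup>2" for t by (simp add: n_def)
  have dn: "(n has_real_derivative (s t)\<^sup>2 * h' t / n t) (at t)" for t
  proof -
    have "((\<lambda>t. r1\<^sup>2 + (s t)\<^sup>2) has_real_derivative 2 * s t * (s t * h' t)) (at t)"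
      using DERIV_add[OF DERIV_const[of "r1\<^sup>2"] DERIV_power[OF ds[of t], of 2]] by (simp add: mult_ac)
    from DERIV_chain2[OF DERIV_real_sqrt[OF pos] this]
    have "(n has_real_derivative inverse (n t) / 2 * (2 * s t * (s t * h' t))) (at t)"
      unfolding n_def[abs_def] .
    moreover have "inverse (n t) / 2 * (2 * s t * (s t * h' t)) = (s t)\<^sup>2 * h' t / n t"
      using n0[of t] by (simp add: field_simps power2_eq_square)
    ultimately show ?thesis by simp
  qed
  define f1 where "f1 t = r1 / n t" for t
  define f2 where "f2 t = s t / n t" for t
  have f12: "(f1 t)\<^sup>2 + (f2 t)\<^sup>2 = 1" for t
  proof -
    have "(f1 t)\<^sup>2 + (f2 t)\<^sup>2 = (n t)\<^sup>2 / (n t)\<^sup>2"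
      unfolding f1_def f2_def power_divide by (simp only: n2 add_divide_distrib)
    then show ?thesis using n0[of t] by simp
  qed
  have df1: "(f1 has_real_derivative - f1 t * (f2 t)\<^sup>2 * h' t) (at t)" for t
  proof -
    have "(f1 has_real_derivative (0 * n t - r1 * ((s t)\<^sup>2 * h' t / n t)) / (n t * n t)) (at t)"
      unfolding f1_def by (rule DERIV_divide[OF DERIV_const dn]) (use n0[of t] in simp)
    moreover have "(0 * n t - r1 * ((s t)\<^sup>2 * h' t / n t)) / (n t * n t) = - f1 t * (f2 t)\<^sup>2 * h' t"
      unfolding f1_def f2_def using n0[of t] by (simp add: field_simps power2_eq_square)
    ultimately show ?thesis by simp
  qed
  have df2: "(f2 has_real_derivative f2 t * (f1 t)\<^sup>2 * h' t) (at t)" for t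
  proof -
    have "(f2 has_real_derivative (s t * h' t * n t - s t * ((s t)\<^sup>2 * h' t / n t)) / (n t * n t)) (at t)"
      unfolding f2_def by (rule DERIV_divide[OF ds dn]) (use n0[of t] in simp)
    moreover have "(s t * h' t * n t - s t * ((s t)\<^sup>2 * h' t / n t)) / (n t * n t) = f2 t * (1 - (f2 t)\<^sup>2) * h' t"
      unfolding f2_def using n0[of t] by (simp add: field_simps power2_eq_square)
    moreover have "1 - (f2 t)\<^sup>2 = (f1 t)\<^sup>2" using f12[of t] by simp
    ultimately show ?thesis by simp
  qed
  have o: "orbit r1 r2 \<omega> \<theta> = (\<lambda>t. (of_real (f1 t) * cis (2 * pi * (\<omega> + \<alpha> * t)), of_real (f2 t) * cis (2 * pi * (\<theta> + t))))"
    by (simp add: fun_eq_iff orbit_def Let_def f1_def f2_def n_def s_def)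
  have f0: "f1 t \<ge> 0" "f2 t \<ge> 0" using assms n0[of t] by (simp_all add: f1_def f2_def s_def)
  have g1: "((\<lambda>t. 2 * pi * (\<omega> + \<alpha> * t)) has_real_derivative 2 * pi * \<alpha>) (at t)"
    and g2: "((\<lambda>t. 2 * pi * (\<theta> + t)) has_real_derivative 2 * pi) (at t)"
    by (rule derivative_eq_intros refl | simp)+
  have cc: "cis a * cnj (cis a) = 1" for a by (simp add: cis_cnj cis_mult)
  have "(orbit r1 r2 \<omega> \<theta> has_vector_derivative
     (of_real (- f1 t * (f2 t)\<^sup>2 * h' t) * cis (2 * pi * (\<omega> + \<alpha> * t)) + of_real (f1 t) * (\<i> * of_real (2 * pi * \<alpha>) * cis (2 * pi * (\<omega> + \<alpha> * t))),
      of_real (f2 t * (f1 t)\<^sup>2 * h' t) * cis (2 * pi * (\<theta> + t)) + of_real (f2 t) * (\<i> * of_real (2 * pi) * cis (2 * pi * (\<theta> + t))))) (at t)"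
    unfolding o
    by (intro has_vector_derivative_Pair polar_has_vector_derivative df1 df2 g1 g2)
  moreover have "vector_field \<alpha> F (orbit r1 r2 \<omega> \<theta> t) =
     (of_real (- f1 t * (f2 t)\<^sup>2 * h' t) * cis (2 * pi * (\<omega> + \<alpha> * t)) + of_real (f1 t) * (\<i> * of_real (2 * pi * \<alpha>) * cis (2 * pi * (\<omega> + \<alpha> * t))),
      of_real (f2 t * (f1 t)\<^sup>2 * h' t) * cis (2 * pi * (\<theta> + t)) + of_real (f2 t) * (\<i> * of_real (2 * pi) * cis (2 * pi * (\<theta> + t))))"
  proof -
    define c1 where "c1 = cis (2 * pi * (\<omega> + \<alpha> * t))"
    define c2 where "c2 = cis (2 * pi * (\<theta> + t))"
    define x1 where "x1 = complex_of_real (f1 t)"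
    define x2 where "x2 = complex_of_real (f2 t)"
    define y where "y = complex_of_real (h' t)"
    have c: "c1 * cnj c1 = 1" "c2 * cnj c2 = 1" by (simp_all only: c1_def c2_def cc)
    have x: "cnj x1 = x1" "cnj x2 = x2" by (simp_all add: x1_def x2_def)
    have Fx: "F (x1 * c1, x2 * c2) = x1 * c1 * (x2 * c2) * y"
      unfolding x1_def x2_def y_def c1_def c2_def h'_def by (rule F_polar[OF f0])
    have "F (x1 * c1, x2 * c2) * cnj (x2 * c2) = x1 * x2\<^sup>2 * y * c1 * (c2 * cnj c2)"
      unfolding Fx by (simp add: x power2_eq_square)
    moreover have "F (x1 * c1, x2 * c2) * cnj (x1 * c1) = x2 * x1\<^sup>2 * y * c2 * (c1 * cnj c1)"
      unfolding Fx by (simp add: x power2_eq_square)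
    ultimately have "vector_field \<alpha> F (x1 * c1, x2 * c2) =
      (- x1 * x2\<^sup>2 * y * c1 + x1 * (\<i> * of_real (2 * pi * \<alpha>) * c1),
       x2 * x1\<^sup>2 * y * c2 + x2 * (\<i> * of_real (2 * pi) * c2))"
      unfolding vector_field_def by (simp add: c)
    then show ?thesis unfolding o x1_def x2_def y_def c1_def c2_def by simp
  qed
  ultimately show ?thesis by simp
qed

end

section \<open>Existence and uniqueness of the flow\<close>

lemma S3_eq: "S3 = {z. (cmod (fst z))\<^sup>2 + (cmod (snd z))\<^sup>2 = 1}"
  by (auto simp: S3_def)

context resonant_cascade
begin

text \<open>Once the rotation is unwound, real and imaginary parts of the coordinates solve real
  linear equations with coefficients that depend on the unknown solution. Imaginary parts therefore
  stay 0 and real parts keep their sign, so the angles of any solution are known. The angular factor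
  is then \<open>psi\<close> along the base flow wherever both coordinates are nonzero, which
  determines the ratio of the moduli; the norm determines the rest.\<close>

lemma solution_unique:
  assumes sol: "solves_from \<alpha> F (of_real r1 * cis (2 * pi * \<omega>), of_real r2 * cis (2 * pi * \<theta>)) u"
    and r: "r1 \<ge> 0" "r2 \<ge> 0" "r1\<^sup>2 + r2\<^sup>2 = 1"
  shows "u t = orbit r1 r2 \<omega> \<theta> t"
proof -
  define u1 where "u1 t = fst (u t)" for t
  define u2 where "u2 t = snd (u t)" for t
  define g where "g t = angular (u t)" for t
  have u: "u t = (u1 t, u2 t)" for t by (simp add: u1_def u2_def)
  have du: "(u has_vector_derivative vector_field \<alpha> F (u t)) (at t)" for t
    using sol by (simp add: solves_from_def)
  have u0: "u1 0 = of_real r1 * cis (2 * pi * \<omega>)" "u2 0 = of_real r2 * cis (2 * pi * \<theta>)"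
    using sol by (simp_all add: solves_from_def u1_def u2_def)
  have sq: "z * cnj z = of_real ((cmod z)\<^sup>2)" for z
    by (metis complex_norm_square of_real_power)
  have vf: "vector_field \<alpha> F (u t) =
     ((2 * of_real pi * \<i> * of_real \<alpha> - of_real ((cmod (u2 t))\<^sup>2 * g t)) * u1 t,
      (2 * of_real pi * \<i> + of_real ((cmod (u1 t))\<^sup>2 * g t)) * u2 t)" for t
  proof -
    have "F (u t) * cnj (u2 t) = u1 t * (u2 t * cnj (u2 t)) * of_real (g t)"
      "F (u t) * cnj (u1 t) = u2 t * (u1 t * cnj (u1 t)) * of_real (g t)"
      by (simp_all add: F_def u g_def)
    then have "F (u t) * cnj (u2 t) = of_real ((cmod (u2 t))\<^sup>2 * g t) * u1 t"
      "F (u t) * cnj (u1 t) = of_real ((cmod (u1 t))\<^sup>2 * g t) * u2 t"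
      unfolding sq by (simp_all add: mult_ac)
    then show ?thesis by (simp add: vector_field_def u algebra_simps)
  qed
  have du1: "(u1 has_vector_derivative (2 * of_real pi * \<i> * of_real \<alpha> - of_real ((cmod (u2 t))\<^sup>2 * g t)) * u1 t) (at t)" for t
    using bounded_linear.has_vector_derivative[OF bounded_linear_fst du[of t]] unfolding vf u1_def[abs_def] by simp
  have du2: "(u2 has_vector_derivative (2 * of_real pi * \<i> + of_real ((cmod (u1 t))\<^sup>2 * g t)) * u2 t) (at t)" for t
    using bounded_linear.has_vector_derivative[OF bounded_linear_snd du[of t]] unfolding vf u2_def[abs_def] by simp
  define e1 where "e1 t = cis (- (2 * pi * (\<omega> + \<alpha> * t)))" for t
  define e2 where "e2 t = cis (- (2 * pi * (\<theta> + t)))" for t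
  have cisd: "((\<lambda>t. cis (a t)) has_vector_derivative \<i> * of_real a' * cis (a t)) (at t)"
    if "(a has_real_derivative a') (at t)" for a a' t
    using polar_has_vector_derivative[OF DERIV_const that, of 1] by simp
  have "((\<lambda>t. - (2 * pi * (\<omega> + \<alpha> * t))) has_real_derivative - (2 * pi * \<alpha>)) (at t)" for t
    by (rule derivative_eq_intros refl | simp)+
  from cisd[OF this] have de1: "(e1 has_vector_derivative \<i> * of_real (- (2 * pi * \<alpha>)) * e1 t) (at t)" for t
    by (simp add: e1_def[abs_def])
  have "((\<lambda>t. - (2 * pi * (\<theta> + t))) has_real_derivative - (2 * pi)) (at t)" for t
    by (rule derivative_eq_intros refl | simp)+
  from cisd[OF this] have de2: "(e2 has_vector_derivative \<i> * of_real (- (2 * pi)) * e2 t) (at t)" for t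
    by (simp add: e2_def[abs_def])
  define w1 where "w1 t = u1 t * e1 t" for t
  define w2 where "w2 t = u2 t * e2 t" for t
  have ne: "cmod (e1 t) = 1" "cmod (e2 t) = 1" for t by (simp_all add: e1_def e2_def)
  have nw: "cmod (w1 t) = cmod (u1 t)" "cmod (w2 t) = cmod (u2 t)" for t
    by (simp_all add: w1_def w2_def norm_mult ne)
  have dw1: "(w1 has_vector_derivative of_real (- ((cmod (w2 t))\<^sup>2 * g t)) * w1 t) (at t)" for t
    using has_vector_derivative_mult[OF du1[of t] de1[of t]] unfolding w1_def[abs_def] nw
    by (simp add: algebra_simps)
  have dw2: "(w2 has_vector_derivative of_real ((cmod (w1 t))\<^sup>2 * g t) * w2 t) (at t)" for t
    using has_vector_derivative_mult[OF du2[of t] de2[of t]] unfolding w2_def[abs_def] nw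
    by (simp add: algebra_simps)
  have Re: "((\<lambda>t. Re (w t)) has_real_derivative c * Re (w t)) (at t)"
    and Im: "((\<lambda>t. Im (w t)) has_real_derivative c * Im (w t)) (at t)"
    if "(w has_vector_derivative of_real c * w t) (at t)" for w c t
    using bounded_linear.has_vector_derivative[OF bounded_linear_Re that]
      bounded_linear.has_vector_derivative[OF bounded_linear_Im that]
    by (simp_all add: has_real_derivative_iff_has_vector_derivative)
  define a1 where "a1 t = Re (w1 t)" for t
  define b1 where "b1 t = Im (w1 t)" for t
  define a2 where "a2 t = Re (w2 t)" for t
  define b2 where "b2 t = Im (w2 t)" for t
  define c1 where "c1 t = - ((cmod (w2 t))\<^sup>2 * g t)" for t
  define c2 where "c2 t = (cmod (w1 t))\<^sup>2 * g t" for t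
  have da1: "(a1 has_real_derivative c1 t * a1 t) (at t)" for t
    using Re[OF dw1] unfolding a1_def[abs_def] c1_def by simp
  have db1: "(b1 has_real_derivative c1 t * b1 t) (at t)" for t
    using Im[OF dw1] unfolding b1_def[abs_def] c1_def by simp
  have da2: "(a2 has_real_derivative c2 t * a2 t) (at t)" for t
    using Re[OF dw2] unfolding a2_def[abs_def] c2_def by simp
  have db2: "(b2 has_real_derivative c2 t * b2 t) (at t)" for t
    using Im[OF dw2] unfolding b2_def[abs_def] c2_def by simp
  have n1: "(cmod (w1 t))\<^sup>2 = (a1 t)\<^sup>2 + (b1 t)\<^sup>2" and n2: "(cmod (w2 t))\<^sup>2 = (a2 t)\<^sup>2 + (b2 t)\<^sup>2" for t
    by (simp_all add: cmod_power2 a1_def b1_def a2_def b2_def)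
  have "w1 0 = of_real r1" "w2 0 = of_real r2"
    by (simp_all add: w1_def w2_def u0 e1_def e2_def cis_mult)
  then have init: "a1 0 = r1" "b1 0 = 0" "a2 0 = r2" "b2 0 = 0"
    by (simp_all add: a1_def b1_def a2_def b2_def)
  \<comment> \<open>Conservation of the norm has to precede the use of the linear equations: it
    bounds their coefficients \<open>c1\<close> and \<open>c2\<close>. It holds because the
    contributions of the two coordinates cancel.\<close>
  have "((\<lambda>t. (a1 t)\<^sup>2 + (b1 t)\<^sup>2 + ((a2 t)\<^sup>2 + (b2 t)\<^sup>2)) has_real_derivative 0) (at t)" for t
  proof -
    have "((\<lambda>t. (a1 t)\<^sup>2 + (b1 t)\<^sup>2 + ((a2 t)\<^sup>2 + (b2 t)\<^sup>2)) has_real_derivative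
       2 * a1 t * (c1 t * a1 t) + 2 * b1 t * (c1 t * b1 t) + (2 * a2 t * (c2 t * a2 t) + 2 * b2 t * (c2 t * b2 t))) (at t)"
      by (intro DERIV_add) (use DERIV_power[OF da1[of t], of 2] DERIV_power[OF db1[of t], of 2]
        DERIV_power[OF da2[of t], of 2] DERIV_power[OF db2[of t], of 2] in \<open>simp_all add: mult_ac\<close>)
    moreover have "2 * a1 t * (c1 t * a1 t) + 2 * b1 t * (c1 t * b1 t) + (2 * a2 t * (c2 t * a2 t) + 2 * b2 t * (c2 t * b2 t))
       = 2 * c1 t * ((a1 t)\<^sup>2 + (b1 t)\<^sup>2) + 2 * c2 t * ((a2 t)\<^sup>2 + (b2 t)\<^sup>2)"
      by (simp add: power2_eq_square algebra_simps)
    moreover have "\<dots> = 0" unfolding c1_def c2_def n1 n2 by (simp add: algebra_simps)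
    ultimately show ?thesis by simp
  qed
  then have "(a1 t)\<^sup>2 + (b1 t)\<^sup>2 + ((a2 t)\<^sup>2 + (b2 t)\<^sup>2) = (a1 0)\<^sup>2 + (b1 0)\<^sup>2 + ((a2 0)\<^sup>2 + (b2 0)\<^sup>2)" for t
    using DERIV_isconst_all[of "\<lambda>t. (a1 t)\<^sup>2 + (b1 t)\<^sup>2 + ((a2 t)\<^sup>2 + (b2 t)\<^sup>2)" t 0] by blast
  then have cons: "(a1 t)\<^sup>2 + (b1 t)\<^sup>2 + ((a2 t)\<^sup>2 + (b2 t)\<^sup>2) = 1" for t using r by (simp add: init)
  define M where "M = suminf amp"
  have gM: "\<bar>g t\<bar> \<le> M" for t unfolding g_def M_def by (rule angular_bound)
  have small: "\<bar>x * y\<bar> \<le> M" if "0 \<le> x" "x \<le> 1" "\<bar>y\<bar> \<le> M" for x y :: real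
  proof -
    have "\<bar>x * y\<bar> \<le> 1 * M" unfolding abs_mult using that by (intro mult_mono) auto
    then show ?thesis by simp
  qed
  have "(cmod (w1 t))\<^sup>2 \<le> 1" "(cmod (w2 t))\<^sup>2 \<le> 1" for t
    using cons[of t] unfolding n1 n2 by (smt (verit) zero_le_power2)+
  then have cM: "\<bar>c1 t\<bar> \<le> M" "\<bar>c2 t\<bar> \<le> M" for t
    unfolding c1_def c2_def abs_minus_cancel by (auto intro!: small gM)
  have b0: "b1 t = 0" "b2 t = 0" for t
    using linear_ode_zero[OF db1 cM(1) init(2)] linear_ode_zero[OF db2 cM(2) init(4)] by auto
  have a1: "r1 = 0 \<Longrightarrow> a1 t = 0" "r1 > 0 \<Longrightarrow> a1 t > 0" for t
    using linear_ode_zero[OF da1 cM(1), of 0] linear_ode_pos[OF da1 cM(1), of 0] init by auto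
  have a2: "r2 = 0 \<Longrightarrow> a2 t = 0" "r2 > 0 \<Longrightarrow> a2 t > 0" for t
    using linear_ode_zero[OF da2 cM(2), of 0] linear_ode_pos[OF da2 cM(2), of 0] init by auto
  have a0: "a1 t \<ge> 0" "a2 t \<ge> 0" for t
    using a1[of t] a2[of t] r by (cases "r1 = 0"; cases "r2 = 0"; simp)+
  have ua: "u1 t = of_real (a1 t) * cis (2 * pi * (\<omega> + \<alpha> * t))" "u2 t = of_real (a2 t) * cis (2 * pi * (\<theta> + t))" for t
  proof -
    have "w1 t = of_real (a1 t)" "w2 t = of_real (a2 t)"
      using b0[of t] by (simp_all add: a1_def b1_def a2_def b2_def complex_eq_iff)
    moreover have "u1 t = w1 t * cis (2 * pi * (\<omega> + \<alpha> * t))" "u2 t = w2 t * cis (2 * pi * (\<theta> + t))"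
      by (simp_all add: w1_def w2_def e1_def e2_def cis_mult mult.assoc)
    ultimately show "u1 t = of_real (a1 t) * cis (2 * pi * (\<omega> + \<alpha> * t))"
      "u2 t = of_real (a2 t) * cis (2 * pi * (\<theta> + t))" by simp_all
  qed
  define h where "h t = height t \<omega> \<theta>" for t
  define h' where "h' t = psi (\<omega> + \<alpha> * t) (\<theta> + t)" for t
  have dh: "(h has_real_derivative h' t) (at t)" for t
    using height_has_derivative[of \<omega> \<theta> t] unfolding h_def[abs_def] h'_def .
  have ratio: "a2 t * r1 = a1 t * (r2 * exp (h t))" for t
  proof (cases "r1 > 0 \<and> r2 > 0")
    case False
    then have "r1 = 0 \<or> r2 = 0" using r by auto
    then show ?thesis using a1(1)[of t] a2(1)[of t] by auto
  next
    case True
    have gh: "g t = h' t" for t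
      unfolding g_def h'_def u ua using a1(2)[of t] a2(2)[of t] True by (intro angular_polar) auto
    \<comment> \<open>\<open>D\<close> measures the deviation from the expected ratio of moduli, in
      a form free of division. It starts at 0 and solves a bounded linear equation, hence
      vanishes.\<close>
    define D where "D t = a2 t * r1 * exp (- h t) - a1 t * r2" for t
    define k where "k t = - ((a2 t)\<^sup>2 * h' t)" for t
    have "(D has_real_derivative k t * D t) (at t)" for t
    proof -
      have "((\<lambda>t. exp (- h t)) has_real_derivative exp (- h t) * (- h' t)) (at t)"
        by (rule DERIV_fun_exp[OF DERIV_minus[OF dh]])
      from DERIV_diff[OF DERIV_mult[OF DERIV_cmult_right[OF da2[of t], of r1] this] DERIV_cmult_right[OF da1[of t], of r2]]
      have "(D has_real_derivative c2 t * a2 t * r1 * exp (- h t) + exp (- h t) * - h' t * (a2 t * r1) - c1 t * a1 t * r2) (at t)"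
        by (simp add: D_def[abs_def])
      moreover have "c2 t * a2 t * r1 * exp (- h t) + exp (- h t) * - h' t * (a2 t * r1) - c1 t * a1 t * r2 = k t * D t"
      proof -
        have "(a1 t)\<^sup>2 = 1 - (a2 t)\<^sup>2" using cons[of t] b0[of t] by simp
        then have c: "c1 t = - ((a2 t)\<^sup>2 * h' t)" "c2 t = (1 - (a2 t)\<^sup>2) * h' t"
          by (simp_all add: c1_def c2_def n1 n2 b0 gh)
        show ?thesis unfolding c D_def k_def by (simp add: algebra_simps)
      qed
      ultimately show ?thesis by simp
    qed
    moreover have "\<bar>k t\<bar> \<le> M" for t
    proof -
      have "(a2 t)\<^sup>2 \<le> 1" using cons[of t] by (smt (verit) zero_le_power2)
      moreover have "\<bar>h' t\<bar> \<le> M" unfolding h'_def M_def by (rule psi_bound)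
      ultimately show ?thesis unfolding k_def abs_minus_cancel by (intro small) auto
    qed
    moreover have "D 0 = 0" by (simp add: D_def init h_def)
    ultimately have "D t = 0" by (rule linear_ode_zero)
    then show ?thesis by (simp add: D_def exp_minus field_simps)
  qed
  define s where "s = r2 * exp (h t)"
  define n where "n = sqrt (r1\<^sup>2 + s\<^sup>2)"
  have s0: "s \<ge> 0" using r by (simp add: s_def)
  have "r1\<^sup>2 + s\<^sup>2 > 0"
  proof (cases "r1 = 0")
    case True
    then have "r2 \<noteq> 0" using r by auto
    then show ?thesis by (simp add: s_def True)
  qed (simp add: add_pos_nonneg)
  then have n0: "n > 0" and nn: "n\<^sup>2 = r1\<^sup>2 + s\<^sup>2" by (simp_all add: n_def)
  have cons': "(a1 t)\<^sup>2 + (a2 t)\<^sup>2 = 1" using cons[of t] b0 by simp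
  have rat: "a2 t * r1 = a1 t * s" using ratio[of t] by (simp add: s_def)
  have "(a1 t * n)\<^sup>2 = (a1 t)\<^sup>2 * r1\<^sup>2 + (a1 t * s)\<^sup>2" by (simp add: power_mult_distrib nn distrib_left)
  also have "\<dots> = ((a1 t)\<^sup>2 + (a2 t)\<^sup>2) * r1\<^sup>2" unfolding rat[symmetric] by (simp add: power_mult_distrib distrib_right)
  finally have "(a1 t * n)\<^sup>2 = r1\<^sup>2" by (simp add: cons')
  then have e1: "a1 t * n = r1" using a0[of t] n0 r by (simp add: power2_eq_iff_nonneg)
  have "(a2 t * n)\<^sup>2 = (a2 t * r1)\<^sup>2 + (a2 t)\<^sup>2 * s\<^sup>2" by (simp add: power_mult_distrib nn distrib_left)
  also have "\<dots> = ((a1 t)\<^sup>2 + (a2 t)\<^sup>2) * s\<^sup>2" unfolding rat by (simp add: power_mult_distrib distrib_right)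
  finally have "(a2 t * n)\<^sup>2 = s\<^sup>2" by (simp add: cons')
  then have e2: "a2 t * n = s" using a0[of t] n0 s0 by (simp add: power2_eq_iff_nonneg)
  have "a1 t = r1 / n" "a2 t = s / n" using e1 e2 n0 by (simp_all add: field_simps)
  then show ?thesis
    unfolding orbit_def Let_def u ua by (simp add: n_def s_def h_def)
qed

text \<open>At a vanishing coordinate the value of \<open>Arg\<close> is immaterial: the
  corresponding radius is 0 and remains 0 along \<open>orbit\<close>.\<close>

definition flow :: "real \<Rightarrow> complex \<times> complex \<Rightarrow> complex \<times> complex" where
  "flow t z = orbit (cmod (fst z)) (cmod (snd z)) (Arg (fst z) / (2 * pi)) (Arg (snd z) / (2 * pi)) t"

lemma orbit_solves:
  assumes "r1 \<ge> 0" "r2 \<ge> 0" "r1\<^sup>2 + r2\<^sup>2 = 1"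
  shows "solves_from \<alpha> F (of_real r1 * cis (2 * pi * \<omega>), of_real r2 * cis (2 * pi * \<theta>)) (orbit r1 r2 \<omega> \<theta>)"
  unfolding solves_from_def
  using orbit_has_vector_derivative[OF assms] assms(3) by (simp add: orbit_def)

text \<open>Independence of the choice of angles follows from uniqueness: the orbit for any
  admissible angles solves the same initial value problem.\<close>

lemma flow_polar:
  assumes "r1 \<ge> 0" "r2 \<ge> 0" "r1\<^sup>2 + r2\<^sup>2 = 1"
  shows "flow t (of_real r1 * cis (2 * pi * \<omega>), of_real r2 * cis (2 * pi * \<theta>)) = orbit r1 r2 \<omega> \<theta> t"
proof -
  define z1 where "z1 = of_real r1 * cis (2 * pi * \<omega>)"
  define z2 where "z2 = of_real r2 * cis (2 * pi * \<theta>)"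
  have z: "z = of_real (cmod z) * cis (2 * pi * (Arg z / (2 * pi)))" for z
    using rcis_cmod_Arg[of z] by (simp add: rcis_def)
  have n: "cmod z1 = r1" "cmod z2 = r2" using assms by (simp_all add: z1_def z2_def norm_mult)
  have "orbit r1 r2 \<omega> \<theta> t = orbit (cmod z1) (cmod z2) (Arg z1 / (2 * pi)) (Arg z2 / (2 * pi)) t"
  proof (rule solution_unique)
    show "solves_from \<alpha> F (of_real (cmod z1) * cis (2 * pi * (Arg z1 / (2 * pi))),
      of_real (cmod z2) * cis (2 * pi * (Arg z2 / (2 * pi)))) (orbit r1 r2 \<omega> \<theta>)"
      unfolding z[symmetric] unfolding z1_def z2_def by (rule orbit_solves[OF assms])
  qed (use assms n in auto)
  then show ?thesis by (simp add: flow_def z1_def z2_def)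
qed

lemma orbit_in_S3:
  assumes "r1 \<ge> 0" "r2 \<ge> 0" "r1\<^sup>2 + r2\<^sup>2 = 1"
  shows "orbit r1 r2 \<omega> \<theta> t \<in> S3"
proof -
  define s where "s = r2 * exp (height t \<omega> \<theta>)"
  have "r1\<^sup>2 + s\<^sup>2 \<noteq> 0"
    using assms(3) by (simp add: s_def sum_power2_eq_zero_iff) auto
  then have pos: "r1\<^sup>2 + s\<^sup>2 > 0" by (metis add_nonneg_nonneg antisym_conv2 zero_le_power2)
  define n where "n = sqrt (r1\<^sup>2 + s\<^sup>2)"
  have nn: "n\<^sup>2 = r1\<^sup>2 + s\<^sup>2" using pos by (simp add: n_def)
  have "(r1 / n)\<^sup>2 + (s / n)\<^sup>2 = n\<^sup>2 / n\<^sup>2"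
    unfolding power_divide by (simp only: nn add_divide_distrib)
  also have "n\<^sup>2 > 0" unfolding nn by (rule pos)
  then have "n\<^sup>2 / n\<^sup>2 = 1" by simp
  finally show ?thesis
    unfolding S3_eq orbit_def Let_def s_def[symmetric] n_def[symmetric] mem_Collect_eq fst_conv snd_conv
      norm_mult norm_of_real norm_cis by (simp only: mult_1_right power2_abs)
qed

lemma is_flow_flow: "is_flow \<alpha> F flow"
  unfolding is_flow_def
proof (intro ballI conjI allI)
  fix x assume "x \<in> S3"
  then have nrm: "(cmod (fst x))\<^sup>2 + (cmod (snd x))\<^sup>2 = 1" by (simp add: S3_eq)
  have z: "of_real (cmod z) * cis (2 * pi * (Arg z / (2 * pi))) = z" for z
    using rcis_cmod_Arg[of z] by (simp add: rcis_def)
  show "flow t x \<in> S3" for t unfolding flow_def by (rule orbit_in_S3) (use nrm in auto)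
  show "solves_from \<alpha> F x u \<longleftrightarrow> u = (\<lambda>t. flow t x)" for u
  proof
    assume "solves_from \<alpha> F x u"
    then have "solves_from \<alpha> F (of_real (cmod (fst x)) * cis (2 * pi * (Arg (fst x) / (2 * pi))),
        of_real (cmod (snd x)) * cis (2 * pi * (Arg (snd x) / (2 * pi)))) u"
      unfolding z by simp
    from solution_unique[OF this] show "u = (\<lambda>t. flow t x)"
      using nrm by (simp add: flow_def fun_eq_iff)
  next
    assume u: "u = (\<lambda>t. flow t x)"
    show "solves_from \<alpha> F x u"
      using orbit_solves[of "cmod (fst x)" "cmod (snd x)" "Arg (fst x) / (2 * pi)" "Arg (snd x) / (2 * pi)"] nrm
      unfolding z u flow_def by simp
  qed
qed

end

section \<open>Limit sets, density and transitivity\<close>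

text \<open>\<open>cyl \<omega> \<theta> h\<close> is the point of \<open>S3\<close> with angles \<open>\<omega>\<close>, \<open>\<theta>\<close> and \<open>h = ln (cmod z2 / cmod z1)\<close>.\<close>
definition rad :: "real \<Rightarrow> real" where
  "rad h = 1 / sqrt (1 + (exp h)\<^sup>2)"

definition cyl :: "real \<Rightarrow> real \<Rightarrow> real \<Rightarrow> complex \<times> complex" where
  "cyl \<omega> \<theta> h = (of_real (rad h) * cis (2 * pi * \<omega>), of_real (rad (- h)) * cis (2 * pi * \<theta>))"

lemma rad_pos: "rad h > 0"
  by (simp add: rad_def add_pos_nonneg)

lemma rad_minus: "rad (- h) = exp h / sqrt (1 + (exp h)\<^sup>2)"
proof -
  have "1 + (exp (- h))\<^sup>2 = (1 + (exp h)\<^sup>2) / (exp h)\<^sup>2"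
    by (simp add: exp_minus field_simps)
  then show ?thesis by (simp add: rad_def real_sqrt_divide)
qed

lemma rad_squares: "(rad h)\<^sup>2 + (rad (- h))\<^sup>2 = 1"
proof -
  have "1 + (exp h)\<^sup>2 > 0" by (simp add: add_pos_nonneg)
  then show ?thesis
    unfolding rad_minus by (simp add: rad_def power_divide flip: add_divide_distrib)
qed

lemma cyl_in_S3: "cyl \<omega> \<theta> h \<in> S3"
  using rad_squares[of h] by (simp add: S3_eq cyl_def norm_mult)

lemma continuous_on_rad [continuous_intros]:
  "continuous_on A f \<Longrightarrow> continuous_on A (\<lambda>x. rad (f x))"
  unfolding rad_def by (intro continuous_intros) (auto simp: add_pos_nonneg less_imp_neq[symmetric])

lemma continuous_on_cyl [continuous_intros]:
  assumes "continuous_on A f" "continuous_on A g" "continuous_on A k"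
  shows "continuous_on A (\<lambda>x. cyl (f x) (g x) (k x))"
  unfolding cyl_def by (intro continuous_intros assms)

lemma cyl_shift: "cyl (\<omega> + of_int m) (\<theta> + of_int n) h = cyl \<omega> \<theta> h"
proof -
  have "cis (2 * pi * (x + of_int i)) = cis (2 * pi * x)" for x :: real and i :: int
    by (simp add: distrib_left flip: cis_mult)
  then show ?thesis by (simp add: cyl_def)
qed

lemma rad_tendsto_0: "(rad \<longlongrightarrow> 0) at_top"
proof (rule tendsto_sandwich[of "\<lambda>_. 0" rad at_top "\<lambda>h. exp (- h)"])
  have "rad h \<le> exp (- h)" for h
  proof -
    have "exp h \<le> sqrt (1 + (exp h)\<^sup>2)" by (rule real_le_rsqrt) simp
    then have "1 / sqrt (1 + (exp h)\<^sup>2) \<le> 1 / exp h" by (intro frac_le) auto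
    then show ?thesis by (simp add: rad_def exp_minus inverse_eq_divide)
  qed
  then show "\<forall>\<^sub>F h in at_top. rad h \<le> exp (- h)" by simp
  show "((\<lambda>h. exp (- h :: real)) \<longlongrightarrow> 0) at_top"
    by (rule filterlim_compose[OF exp_at_bot filterlim_uminus_at_bot_at_top])
  show "\<forall>\<^sub>F h in at_top. 0 \<le> rad h" using rad_pos by (simp add: less_imp_le)
qed simp

lemma rad_tendsto_1: "(rad \<longlongrightarrow> 1) at_bot"
proof -
  have "(rad \<longlongrightarrow> 1 / sqrt (1 + 0\<^sup>2)) at_bot"
    unfolding rad_def[abs_def] by (intro tendsto_intros exp_at_bot) simp
  then show ?thesis by simp
qed

lemma S3_polar:
  assumes "z \<in> S3"
  obtains a \<omega> \<theta> where "0 \<le> a" "a \<le> pi / 2"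
    "z = (of_real (cos a) * cis (2 * pi * \<omega>), of_real (sin a) * cis (2 * pi * \<theta>))"
proof -
  have "(cmod (fst z))\<^sup>2 + (cmod (snd z))\<^sup>2 = 1" using assms by (simp add: S3_eq)
  then obtain a where a: "0 \<le> a" "a \<le> pi / 2" "cmod (fst z) = cos a" "cmod (snd z) = sin a"
    using sincos_total_pi_half[of "cmod (fst z)" "cmod (snd z)"] by auto
  have z: "w = of_real (cmod w) * cis (2 * pi * (Arg w / (2 * pi)))" for w
    using rcis_cmod_Arg[of w] by (simp add: rcis_def)
  have "z = (of_real (cos a) * cis (2 * pi * (Arg (fst z) / (2 * pi))),
             of_real (sin a) * cis (2 * pi * (Arg (snd z) / (2 * pi))))"
    unfolding a(3,4)[symmetric] z[symmetric] by simp
  with a that show ?thesis by blast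
qed

lemma cyl_of_angle:
  assumes "0 < a" "a < pi / 2"
  shows "(of_real (cos a) * cis (2 * pi * \<omega>), of_real (sin a) * cis (2 * pi * \<theta>)) = cyl \<omega> \<theta> (ln (tan a))"
proof -
  have c: "cos a > 0" using assms by (intro cos_gt_zero) auto
  have s: "sin a > 0" using assms by (intro sin_gt_zero2) auto
  have t: "tan a > 0" using c s by (simp add: tan_def)
  have "1 + (exp (ln (tan a)))\<^sup>2 = 1 / (cos a)\<^sup>2"
    using c t sin_cos_squared_add[of a] by (simp add: tan_def field_simps)
  then have "sqrt (1 + (exp (ln (tan a)))\<^sup>2) = 1 / cos a" using c by (simp add: real_sqrt_divide)
  then have "rad (ln (tan a)) = cos a" "rad (- ln (tan a)) = sin a"
    unfolding rad_minus using c t by (simp_all add: rad_def) (simp add: tan_def)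
  then show ?thesis by (simp add: cyl_def)
qed

text \<open>The points missed by \<open>cyl\<close> are those of the two circles; they are reached
  when the polar angle \<open>a\<close> tends to 0 or pi/2 with \<omega> and \<theta> fixed.\<close>

lemma S3_subset_closure_cyl: "S3 \<subseteq> closure (\<Union>\<omega> \<theta> h. {cyl \<omega> \<theta> h})"
proof
  let ?C = "\<Union>\<omega> \<theta> h. {cyl \<omega> \<theta> h}"
  fix z assume "z \<in> S3"
  then obtain a \<omega> \<theta> where a: "0 \<le> a" "a \<le> pi / 2"
    and z: "z = (of_real (cos a) * cis (2 * pi * \<omega>), of_real (sin a) * cis (2 * pi * \<theta>))"
    by (rule S3_polar)
  let ?f = "\<lambda>a. (complex_of_real (cos a) * cis (2 * pi * \<omega>), complex_of_real (sin a) * cis (2 * pi * \<theta>))"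
  have "?f ` closure {0<..<pi / 2} \<subseteq> closure ?C"
  proof (rule image_closure_subset)
    show "continuous_on (closure {0<..<pi / 2}) ?f" by (intro continuous_intros)
    show "?f ` {0<..<pi / 2} \<subseteq> closure ?C"
    proof (intro image_subsetI)
      fix b assume "b \<in> {0<..<pi / 2}"
      then have "?f b = cyl \<omega> \<theta> (ln (tan b))" using cyl_of_angle[of b \<omega> \<theta>] by simp
      then show "?f b \<in> closure ?C" by (auto intro!: closure_subset[THEN subsetD])
    qed
  qed simp
  moreover have "closure {0<..<pi / 2} = {0..pi / 2}" by (rule closure_greaterThanLessThan) simp
  ultimately show "z \<in> closure ?C" using a z by auto
qed

text \<open>As the height tends to infinity the first coordinate dies out, so its angle
  \<open>f\<close> is arbitrary. The second assumption produces times at which the second angle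
  takes a prescribed value exactly, so every point of the circle is a limit point.\<close>

lemma cyl_limit_set_plus:
  assumes h: "filterlim h at_top Fl"
    and tau: "\<And>x. \<exists>\<tau>. filterlim \<tau> Fl sequentially \<and> (\<forall>n::nat. cis (2 * pi * (g (\<tau> n))) = cis (2 * pi * x))"
  shows "{y. \<exists>\<tau>::nat \<Rightarrow> real. filterlim \<tau> Fl sequentially \<and> (\<lambda>n. cyl (f (\<tau> n)) (g (\<tau> n)) (h (\<tau> n))) \<longlonglongrightarrow> y}
    = circle_of Plus_side"
proof (intro set_eqI iffI)
  fix y assume "y \<in> {y. \<exists>\<tau>::nat \<Rightarrow> real. filterlim \<tau> Fl sequentially \<and> (\<lambda>n. cyl (f (\<tau> n)) (g (\<tau> n)) (h (\<tau> n))) \<longlonglongrightarrow> y}"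
  then obtain \<tau> :: "nat \<Rightarrow> real" where \<tau>: "filterlim \<tau> Fl sequentially"
    and lim: "(\<lambda>n. cyl (f (\<tau> n)) (g (\<tau> n)) (h (\<tau> n))) \<longlonglongrightarrow> y" by blast
  have ht: "filterlim (\<lambda>n. h (\<tau> n)) at_top sequentially" by (rule filterlim_compose[OF h \<tau>])
  have "(\<lambda>n. norm (fst (cyl (f (\<tau> n)) (g (\<tau> n)) (h (\<tau> n))))) \<longlonglongrightarrow> norm (fst y)"
    by (intro tendsto_intros lim)
  moreover have "norm (fst (cyl a b c)) = rad c" for a b c
    using rad_pos[of c] by (simp add: cyl_def norm_mult)
  moreover have "(\<lambda>n. rad (h (\<tau> n))) \<longlonglongrightarrow> 0" by (rule filterlim_compose[OF rad_tendsto_0 ht])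
  ultimately have "norm (fst y) = 0" using LIMSEQ_unique by fastforce
  moreover have "(\<lambda>n. norm (snd (cyl (f (\<tau> n)) (g (\<tau> n)) (h (\<tau> n))))) \<longlonglongrightarrow> norm (snd y)"
    by (intro tendsto_intros lim)
  moreover have "norm (snd (cyl a b c)) = rad (- c)" for a b c
    using rad_pos[of "- c"] by (simp add: cyl_def norm_mult)
  moreover have "(\<lambda>n. rad (- h (\<tau> n))) \<longlonglongrightarrow> 1"
    by (rule filterlim_compose[OF rad_tendsto_1 filterlim_compose[OF filterlim_uminus_at_bot_at_top ht]])
  ultimately have "norm (snd y) = 1" "fst y = 0" using LIMSEQ_unique by fastforce+
  then show "y \<in> circle_of Plus_side" by (cases y) (auto simp: S3_def)
next
  fix y assume "y \<in> circle_of Plus_side"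
  then have y: "fst y = 0" "norm (snd y) = 1" by auto
  define x where "x = Arg (snd y) / (2 * pi)"
  have x: "cis (2 * pi * x) = snd y" using rcis_cmod_Arg[of "snd y"] y by (simp add: x_def rcis_def)
  obtain \<tau> :: "nat \<Rightarrow> real" where \<tau>: "filterlim \<tau> Fl sequentially" "\<And>n. cis (2 * pi * (g (\<tau> n))) = cis (2 * pi * x)"
    using tau[of x] by blast
  have ht: "filterlim (\<lambda>n. h (\<tau> n)) at_top sequentially" by (rule filterlim_compose[OF h \<tau>(1)])
  have 1: "(\<lambda>n. rad (h (\<tau> n))) \<longlonglongrightarrow> 0" by (rule filterlim_compose[OF rad_tendsto_0 ht])
  have 2: "(\<lambda>n. rad (- h (\<tau> n))) \<longlonglongrightarrow> 1"
    by (rule filterlim_compose[OF rad_tendsto_1 filterlim_compose[OF filterlim_uminus_at_bot_at_top ht]])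
  have "(\<lambda>n. of_real (rad (h (\<tau> n))) * cis (2 * pi * f (\<tau> n))) \<longlonglongrightarrow> 0"
    by (rule tendsto_norm_zero_cancel) (use 1 rad_pos in \<open>simp add: norm_mult abs_of_pos\<close>)
  moreover have "(\<lambda>n. of_real (rad (- h (\<tau> n))) * cis (2 * pi * x)) \<longlonglongrightarrow> of_real 1 * cis (2 * pi * x)"
    by (intro tendsto_intros 2)
  ultimately have "(\<lambda>n. cyl (f (\<tau> n)) (g (\<tau> n)) (h (\<tau> n))) \<longlonglongrightarrow> (0, of_real 1 * cis (2 * pi * x))"
    unfolding cyl_def \<tau>(2) by (rule tendsto_Pair)
  then have "(\<lambda>n. cyl (f (\<tau> n)) (g (\<tau> n)) (h (\<tau> n))) \<longlonglongrightarrow> y" using x y by (simp add: prod_eq_iff) (metis prod.collapse)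
  then show "y \<in> {y. \<exists>\<tau>::nat \<Rightarrow> real. filterlim \<tau> Fl sequentially \<and> (\<lambda>n. cyl (f (\<tau> n)) (g (\<tau> n)) (h (\<tau> n))) \<longlonglongrightarrow> y}"
    using \<tau>(1) by blast
qed

text \<open>Exchanging the two coordinates maps one circle to the other and reverses the sign of the height.\<close>
lemma cyl_limit_set_minus:
  assumes h: "filterlim h at_bot Fl"
    and tau: "\<And>x. \<exists>\<tau>. filterlim \<tau> Fl sequentially \<and> (\<forall>n::nat. cis (2 * pi * (f (\<tau> n))) = cis (2 * pi * x))"
  shows "{y. \<exists>\<tau>::nat \<Rightarrow> real. filterlim \<tau> Fl sequentially \<and> (\<lambda>n. cyl (f (\<tau> n)) (g (\<tau> n)) (h (\<tau> n))) \<longlonglongrightarrow> y}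
    = circle_of Minus_side"
proof -
  have swap: "cyl a b c = prod.swap (cyl b a (- c))" for a b c by (simp add: cyl_def)
  have "filterlim (\<lambda>t. - h t) at_top Fl" using h by (simp add: filterlim_uminus_at_bot)
  from cyl_limit_set_plus[where h = "\<lambda>t. - h t" and g = f and f = g, OF this tau]
  have plus: "{y. \<exists>\<tau>::nat \<Rightarrow> real. filterlim \<tau> Fl sequentially \<and> (\<lambda>n. cyl (g (\<tau> n)) (f (\<tau> n)) (- h (\<tau> n))) \<longlonglongrightarrow> y}
    = circle_of Plus_side" .
  have lim: "(\<lambda>n. prod.swap (u n)) \<longlonglongrightarrow> y \<longleftrightarrow> u \<longlonglongrightarrow> prod.swap y" for u :: "nat \<Rightarrow> complex \<times> complex" and y
  proof -
    have *: "(\<lambda>n. prod.swap (v n)) \<longlonglongrightarrow> prod.swap y" if "v \<longlonglongrightarrow> y" for v :: "nat \<Rightarrow> complex \<times> complex" and y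
      unfolding prod.swap_def by (intro tendsto_intros that)
    show ?thesis using *[of u "prod.swap y"] *[of "\<lambda>n. prod.swap (u n)" y] by auto
  qed
  have "{y. \<exists>\<tau>::nat \<Rightarrow> real. filterlim \<tau> Fl sequentially \<and> (\<lambda>n. cyl (f (\<tau> n)) (g (\<tau> n)) (h (\<tau> n))) \<longlonglongrightarrow> y}
    = {y. prod.swap y \<in> circle_of Plus_side}"
    unfolding plus[symmetric] swap[of "f _"] lim by simp
  also have "\<dots> = circle_of Minus_side" by (auto simp: S3_def)
  finally show ?thesis .
qed

lemma cis_linear_recurrence:
  fixes c :: real
  assumes "c \<noteq> 0"
  shows "\<exists>\<tau>::nat \<Rightarrow> real. filterlim \<tau> at_top sequentially \<and> (\<forall>n. cis (2 * pi * (b + c * \<tau> n)) = cis (2 * pi * x))"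
    and "\<exists>\<tau>::nat \<Rightarrow> real. filterlim \<tau> at_bot sequentially \<and> (\<forall>n. cis (2 * pi * (b + c * \<tau> n)) = cis (2 * pi * x))"
proof -
  have eq: "cis (2 * pi * (b + c * ((x - b) / c + of_int i / c))) = cis (2 * pi * x)" for i :: int
  proof -
    have "2 * pi * (b + c * ((x - b) / c + of_int i / c)) = 2 * pi * x + 2 * pi * of_int i"
      using assms by (simp add: field_simps)
    then show ?thesis by (simp flip: cis_mult)
  qed
  have up: "filterlim (\<lambda>n::nat. (x - b) / c + real n / \<bar>c\<bar>) at_top sequentially"
    by (intro filterlim_tendsto_add_at_top[OF tendsto_const]
        filterlim_at_top_mult_tendsto_pos[OF tendsto_const _ filterlim_real_sequentially, of "1 / \<bar>c\<bar>", simplified])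
      (use assms in auto)
  have dn: "filterlim (\<lambda>n::nat. (x - b) / c - real n / \<bar>c\<bar>) at_bot sequentially"
  proof -
    have "filterlim (\<lambda>n::nat. - ((x - b) / c) + real n / \<bar>c\<bar>) at_top sequentially"
      by (intro filterlim_tendsto_add_at_top[OF tendsto_const]
          filterlim_at_top_mult_tendsto_pos[OF tendsto_const _ filterlim_real_sequentially, of "1 / \<bar>c\<bar>", simplified])
        (use assms in auto)
    then show ?thesis unfolding filterlim_uminus_at_bot by simp
  qed
  \<comment> \<open>The integer multiples of \<open>1 / c\<close> must be traversed in the direction
    given by the sign of \<open>c\<close> for the times to tend to the intended end.\<close>
  have s: "real n / \<bar>c\<bar> = of_int (if c > 0 then int n else - int n) / c" for n using assms by auto
  have s': "(x - b) / c - real n / \<bar>c\<bar> = (x - b) / c + of_int (if c > 0 then - int n else int n) / c" for n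
    using assms by auto
  show "\<exists>\<tau>::nat \<Rightarrow> real. filterlim \<tau> at_top sequentially \<and> (\<forall>n. cis (2 * pi * (b + c * \<tau> n)) = cis (2 * pi * x))"
    by (rule exI, rule conjI, rule up) (simp only: s eq simp_thms)
  show "\<exists>\<tau>::nat \<Rightarrow> real. filterlim \<tau> at_bot sequentially \<and> (\<forall>n. cis (2 * pi * (b + c * \<tau> n)) = cis (2 * pi * x))"
    by (rule exI, rule conjI, rule dn) (simp only: s' eq simp_thms)
qed

section \<open>Escaping base points, density of the heteroclinic sets and transitivity\<close>

context resonant_cascade
begin

lemma flow_cyl: "flow t (cyl \<omega> \<theta> h) = cyl (\<omega> + \<alpha> * t) (\<theta> + t) (h + height t \<omega> \<theta>)"
proof -
  define E where "E = exp h"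
  define H where "H = exp (height t \<omega> \<theta>)"
  define n where "n = sqrt (1 + E\<^sup>2)"
  have pos: "1 + x\<^sup>2 > 0" for x :: real by (simp add: add_pos_nonneg)
  have n0: "n > 0" using pos[of E] by (simp add: n_def)
  have r: "rad h = 1 / n" "rad (- h) = E / n"
    by (simp_all add: rad_minus n_def E_def) (simp add: rad_def)
  have "(1 / n)\<^sup>2 + (E / n * H)\<^sup>2 = (1 + (E * H)\<^sup>2) / n\<^sup>2"
    by (simp add: power_divide power_mult_distrib add_divide_distrib)
  then have sq: "sqrt ((rad h)\<^sup>2 + (rad (- h) * H)\<^sup>2) = sqrt (1 + (E * H)\<^sup>2) / n"
    unfolding r using n0 by (simp add: real_sqrt_divide)
  have "rad h / (sqrt (1 + (E * H)\<^sup>2) / n) = rad (h + height t \<omega> \<theta>)"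
    unfolding r using n0 by (simp add: rad_def exp_add E_def H_def)
  moreover have "rad (- h) * H / (sqrt (1 + (E * H)\<^sup>2) / n) = rad (- (h + height t \<omega> \<theta>))"
    unfolding r(2) rad_minus[of "h + height t \<omega> \<theta>"] using n0 by (simp add: exp_add E_def H_def)
  moreover have "flow t (cyl \<omega> \<theta> h) = orbit (rad h) (rad (- h)) \<omega> \<theta> t"
    unfolding cyl_def using rad_pos rad_squares by (intro flow_polar) (auto simp: less_imp_le)
  ultimately show ?thesis
    unfolding orbit_def Let_def H_def[symmetric] sq cyl_def by simp
qed

fun end_filter :: "side \<Rightarrow> real filter" where
  "end_filter Plus_side = at_top"
| "end_filter Minus_side = at_bot"

text \<open>This is a condition on the two angles alone, since the initial height only adds a
  constant. Every point of the fibre over such a base point therefore belongs to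
  \<open>HC\<close>.\<close>

definition escaping :: "side \<Rightarrow> side \<Rightarrow> (real \<times> real) set" where
  "escaping sm sp = {(\<omega>, \<theta>). filterlim (\<lambda>t. height t \<omega> \<theta>) (end_filter sp) at_top \<and>
     filterlim (\<lambda>t. height t \<omega> \<theta>) (end_filter sm) at_bot}"

lemma alpha_nonzero: "\<alpha> \<noteq> 0"
  using irrational by auto

lemma cyl_limit_set:
  assumes "filterlim h (end_filter s) Fl" "Fl = at_top \<or> Fl = at_bot"
  shows "{y. \<exists>\<tau>::nat \<Rightarrow> real. filterlim \<tau> Fl sequentially \<and>
     (\<lambda>n. cyl (\<omega> + \<alpha> * \<tau> n) (\<theta> + \<tau> n) (h (\<tau> n))) \<longlonglongrightarrow> y} = circle_of s"
proof (cases s)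
  case Plus_side
  have "\<exists>\<tau>. filterlim \<tau> Fl sequentially \<and> (\<forall>n::nat. cis (2 * pi * (\<theta> + \<tau> n)) = cis (2 * pi * x))" for x
    using cis_linear_recurrence[of 1 \<theta> x] assms(2) by auto
  then show ?thesis
    using cyl_limit_set_plus[of h Fl "\<lambda>t. \<theta> + t" "\<lambda>t. \<omega> + \<alpha> * t"] assms(1) Plus_side by simp
next
  case Minus_side
  have "\<exists>\<tau>. filterlim \<tau> Fl sequentially \<and> (\<forall>n::nat. cis (2 * pi * (\<omega> + \<alpha> * \<tau> n)) = cis (2 * pi * x))" for x
    using cis_linear_recurrence[OF alpha_nonzero, of \<omega> x] assms(2) by auto
  then show ?thesis
    using cyl_limit_set_minus[of h Fl "\<lambda>t. \<omega> + \<alpha> * t" "\<lambda>t. \<theta> + t"] assms(1) Minus_side by simp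
qed

lemma filterlim_add_const_end:
  assumes "filterlim f (end_filter s) Fl"
  shows "filterlim (\<lambda>t. c + f t) (end_filter s) Fl"
proof (cases s)
  case Plus_side
  then show ?thesis using assms by (simp add: filterlim_tendsto_add_at_top[OF tendsto_const])
next
  case Minus_side
  then have "filterlim (\<lambda>t. - c + - f t) at_top Fl"
    using assms by (intro filterlim_tendsto_add_at_top[OF tendsto_const]) (simp add: filterlim_uminus_at_bot)
  then show ?thesis using Minus_side by (simp add: filterlim_uminus_at_bot)
qed

lemma cyl_in_HC:
  assumes "(\<omega>, \<theta>) \<in> escaping sm sp"
  shows "cyl \<omega> \<theta> h \<in> HC flow sm sp"
proof -
  have top: "filterlim (\<lambda>t. h + height t \<omega> \<theta>) (end_filter sp) at_top"
    and bot: "filterlim (\<lambda>t. h + height t \<omega> \<theta>) (end_filter sm) at_bot"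
    using assms by (auto simp: escaping_def intro: filterlim_add_const_end)
  show ?thesis
    unfolding HC_def omega_limit_set_def alpha_limit_set_def mem_Collect_eq flow_cyl
    using cyl_limit_set[OF top] cyl_limit_set[OF bot] cyl_in_S3 by simp
qed

text \<open>By the cocycle identity, moving the base point along the flow shifts time and subtracts
  a constant from the height.\<close>

lemma escaping_flow:
  assumes "(\<omega>, \<theta>) \<in> escaping sm sp"
  shows "(\<omega> + \<alpha> * s, \<theta> + s) \<in> escaping sm sp"
proof -
  have eq: "height t (\<omega> + \<alpha> * s) (\<theta> + s) = - height s \<omega> \<theta> + height (s + t) \<omega> \<theta>" for t
    using height_add[of s t \<omega> \<theta>] by simp
  have "filterlim (\<lambda>t. s + t) at_top at_top" "filterlim (\<lambda>t. s + t) at_bot at_bot"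
    using filterlim_add_const_end[of "\<lambda>t. t" Plus_side at_top s] filterlim_add_const_end[of "\<lambda>t. t" Minus_side at_bot s]
    by (simp_all add: filterlim_ident)
  moreover have "filterlim (\<lambda>t. height t (\<omega> + \<alpha> * s) (\<theta> + s)) (end_filter e) Fl"
    if "filterlim (\<lambda>t. height t \<omega> \<theta>) (end_filter e) Fl" "filterlim (\<lambda>t. s + t) Fl Fl" for e Fl
    unfolding eq by (intro filterlim_add_const_end filterlim_compose[OF that])
  ultimately show ?thesis using assms by (simp add: escaping_def)
qed

lemma height_shift: "height t (\<omega> + of_int m) (\<theta> + of_int n) = height t \<omega> \<theta>"
proof -
  have ph: "phase k (\<omega> + of_int m) (\<theta> + of_int n) = phase k \<omega> \<theta> + of_int (int (q k) * m - p k * n)" for k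
    by (simp add: phase_def algebra_simps)
  have per: "cos (2 * pi * (x + of_int i)) = cos (2 * pi * x)" for x :: real and i :: int
    using cos_int_2pin[of i] sin_int_2pin[of i] by (simp add: cos_add distrib_left)
  have swap: "x + of_int i + y = x + y + of_int i" for x y :: real and i :: int by simp
  show ?thesis unfolding height_def ph swap per ..
qed

lemma escaping_shift:
  "(\<omega> + of_int m, \<theta> + of_int n) \<in> escaping sm sp \<longleftrightarrow> (\<omega>, \<theta>) \<in> escaping sm sp"
  by (simp add: escaping_def height_shift)

fun start_phase :: "side \<Rightarrow> side \<Rightarrow> real" where
  "start_phase Plus_side Plus_side = 0"
| "start_phase Minus_side Minus_side = 1 / 2"
| "start_phase Minus_side Plus_side = 1 / 4"
| "start_phase Plus_side Minus_side = 3 / 4"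

lemma filterlim_at_top_powers:
  fixes f :: "real \<Rightarrow> real"
  assumes "\<And>m t. 4 ^ m \<le> t \<Longrightarrow> f t \<ge> 2 ^ m / 100"
  shows "filterlim f at_top at_top"
  unfolding filterlim_at_top
proof
  fix Z :: real
  obtain m where m: "100 * Z < 2 ^ m" using real_arch_pow[of 2 "100 * Z"] by auto
  have "\<forall>\<^sub>F t in at_top. (4::real) ^ m \<le> t" by (rule eventually_ge_at_top)
  then show "\<forall>\<^sub>F t in at_top. Z \<le> f t"
    by eventually_elim (use m assms[of m] in fastforce)
qed

lemma filterlim_at_bot_iff_minus:
  fixes f :: "real \<Rightarrow> real"
  shows "filterlim f Fl at_bot \<longleftrightarrow> filterlim (\<lambda>t. f (- t)) Fl at_top"
  by (simp add: filterlim_at_bot_mirror)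

lemma resonant_even_escaping:
  assumes "resonant_start 0 \<omega> \<theta>"
  shows "(\<omega>, \<theta>) \<in> escaping Plus_side Plus_side"
proof -
  have "filterlim (\<lambda>t. height t \<omega> \<theta>) at_top at_top" "filterlim (\<lambda>t. height (- t) \<omega> \<theta>) at_top at_top"
    by (auto intro!: filterlim_at_top_powers height_even[OF assms])
  then show ?thesis by (simp add: escaping_def filterlim_at_bot_iff_minus)
qed

lemma resonant_odd_escaping:
  assumes "resonant_start (1 / 4) \<omega> \<theta>"
  shows "(\<omega>, \<theta>) \<in> escaping Minus_side Plus_side"
proof -
  have le: "(2::real) ^ m / 100 \<le> 2 ^ m / 10" for m by (simp add: field_simps)
  have "filterlim (\<lambda>t. height t \<omega> \<theta>) at_top at_top"
    by (rule filterlim_at_top_powers) (use height_odd(1)[OF assms] le order_trans in blast)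
  moreover have "filterlim (\<lambda>t. - height (- t) \<omega> \<theta>) at_top at_top"
  proof (rule filterlim_at_top_powers)
    fix m t assume "(4::real) ^ m \<le> t"
    from height_odd(2)[OF assms this] show "2 ^ m / 100 \<le> - height (- t) \<omega> \<theta>" using le[of m] by linarith
  qed
  ultimately show ?thesis
    by (simp add: escaping_def filterlim_at_bot_iff_minus) (simp add: filterlim_uminus_at_bot)
qed

lemma resonant_start_escaping:
  assumes "resonant_start (start_phase sm sp) \<omega> \<theta>"
  shows "(\<omega>, \<theta>) \<in> escaping sm sp"
proof -
  have minus: "(\<omega>, \<theta>) \<in> escaping Minus_side s"
    if "\<And>t. height t \<omega> \<theta> = - height t \<omega>' \<theta>'" "(\<omega>', \<theta>') \<in> escaping Plus_side Plus_side" "s = Minus_side" for \<omega>' \<theta>' s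
    using that by (simp add: escaping_def filterlim_uminus_at_bot)
  have plus: "(\<omega>, \<theta>) \<in> escaping Plus_side Minus_side"
    if "\<And>t. height t \<omega> \<theta> = - height t \<omega>' \<theta>'" "(\<omega>', \<theta>') \<in> escaping Minus_side Plus_side" for \<omega>' \<theta>'
    using that by (simp add: escaping_def filterlim_uminus_at_bot)
  consider "sm = Plus_side" "sp = Plus_side" | "sm = Minus_side" "sp = Minus_side"
    | "sm = Minus_side" "sp = Plus_side" | "sm = Plus_side" "sp = Minus_side"
    by (cases sm; cases sp) auto
  then show ?thesis
  proof cases
    case 1
    then show ?thesis using assms resonant_even_escaping by simp
  next
    case 2
    then have "resonant_start (0 + 1 / 2) \<omega> \<theta>" using assms by simp
    then obtain \<omega>' \<theta>' where "resonant_start 0 \<omega>' \<theta>'" "\<And>t. height t \<omega> \<theta> = - height t \<omega>' \<theta>'"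
      by (rule height_half_shift) blast
    then show ?thesis using minus resonant_even_escaping 2 by blast
  next
    case 3
    then show ?thesis using assms resonant_odd_escaping by simp
  next
    case 4
    then have "resonant_start (1 / 4 + 1 / 2) \<omega> \<theta>" using assms by simp
    then obtain \<omega>' \<theta>' where "resonant_start (1 / 4) \<omega>' \<theta>'" "\<And>t. height t \<omega> \<theta> = - height t \<omega>' \<theta>'"
      by (rule height_half_shift) blast
    then show ?thesis using plus resonant_odd_escaping 4 by blast
  qed
qed

lemma start_phase_multiple: "\<exists>i::int. start_phase sm sp = of_int i / 4"
proof (cases sm; cases sp)
qed (auto intro: exI[of _ 0] exI[of _ 1] exI[of _ 2] exI[of _ 3])

lemma q_times_quarter:
  assumes "c = of_int i / 4"
  shows "real (q k) * c = c + of_int (int (q k div 4) * i)"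
proof -
  have "q k = 4 * (q k div 4) + 1" using q_mod[of k] mult_div_mod_eq[of 4 "q k"] by simp
  then have "real (q k) = 4 * real (q k div 4) + 1" by (metis of_nat_1 of_nat_add of_nat_mult of_nat_numeral)
  then show ?thesis by (simp add: assms field_simps)
qed

text \<open>For \<theta> = 0 the phases are \<open>q k * c\<close>, which equal \<open>c\<close>
  modulo 1 without any error.\<close>

lemma escaping_base: "(start_phase sm sp, 0) \<in> escaping sm sp"
proof (rule resonant_start_escaping)
  obtain i :: int where i: "start_phase sm sp = of_int i / 4" using start_phase_multiple by blast
  show "resonant_start (start_phase sm sp) (start_phase sm sp) 0"
    unfolding resonant_start_def
  proof
    fix k
    have "2 * pi * phase k (start_phase sm sp) 0
      = 2 * pi * start_phase sm sp + 0 + 2 * pi * of_int (int (q k div 4) * i)"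
      by (simp add: phase_def q_times_quarter[OF i] distrib_left)
    then show "\<exists>b (n::int). 2 * pi * phase k (start_phase sm sp) 0 = 2 * pi * start_phase sm sp + b + 2 * pi * of_int n \<and> \<bar>b\<bar> \<le> 1 / 1000"
      by (metis abs_zero zero_le_divide_1_iff zero_le_numeral)
  qed
qed

text \<open>The base orbit of one escaping point meets the section \<theta> = \<theta>0 modulo 1 at
  the times \<open>\<theta>0 + j\<close>, and its first angles there are an orbit of the irrational
  rotation by \<alpha>.\<close>

lemma escaping_dense:
  assumes "\<epsilon> > 0"
  shows "\<exists>\<omega>. \<bar>\<omega> - \<omega>0\<bar> < \<epsilon> \<and> (\<omega>, \<theta>0) \<in> escaping sm sp"
proof -
  define c where "c = start_phase sm sp"
  obtain j :: nat and l :: int where jl: "\<bar>real j * \<alpha> - of_int l - (\<omega>0 - c - \<alpha> * \<theta>0)\<bar> < \<epsilon>"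
    using inhomogeneous_approx_beyond[OF irrational assms] by blast
  define s where "s = \<theta>0 + real j"
  have "(c + \<alpha> * s, 0 + s) \<in> escaping sm sp" unfolding c_def by (rule escaping_flow[OF escaping_base])
  moreover have "c + \<alpha> * s = (c + \<alpha> * s - of_int l) + of_int l" "0 + s = \<theta>0 + of_int (int j)"
    by (simp_all add: s_def)
  ultimately have "(c + \<alpha> * s - of_int l, \<theta>0) \<in> escaping sm sp" by (metis escaping_shift)
  moreover have "\<bar>(c + \<alpha> * s - of_int l) - \<omega>0\<bar> < \<epsilon>" using jl by (simp add: s_def algebra_simps)
  ultimately show ?thesis by blast
qed

lemma HC_dense: "S3 \<subseteq> closure (HC flow sm sp)"
proof -
  have "cyl \<omega>0 \<theta>0 h \<in> closure (HC flow sm sp)" for \<omega>0 \<theta>0 h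
    unfolding closure_approachable
  proof (intro allI impI)
    fix e :: real assume "e > 0"
    have "isCont (\<lambda>\<omega>. cyl \<omega> \<theta>0 h) \<omega>0"
      using continuous_on_cyl[OF continuous_on_id continuous_on_const continuous_on_const, of UNIV \<theta>0 h]
      by (simp add: continuous_on_eq_continuous_at)
    then obtain d where d: "d > 0" "\<And>\<omega>. dist \<omega> \<omega>0 < d \<Longrightarrow> dist (cyl \<omega> \<theta>0 h) (cyl \<omega>0 \<theta>0 h) < e"
      unfolding continuous_at_eps_delta using \<open>e > 0\<close> by blast
    obtain \<omega> where "\<bar>\<omega> - \<omega>0\<bar> < d" "(\<omega>, \<theta>0) \<in> escaping sm sp" using escaping_dense[OF d(1)] by blast
    then show "\<exists>y\<in>HC flow sm sp. dist y (cyl \<omega>0 \<theta>0 h) < e"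
      using d(2)[of \<omega>] cyl_in_HC[of \<omega> \<theta>0 sm sp h] by (auto simp: dist_real_def)
  qed
  then have "closure (\<Union>\<omega> \<theta> h. {cyl \<omega> \<theta> h}) \<subseteq> closure (HC flow sm sp)"
    by (intro closure_minimal) auto
  then show ?thesis using S3_subset_closure_cyl by blast
qed

text \<open>Starting points whose heights tend to opposite infinities lie arbitrarily close together, so the
  intermediate value theorem prescribes the height at a return time of the base rotation.\<close>
lemma flow_visits:
  assumes "open B" "cyl \<omega>1 \<theta>1 h1 \<in> B" "\<epsilon> > 0"
  shows "\<exists>\<omega> t. \<bar>\<omega> - \<omega>0\<bar> < \<epsilon> \<and> flow t (cyl \<omega> \<theta>0 h0) \<in> B"
proof -
  have "isCont (\<lambda>\<omega>. cyl \<omega> \<theta>1 h1) \<omega>1"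
    using continuous_on_cyl[OF continuous_on_id continuous_on_const continuous_on_const, of UNIV \<theta>1 h1]
    by (simp add: continuous_on_eq_continuous_at)
  moreover obtain e where e: "e > 0" "ball (cyl \<omega>1 \<theta>1 h1) e \<subseteq> B" using assms(1,2) open_contains_ball by blast
  ultimately obtain d where d: "d > 0" "\<And>\<omega>. dist \<omega> \<omega>1 < d \<Longrightarrow> dist (cyl \<omega> \<theta>1 h1) (cyl \<omega>1 \<theta>1 h1) < e"
    unfolding continuous_at_eps_delta by blast
  \<comment> \<open>Two errors below \<eta> will add up: the choice of \<omega> near \<omega>0 and
    the return of the rotation. Hence half of \<open>d\<close>.\<close>
  define \<eta> where "\<eta> = min \<epsilon> (d / 2)"
  have \<eta>: "\<eta> > 0" using assms(3) d(1) by (simp add: \<eta>_def)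
  obtain a where a: "\<bar>a - \<omega>0\<bar> < \<eta>" "(a, \<theta>0) \<in> escaping Plus_side Plus_side" using escaping_dense[OF \<eta>] by blast
  obtain b where b: "\<bar>b - \<omega>0\<bar> < \<eta>" "(b, \<theta>0) \<in> escaping Minus_side Minus_side" using escaping_dense[OF \<eta>] by blast
  have "filterlim (\<lambda>t. height t a \<theta>0) at_top at_top" "filterlim (\<lambda>t. height t b \<theta>0) at_bot at_top"
    using a b by (auto simp: escaping_def)
  then have "\<forall>\<^sub>F t in at_top. h1 - h0 \<le> height t a \<theta>0 \<and> height t b \<theta>0 \<le> h1 - h0"
    by (intro eventually_conj) (auto simp: filterlim_at_top filterlim_at_bot)
  then obtain T where T: "\<And>t. t \<ge> T \<Longrightarrow> h1 - h0 \<le> height t a \<theta>0 \<and> height t b \<theta>0 \<le> h1 - h0"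
    by (auto simp: eventually_at_top_linorder)
  define J where "J = nat \<lceil>T - (\<theta>1 - \<theta>0)\<rceil>"
  obtain j :: nat and l :: int where jl: "j \<ge> J"
    "\<bar>real j * \<alpha> - of_int l - (\<omega>1 - \<omega>0 - \<alpha> * (\<theta>1 - \<theta>0))\<bar> < \<eta>"
    using inhomogeneous_approx_beyond[OF irrational \<eta>] by blast
  \<comment> \<open>At this time the second angle is \<theta>1 plus an integer, exactly; the first
    is close to its target by the choice of \<open>j\<close>, and \<open>J\<close> makes
    \<open>t\<close> late enough for the two opposite heights.\<close>
  define t where "t = \<theta>1 - \<theta>0 + real j"
  have "real J \<ge> T - (\<theta>1 - \<theta>0)" by (simp add: J_def) linarith
  moreover have "real j \<ge> real J" using jl(1) by simp
  ultimately have "t \<ge> T" unfolding t_def by linarith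
  then have ht: "h1 - h0 \<le> height t a \<theta>0" "height t b \<theta>0 \<le> h1 - h0" using T by auto
  have "continuous_on UNIV (\<lambda>\<omega>. height t (fst (\<omega>, \<theta>0)) (snd (\<omega>, \<theta>0)))"
    by (rule continuous_on_compose2[OF continuous_on_height]) (auto intro!: continuous_intros)
  then have "connected ((\<lambda>\<omega>. height t \<omega> \<theta>0) ` {\<omega>0 - \<eta><..<\<omega>0 + \<eta>})"
    by (intro connected_continuous_image) (auto intro: continuous_on_subset)
  then have "h1 - h0 \<in> (\<lambda>\<omega>. height t \<omega> \<theta>0) ` {\<omega>0 - \<eta><..<\<omega>0 + \<eta>}"
    by (rule connectedD_interval[of _ "height t b \<theta>0" "height t a \<theta>0"]) (use a b ht in \<open>auto simp: abs_less_iff\<close>)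
  then obtain \<omega> where "\<omega> \<in> {\<omega>0 - \<eta><..<\<omega>0 + \<eta>}" "height t \<omega> \<theta>0 = h1 - h0" by auto
  then have \<omega>: "\<bar>\<omega> - \<omega>0\<bar> < \<eta>" "height t \<omega> \<theta>0 = h1 - h0" by (auto simp: abs_less_iff)
  have "flow t (cyl \<omega> \<theta>0 h0) = cyl ((\<omega> + \<alpha> * t - of_int l) + of_int l) (\<theta>1 + of_int (int j)) h1"
    by (simp add: flow_cyl \<omega>(2)) (simp add: t_def)
  also have "\<dots> = cyl (\<omega> + \<alpha> * t - of_int l) \<theta>1 h1" by (rule cyl_shift)
  finally have fl: "flow t (cyl \<omega> \<theta>0 h0) = cyl (\<omega> + \<alpha> * t - of_int l) \<theta>1 h1" .
  have "\<bar>(\<omega> + \<alpha> * t - of_int l) - \<omega>1\<bar> < 2 * \<eta>"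
    using jl(2) \<omega>(1) by (simp add: t_def algebra_simps abs_less_iff)
  then have "dist (\<omega> + \<alpha> * t - of_int l) \<omega>1 < d" by (simp add: dist_real_def \<eta>_def)
  from d(2)[OF this] have "flow t (cyl \<omega> \<theta>0 h0) \<in> ball (cyl \<omega>1 \<theta>1 h1) e"
    unfolding fl by (simp add: dist_commute)
  then have "flow t (cyl \<omega> \<theta>0 h0) \<in> B" using e(2) by blast
  moreover have "\<bar>\<omega> - \<omega>0\<bar> < \<epsilon>" using \<omega>(1) by (simp add: \<eta>_def)
  ultimately show ?thesis by blast
qed

text \<open>Baire's theorem is applied in the parameter space of angles and height, which is
  complete and whose image under \<open>cyl\<close> is dense in the sphere. The parameters whose
  orbits visit a given basic open set meeting the sphere form an open dense set, by
  \<open>flow_visits\<close>.\<close>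

lemma transitive_flow_flow: "transitive_flow flow"
proof -
  obtain \<B> :: "(complex \<times> complex) set set" where \<B>: "countable \<B>" "\<And>C. C \<in> \<B> \<Longrightarrow> open C"
    "\<And>S. open S \<Longrightarrow> \<exists>U. U \<subseteq> \<B> \<and> S = \<Union>U"
    using univ_second_countable by blast
  define P where "P v = cyl (fst v) (fst (snd v)) (snd (snd v))" for v :: "real \<times> real \<times> real"
  define G where "G B = {v. \<exists>t. flow t (P v) \<in> B}" for B
  define \<B>' where "\<B>' = {B \<in> \<B>. B \<inter> S3 \<noteq> {}}"
  have "UNIV \<subseteq> closure (\<Inter> (G ` \<B>'))"
  proof (rule Baire)
    show "countable (G ` \<B>')" unfolding \<B>'_def using \<B>(1) by (intro countable_image) (rule countable_subset[of _ \<B>], auto)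
    fix T assume "T \<in> G ` \<B>'"
    then obtain B where B: "T = G B" "B \<in> \<B>" "B \<inter> S3 \<noteq> {}" by (auto simp: \<B>'_def)
    have oB: "open B" using \<B>(2) B(2) .
    have cont: "continuous_on UNIV (\<lambda>v. flow t (P v))" for t
    proof -
      have "continuous_on UNIV (\<lambda>v :: real \<times> real \<times> real. height t (fst (fst v, fst (snd v))) (snd (fst v, fst (snd v))))"
        by (rule continuous_on_compose2[OF continuous_on_height]) (auto intro!: continuous_intros)
      then have "continuous_on UNIV (\<lambda>v :: real \<times> real \<times> real. height t (fst v) (fst (snd v)))" by simp
      then show ?thesis unfolding P_def flow_cyl by (intro continuous_intros)
    qed
    have "G B = (\<Union>t. (\<lambda>v. flow t (P v)) -` B)" unfolding G_def by blast
    moreover have "open ((\<lambda>v. flow t (P v)) -` B)" for t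
      using continuous_open_vimage[OF oB] cont continuous_on_eq_continuous_at by blast
    ultimately have "open (G B)" by auto
    moreover have "v \<in> closure (G B)" for v
      unfolding closure_approachable
    proof (intro allI impI)
      fix e :: real assume e: "e > 0"
      obtain z where "z \<in> B" "z \<in> S3" using B(3) by blast
      then have "B \<inter> (\<Union>\<omega> \<theta> h. {cyl \<omega> \<theta> h}) \<noteq> {}"
        using S3_subset_closure_cyl open_Int_closure_eq_empty[OF oB] by blast
      then obtain \<omega>1 \<theta>1 h1 where "cyl \<omega>1 \<theta>1 h1 \<in> B" by auto
      from flow_visits[OF oB this e, of "fst v" "fst (snd v)" "snd (snd v)"]
      obtain \<omega> t where \<omega>: "\<bar>\<omega> - fst v\<bar> < e" "flow t (cyl \<omega> (fst (snd v)) (snd (snd v))) \<in> B" by blast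
      have "dist (\<omega>, snd v) v < e" using \<omega>(1) by (cases v) (simp add: dist_Pair_Pair dist_real_def)
      moreover have "(\<omega>, snd v) \<in> G B" using \<omega>(2) by (auto simp: G_def P_def)
      ultimately show "\<exists>y\<in>G B. dist y v < e" by blast
    qed
    ultimately show "openin (top_of_set UNIV) T \<and> UNIV \<subseteq> closure T" unfolding B(1) by auto
  qed simp
  then have "\<Inter> (G ` \<B>') \<noteq> {}" by auto
  then obtain v where v: "\<And>B. B \<in> \<B>' \<Longrightarrow> v \<in> G B" by auto
  have "S3 \<subseteq> closure (range (\<lambda>t. flow t (P v)))"
  proof
    fix y assume y: "y \<in> S3"
    show "y \<in> closure (range (\<lambda>t. flow t (P v)))"
      unfolding closure_approachable
    proof (intro allI impI)
      fix e :: real assume "e > 0"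
      obtain U where U: "U \<subseteq> \<B>" "ball y e = \<Union>U" using \<B>(3)[OF open_ball] by blast
      then obtain B where B: "B \<in> U" "y \<in> B" using \<open>e > 0\<close> by (metis UnionE centre_in_ball)
      then have "B \<in> \<B>'" using U y by (auto simp: \<B>'_def)
      then obtain t where "flow t (P v) \<in> B" using v by (auto simp: G_def)
      then have "flow t (P v) \<in> ball y e" using B U by blast
      then show "\<exists>w\<in>range (\<lambda>t. flow t (P v)). dist w y < e" by (auto simp: dist_commute)
    qed
  qed
  moreover have "P v \<in> S3" by (simp add: P_def cyl_in_S3)
  ultimately show ?thesis unfolding transitive_flow_def by blast
qed

end

section \<open>Hausdorff dimension\<close>

text \<open>A covering of the family by sets of diameter \<open>d\<close> induces a covering of the parameter box by boxes of
  volume at most a constant times \<open>d powr (5 / 2)\<close>.\<close>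
lemma hausdorff_dim_ge_five_halves:
  fixes P :: "real \<times> real \<times> real \<Rightarrow> 'a::metric_space" and C :: real
  assumes sub: "P ` cbox (0, 0, 0) (x1, x2, x3) \<subseteq> A"
    and x: "x1 > 0" "x2 > 0" "x3 > 0" and C: "C > 0"
    and sep: "\<And>v w. v \<in> cbox (0, 0, 0) (x1, x2, x3) \<Longrightarrow> w \<in> cbox (0, 0, 0) (x1, x2, x3) \<Longrightarrow>
      \<bar>fst v - fst w\<bar> \<le> C * sqrt (dist (P v) (P w)) \<and>
      \<bar>fst (snd v) - fst (snd w)\<bar> \<le> C * dist (P v) (P w) \<and>
      \<bar>snd (snd v) - snd (snd w)\<bar> \<le> C * dist (P v) (P w)"
  shows "5 / 2 \<le> hausdorff_dim A"
  unfolding hausdorff_dim_def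
proof (rule Inf_greatest)
  fix y assume "y \<in> {ennreal s |s. 0 \<le> s \<and> hausdorff_measure s A = 0}"
  then obtain s where s: "y = ennreal s" "0 \<le> s" "hausdorff_measure s A = 0" by blast
  define Box where "Box = cbox (0, 0, 0) (x1, x2, x3)"
  have vol: "emeasure lborel (cbox (a1, a2, a3) (b1, b2, b3)) = ennreal ((b1 - a1) * ((b2 - a2) * (b3 - a3)))"
    if "a1 \<le> b1" "a2 \<le> b2" "a3 \<le> b3" for a1 a2 a3 b1 b2 b3 :: real
  proof -
    have volume: "measure lborel (cbox (a1, a2, a3) (b1, b2, b3)) = (b1 - a1) * ((b2 - a2) * (b3 - a3))"
      using that by (simp add: content_Pair)
    have "emeasure lborel (cbox (a1, a2, a3) (b1, b2, b3)) \<noteq> top"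
      using emeasure_lborel_cbox_finite[of "(a1, a2, a3)" "(b1, b2, b3)"] by auto
    from emeasure_eq_ennreal_measure[OF this] show ?thesis unfolding volume .
  qed
  have "5 / 2 \<le> s"
  proof (rule ccontr)
    assume "\<not> 5 / 2 \<le> s"
    define V where "V = x1 * (x2 * x3)"
    \<comment> \<open>The factor 8 is the product of the three doublings from half-widths to widths
      of the covering boxes.\<close>
    define K where "K = 8 * C ^ 3"
    have VK: "V > 0" "K > 0" using x C by (simp_all add: V_def K_def)
    \<comment> \<open>Scale 1 is enough: vanishing of the measure forces the content at every scale
      to vanish, and diameters at most 1 allow powers to be compared.\<close>
    have "hausdorff_content s 1 A \<le> hausdorff_measure s A"
      unfolding hausdorff_measure_def by (rule SUP_upper) simp
    then have "hausdorff_content s 1 A < ennreal (V / K)" using s(3) VK by simp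
    then obtain U :: "nat \<Rightarrow> 'a set" where U: "A \<subseteq> (\<Union>i. U i)" "\<And>i. bounded (U i) \<and> diameter (U i) \<le> 1"
      and small: "(\<Sum>i. hausdorff_weight s (U i)) < ennreal (V / K)"
      unfolding hausdorff_content_def INF_less_iff by blast
    have "\<exists>B. B \<in> sets lborel \<and> {v \<in> Box. P v \<in> U i} \<subseteq> B \<and>
      emeasure lborel B \<le> ennreal K * hausdorff_weight s (U i)" for i
    proof (cases "{v \<in> Box. P v \<in> U i} = {}")
      case True
      then show ?thesis by (intro exI[of _ "{}"]) simp
    next
      case False
      then obtain v where v: "v \<in> Box" "P v \<in> U i" by blast
      define d where "d = diameter (U i)"
      have bU: "bounded (U i)" and d1: "d \<le> 1" using U(2)[of i] by (auto simp: d_def)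
      have d0: "d \<ge> 0" unfolding d_def by (rule diameter_ge_0[OF bU])
      \<comment> \<open>The box is centred at one parameter point of the piece, so
        \<open>sep\<close> puts the whole piece inside.\<close>
      define B where "B = cbox (fst v - C * sqrt d, fst (snd v) - C * d, snd (snd v) - C * d)
        (fst v + C * sqrt d, fst (snd v) + C * d, snd (snd v) + C * d)"
      have "{v \<in> Box. P v \<in> U i} \<subseteq> B"
      proof
        fix w assume w: "w \<in> {v \<in> Box. P v \<in> U i}"
        have dd: "dist (P v) (P w) \<le> d" unfolding d_def using w v by (intro diameter_bounded_bound[OF bU]) auto
        have "C * sqrt (dist (P v) (P w)) \<le> C * sqrt d" "C * dist (P v) (P w) \<le> C * d"
          using C dd by (auto intro: mult_left_mono)
        moreover have "\<bar>fst v - fst w\<bar> \<le> C * sqrt (dist (P v) (P w)) \<and>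
          \<bar>fst (snd v) - fst (snd w)\<bar> \<le> C * dist (P v) (P w) \<and>
          \<bar>snd (snd v) - snd (snd w)\<bar> \<le> C * dist (P v) (P w)"
          using v w by (intro sep) (auto simp: Box_def)
        ultimately have "\<bar>fst v - fst w\<bar> \<le> C * sqrt d" "\<bar>fst (snd v) - fst (snd w)\<bar> \<le> C * d"
          "\<bar>snd (snd v) - snd (snd w)\<bar> \<le> C * d" by linarith+
        then show "w \<in> B"
          unfolding B_def cbox_Pair_eq by (simp add: mem_Times_iff abs_le_iff algebra_simps)
      qed
      moreover have "B \<in> sets lborel" by (simp add: B_def)
      moreover have "emeasure lborel B \<le> ennreal K * hausdorff_weight s (U i)"
      proof -
        have "emeasure lborel B = ennreal ((2 * (C * sqrt d)) * ((2 * (C * d)) * (2 * (C * d))))"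
          unfolding B_def using C d0 by (subst vol) auto
        also have "(2 * (C * sqrt d)) * ((2 * (C * d)) * (2 * (C * d))) = K * (sqrt d * d\<^sup>2)"
          by (simp add: K_def power2_eq_square power3_eq_cube)
        also have "ennreal (K * (sqrt d * d\<^sup>2)) \<le> ennreal K * hausdorff_weight s (U i)"
        proof (cases "s = 0")
          \<comment> \<open>The weight is now 1 whatever the diameter; the volume is bounded because
            \<open>d \<le> 1\<close>.\<close>
          case True
          have "sqrt d * d\<^sup>2 \<le> 1 * 1" using d0 d1 by (intro mult_mono) (auto simp: power_le_one)
          then have "K * (sqrt d * d\<^sup>2) \<le> K" using VK by simp
          moreover have "hausdorff_weight s (U i) = 1" using True v by (auto simp: hausdorff_weight_def)
          ultimately show ?thesis by (simp add: ennreal_leI)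
        next
          case False
          have "sqrt d * d\<^sup>2 \<le> d powr s"
          \<comment> \<open>For diameter 0 both sides vanish, as
            \<open>0 powr s = 0\<close>.\<close>
          proof (cases "d = 0")
            case False
            then have "d > 0" using d0 by simp
            then have "sqrt d * d\<^sup>2 = d powr (1 / 2 + 2)"
              by (simp only: powr_add powr_half_sqrt powr_numeral less_imp_le)
            also have "\<dots> \<le> d powr s" using \<open>d > 0\<close> d1 \<open>\<not> 5 / 2 \<le> s\<close> by (intro powr_mono') auto
            finally show ?thesis .
          qed simp
          then have "K * (sqrt d * d\<^sup>2) \<le> K * d powr s" using VK by simp
          then have "ennreal (K * (sqrt d * d\<^sup>2)) \<le> ennreal (K * d powr s)" by (rule ennreal_leI)
          also have "\<dots> = ennreal K * hausdorff_weight s (U i)"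
            unfolding hausdorff_weight_def d_def[symmetric] using False VK
            by (subst ennreal_mult) auto
          finally show ?thesis .
        qed
        finally show ?thesis .
      qed
      ultimately show ?thesis by blast
    qed
    then have "\<exists>B. \<forall>i. B i \<in> sets lborel \<and> {v \<in> Box. P v \<in> U i} \<subseteq> B i \<and>
      emeasure lborel (B i) \<le> ennreal K * hausdorff_weight s (U i)" by (intro choice allI)
    then obtain B where B: "\<And>i. B i \<in> sets lborel" "\<And>i. {v \<in> Box. P v \<in> U i} \<subseteq> B i"
      "\<And>i. emeasure lborel (B i) \<le> ennreal K * hausdorff_weight s (U i)" by blast
    have "Box \<subseteq> (\<Union>i. B i)"
    proof
      fix v assume v: "v \<in> Box"
      then have "P v \<in> A" using sub by (auto simp: Box_def)
      then obtain i where "P v \<in> U i" using U(1) by blast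
      then show "v \<in> (\<Union>i. B i)" using v B(2)[of i] by blast
    qed
    then have "emeasure lborel Box \<le> emeasure lborel (\<Union>i. B i)"
      by (rule emeasure_mono) (use B(1) in blast)
    also have "\<dots> \<le> (\<Sum>i. emeasure lborel (B i))"
      by (rule emeasure_subadditive_countably) (use B(1) in blast)
    also have "\<dots> \<le> (\<Sum>i. ennreal K * hausdorff_weight s (U i))"
      by (rule suminf_le[OF B(3)]) (rule summableI)+
    also have "\<dots> = ennreal K * (\<Sum>i. hausdorff_weight s (U i))" by (rule ennreal_suminf_cmult)
    also have "\<dots> < ennreal K * ennreal (V / K)"
      by (rule ennreal_mult_strict_left_mono[OF small]) (use VK in \<open>simp_all add: ennreal_less_top\<close>)
    also have "ennreal K * ennreal (V / K) = ennreal (K * (V / K))"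
      by (rule ennreal_mult[symmetric]) (use VK in auto)
    also have "K * (V / K) = V" using VK by simp
    also have "ennreal V = emeasure lborel Box"
      using vol[of 0 x1 0 x2 0 x3] x by (simp add: Box_def V_def)
    finally show False by simp
  qed
  then have "ennreal (5 / 2) \<le> ennreal s" by (rule ennreal_leI)
  moreover have "ennreal (5 / 2) = 5 / 2" using divide_ennreal[of 5 2] by simp
  ultimately show "5 / 2 \<le> y" using s(1) by simp
qed

section \<open>A Cantor set adapted to a chain of divisors\<close>

locale divisor_chain =
  fixes q :: "nat \<Rightarrow> nat"
  assumes q0: "q 0 > 0" and dvd: "q k dvd q (Suc k)" and growth: "800000000 * q k \<le> q (Suc k)"
begin

definition ratio :: "nat \<Rightarrow> nat" where "ratio k = q (Suc k) div q k"
definition digits :: "nat \<Rightarrow> nat" where "digits k = ratio k div 20000"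
definition total :: "nat \<Rightarrow> nat" where "total k = (\<Prod>i<k. digits i)"
text \<open>\<open>z\<close> is expanded in the mixed radix system with bases
  \<open>digits 0\<close>, \<open>digits 1\<close> and so on; \<open>prefix k z\<close> is its first
  \<open>k\<close> digits read as one integer.\<close>

definition prefix :: "nat \<Rightarrow> real \<Rightarrow> int" where "prefix k z = \<lfloor>z * real (total k)\<rfloor>"
definition digit :: "nat \<Rightarrow> real \<Rightarrow> int" where
  "digit k z = prefix (Suc k) z - int (digits k) * prefix k z"
definition cantor :: "real \<Rightarrow> real" where
  "cantor z = (\<Sum>k. of_int (digit k z) / real (q (Suc k)))"

lemma q_pos: "q k > 0"
proof (induction k)
  case (Suc k)
  then show ?case using growth[of k] by simp
qed (rule q0)

lemma ratio_mult: "q (Suc k) = ratio k * q k"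
  by (simp add: ratio_def dvd)

lemma ratio_ge: "ratio k \<ge> 800000000"
  using growth[of k] q_pos[of k] unfolding ratio_mult by simp

lemma digits_ge: "digits k \<ge> 40000" and digits_le: "20000 * digits k \<le> ratio k"
  and ratio_le: "ratio k \<le> 40000 * digits k"
proof -
  show "digits k \<ge> 40000"
    using div_le_mono[OF ratio_ge[of k], of 20000] unfolding digits_def by simp
  show "20000 * digits k \<le> ratio k" unfolding digits_def by simp
  have "ratio k < 20000 * digits k + 20000"
    using div_mult_mod_eq[of "ratio k" 20000] mod_less_divisor[of 20000 "ratio k"] unfolding digits_def by linarith
  then show "ratio k \<le> 40000 * digits k" using \<open>digits k \<ge> 40000\<close> by linarith
qed

lemma total_Suc: "total (Suc k) = digits k * total k"
  by (simp add: total_def)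

lemma total_ge: "total k \<ge> 2 ^ k"
proof (induction k)
  case (Suc k)
  have "2 * 2 ^ k \<le> digits k * total k" using digits_ge[of k] by (intro mult_mono Suc) auto
  then show ?case by (simp add: total_Suc)
qed (simp add: total_def)

text \<open>\<open>digits k\<close> falls short of \<open>ratio k\<close> by a factor of at most
  40000, which is itself at most \<open>digits k\<close>, so each ratio is at most a square. This is
  where the Hoelder exponent 1/2 originates.\<close>

lemma q_le_total: "q k \<le> q 0 * (total k)\<^sup>2"
proof (induction k)
  case (Suc k)
  have "ratio k \<le> digits k * digits k"
    by (rule le_trans[OF ratio_le mult_right_mono[OF digits_ge]]) simp
  then have "ratio k * q k \<le> (digits k * digits k) * (q 0 * (total k)\<^sup>2)" by (intro mult_mono Suc) auto
  then show ?case by (simp add: ratio_mult total_Suc power_mult_distrib power2_eq_square mult_ac)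
qed (simp add: total_def)

lemma dvd_le: "i \<le> k \<Longrightarrow> q i dvd q k"
  by (induction k rule: dec_induct) (auto intro: dvd_trans dvd)

lemma digit_bounds: "0 \<le> digit k z \<and> digit k z < int (digits k)"
proof -
  define x where "x = z * real (total k)"
  have t: "z * real (total (Suc k)) = real (digits k) * x" by (simp add: total_Suc x_def)
  have "int (digits k) * \<lfloor>x\<rfloor> \<le> \<lfloor>real (digits k) * x\<rfloor>"
    by (simp add: le_floor_iff mult_left_mono)
  moreover have "\<lfloor>real (digits k) * x\<rfloor> < int (digits k) * \<lfloor>x\<rfloor> + int (digits k)"
  proof -
    have "real (digits k) * x < real (digits k) * (of_int \<lfloor>x\<rfloor> + 1)"
      using digits_ge[of k] by (intro mult_strict_left_mono) (linarith, simp)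
    then show ?thesis by (simp add: floor_less_iff distrib_left)
  qed
  ultimately show ?thesis unfolding digit_def prefix_def t by (simp add: x_def)
qed

lemma q_growth: "real (q (k + i)) \<ge> 2 ^ i * real (q k)"
proof (induction i)
  case (Suc i)
  have "real (q (k + Suc i)) \<ge> 800000000 * real (q (k + i))"
    using growth[of "k + i"] by (metis add_Suc_right of_nat_le_iff of_nat_mult of_nat_numeral)
  then show ?case using Suc by simp
qed simp

lemma digit_term_bound: "of_int (digit (k + i) z) / real (q (Suc (k + i))) \<le> 1 / (20000 * real (q k)) * (1 / 2) ^ i"
proof -
  have "of_int (digit (k + i) z) / real (q (Suc (k + i))) \<le> real (digits (k + i)) / real (q (Suc (k + i)))"
  proof (rule divide_right_mono)
    have "digit (k + i) z \<le> int (digits (k + i))" using digit_bounds[of "k + i" z] by simp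
    then show "real_of_int (digit (k + i) z) \<le> real (digits (k + i))" by linarith
  qed simp
  also have "\<dots> \<le> (real (ratio (k + i)) / 20000) / real (q (Suc (k + i)))"
  proof (rule divide_right_mono)
    have "real (20000 * digits (k + i)) \<le> real (ratio (k + i))" using digits_le of_nat_le_iff by blast
    then show "real (digits (k + i)) \<le> real (ratio (k + i)) / 20000" by simp
  qed simp
  also have "\<dots> = 1 / (20000 * real (q (k + i)))"
    using ratio_ge[of "k + i"] by (simp add: ratio_mult)
  also have "\<dots> \<le> 1 / (20000 * (2 ^ i * real (q k)))"
    using q_growth[of i k] q_pos[of k] by (intro divide_left_mono) (auto simp: q_pos)
  finally show ?thesis by (simp add: power_divide mult_ac)
qed

lemma digit_term_nonneg: "of_int (digit k z) / real (q (Suc k)) \<ge> 0"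
  using digit_bounds[of k z] by simp

lemma summable_cantor_tail: "summable (\<lambda>i. of_int (digit (k + i) z) / real (q (Suc (k + i))))"
proof (rule summable_comparison_test')
  show "summable (\<lambda>i. 1 / (20000 * real (q k)) * (1 / 2) ^ i)" by (intro summable_mult summable_geometric) simp
  show "norm (of_int (digit (k + i) z) / real (q (Suc (k + i)))) \<le> 1 / (20000 * real (q k)) * (1 / 2) ^ i" if "i \<ge> 0" for i
    using digit_term_bound[of k i z] digit_term_nonneg[of "k + i" z] by simp
qed

definition tail :: "nat \<Rightarrow> real \<Rightarrow> real" where
  "tail k z = (\<Sum>i. of_int (digit (k + i) z) / real (q (Suc (k + i))))"

lemma tail_bounds: "0 \<le> tail k z" "tail k z \<le> 1 / (10000 * real (q k))"
proof -
  show "0 \<le> tail k z" unfolding tail_def by (intro suminf_nonneg summable_cantor_tail digit_term_nonneg)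
  have "(\<lambda>i. 1 / (20000 * real (q k)) * (1 / 2) ^ i) sums (1 / (20000 * real (q k)) * (1 / (1 - 1 / 2)))"
    by (intro sums_mult geometric_sums) simp
  then have "tail k z \<le> 1 / (20000 * real (q k)) * (1 / (1 - 1 / 2))"
    unfolding tail_def by (intro sums_le[OF digit_term_bound summable_sums[OF summable_cantor_tail]])
  then show "tail k z \<le> 1 / (10000 * real (q k))" by simp
qed

lemma cantor_split: "cantor z = (\<Sum>i<k. of_int (digit i z) / real (q (Suc i))) + tail k z"
  using suminf_split_initial_segment[of "\<lambda>i. of_int (digit i z) / real (q (Suc i))" k]
    summable_cantor_tail[of 0 z] by (simp add: cantor_def tail_def add.commute)

lemma cantor_bounds: "0 \<le> cantor z" "cantor z \<le> 1 / 10000"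
proof -
  have eq: "cantor z = tail 0 z" using cantor_split[of z 0] by simp
  show "0 \<le> cantor z" unfolding eq by (rule tail_bounds)
  have "1 / (10000 * real (q 0)) \<le> 1 / (10000 * 1)" using q0 by (intro divide_left_mono) auto
  then show "cantor z \<le> 1 / 10000" using tail_bounds(2)[of 0 z] unfolding eq by simp
qed

text \<open>Multiplication by \<open>q k\<close> turns the first \<open>k\<close> terms of the series into integers, by divisibility.\<close>
lemma q_times_cantor:
  "\<exists>(n::int) r. real (q k) * cantor z = of_int n + r \<and> 0 \<le> r \<and> r \<le> 1 / 10000"
proof -
  have "real (q k) * (\<Sum>i<k. of_int (digit i z) / real (q (Suc i)))
    = of_int (\<Sum>i<k. digit i z * int (q k div q (Suc i)))"
  proof -
    have "real (q k) * (of_int (digit i z) / real (q (Suc i))) = of_int (digit i z * int (q k div q (Suc i)))"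
      if "i < k" for i
    proof -
      have "q (Suc i) dvd q k" using that by (intro dvd_le) simp
      then have "real (q k div q (Suc i)) = real (q k) / real (q (Suc i))" by (rule real_of_nat_div)
      then show ?thesis by simp
    qed
    then show ?thesis by (simp add: sum_distrib_left)
  qed
  moreover have "0 \<le> real (q k) * tail k z" using tail_bounds by simp
  moreover have "real (q k) * tail k z \<le> 1 / 10000"
    using mult_left_mono[OF tail_bounds(2)[of k z], of "real (q k)"] q_pos[of k] by simp
  ultimately show ?thesis
    unfolding cantor_split[of z k] distrib_left
    by (intro exI[of _ "\<Sum>i<k. digit i z * int (q k div q (Suc i))"] exI[of _ "real (q k) * tail k z"]) simp
qed

text \<open>At the first level \<open>k\<close> where the prefixes differ, say by \<open>m\<close>,
  the parameters are at most 2 * m / total k apart, while the images are at least m / (2 * q k)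
  apart, later digits being confined to a small tail. The bound m \<le> \<open>digits j\<close> and
  \<open>q_le_total\<close> compare the square of the first with the second.\<close>

lemma cantor_separated:
  assumes "0 \<le> z" "z < z'" "z' < 1"
  shows "(z' - z)\<^sup>2 \<le> 320000 * real (q 0) * (cantor z' - cantor z)"
proof -
  have p0: "prefix 0 z = 0" "prefix 0 z' = 0" using assms by (simp_all add: prefix_def total_def floor_eq_iff)
  have "\<exists>k. prefix k z \<noteq> prefix k z'"
  proof -
    obtain k where k: "1 / (z' - z) < 2 ^ k" using real_arch_pow[of 2 "1 / (z' - z)"] by auto
    have "(2::real) ^ k \<le> real (total k)" using total_ge[of k] by (metis of_nat_le_iff of_nat_numeral of_nat_power)
    then have "1 / (z' - z) < real (total k)" using k by linarith
    then have "1 < z' * real (total k) - z * real (total k)" using assms by (simp add: field_simps)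
    then have "prefix k z \<noteq> prefix k z'" unfolding prefix_def by linarith
    then show ?thesis by blast
  qed
  then obtain k where k: "prefix k z \<noteq> prefix k z'" "\<And>i. i < k \<Longrightarrow> prefix i z = prefix i z'"
    using exists_least_iff[of "\<lambda>k. prefix k z \<noteq> prefix k z'"] by blast
  \<comment> \<open>At level 0 both prefixes are 0 since the points lie in the unit interval, so the
    first difference has a level before it.\<close>
  then obtain j where j: "k = Suc j" using p0 by (cases k) auto
  define m where "m = prefix k z' - prefix k z"
  have "z * real (total k) \<le> z' * real (total k)" using assms by (intro mult_right_mono) auto
  then have "prefix k z \<le> prefix k z'" unfolding prefix_def by (rule floor_mono)
  then have m1: "m \<ge> 1" using k(1) by (simp add: m_def)
  have same: "digit i z = digit i z'" if "i < j" for i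
    using that k(2)[of i] k(2)[of "Suc i"] j by (simp add: digit_def)
  have dm: "digit j z' = digit j z + m" using k(2)[of j] j by (simp add: digit_def m_def)
  then have mN: "m \<le> int (digits j)" using digit_bounds[of j z] digit_bounds[of j z'] by linarith
  define Q where "Q = real (q k)"
  define T where "T = real (total j)"
  define N where "N = real (digits j)"
  define \<mu> where "\<mu> = real_of_int m"
  have Q0: "Q > 0" using q_pos[of k] by (simp add: Q_def)
  have T1: "T > 0" using total_ge[of j] by (simp add: T_def) (metis gr_zeroI not_numeral_le_zero power_eq_0_iff le_zero_eq)
  have N0: "N > 0" using digits_ge[of j] by (simp add: N_def)
  have \<mu>1: "\<mu> \<ge> 1" using m1 by (simp add: \<mu>_def)
  have \<mu>N: "\<mu> \<le> N" using mN unfolding \<mu>_def N_def by linarith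
  have "cantor z' - cantor z = \<mu> / Q + (tail k z' - tail k z)"
    unfolding cantor_split[of _ k] j by (simp add: same dm Q_def \<mu>_def j add_divide_distrib)
  moreover have "tail k z \<le> (\<mu> / Q) / 10000"
  proof -
    have "tail k z \<le> 1 / (10000 * Q)" using tail_bounds(2)[of k z] by (simp add: Q_def)
    also have "\<dots> \<le> (\<mu> / Q) / 10000" using \<mu>1 Q0 by (simp add: field_simps)
    finally show ?thesis .
  qed
  moreover have "\<mu> / Q \<ge> 0" using \<mu>1 Q0 by simp
  ultimately have low: "cantor z' - cantor z \<ge> (\<mu> / Q) / 2" using tail_bounds(1)[of k z'] by linarith
  have tk: "real (total k) = T * N" by (simp add: j total_Suc T_def N_def)
  have "(z' - z) * (T * N) \<le> 2 * \<mu>"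
  proof -
    have "z' * real (total k) - z * real (total k) < \<mu> + 1"
      unfolding \<mu>_def m_def prefix_def by (simp; linarith)
    then show ?thesis using \<mu>1 by (simp add: tk left_diff_distrib)
  qed
  then have "z' - z \<le> 2 * \<mu> / (T * N)" using T1 N0 by (simp add: pos_le_divide_eq)
  then have "(z' - z)\<^sup>2 \<le> (2 * \<mu> / (T * N))\<^sup>2" using assms by (intro power_mono) auto
  also have "\<dots> = 4 * \<mu> * (\<mu> / (T\<^sup>2 * N\<^sup>2))"
    by (simp add: power2_eq_square mult_ac)
  \<comment> \<open>One factor \<mu> of the square is replaced by its bound \<open>N\<close>; the
    other stays, because the right-hand side is linear in \<mu>.\<close>
  also have "\<dots> \<le> 4 * \<mu> * (N / (T\<^sup>2 * N\<^sup>2))"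
    using \<mu>N \<mu>1 by (intro mult_left_mono divide_right_mono) auto
  also have "\<dots> = 4 * \<mu> / (T\<^sup>2 * N)" using N0 by (simp add: power2_eq_square)
  also have "\<dots> \<le> 4 * \<mu> * (40000 * real (q 0) / Q)"
  proof -
    have "Q \<le> real (40000 * digits j * (q 0 * (total j)\<^sup>2))"
      unfolding Q_def j ratio_mult by (intro of_nat_mono mult_mono ratio_le q_le_total) auto
    then have "Q \<le> 40000 * real (q 0) * (T\<^sup>2 * N)" by (simp add: T_def N_def mult_ac)
    then have "1 / (T\<^sup>2 * N) \<le> 40000 * real (q 0) / Q" using Q0 T1 N0 by (simp add: field_simps)
    from mult_left_mono[OF this, of "4 * \<mu>"] show ?thesis using \<mu>1 by simp
  qed
  also have "\<dots> = 320000 * real (q 0) * ((\<mu> / Q) / 2)" by simp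
  also have "\<dots> \<le> 320000 * real (q 0) * (cantor z' - cantor z)" by (intro mult_left_mono low) simp
  finally show ?thesis .
qed

end

text \<open>The chord is twice the sine of half the arc, and arcs up to 3 radians have halves within
  the range of \<open>sin_ge_linear\<close>.\<close>

lemma cis_diff_lower:
  assumes "\<bar>a - b\<bar> \<le> 3"
  shows "\<bar>a - b\<bar> \<le> 2 * norm (cis a - cis b)"
proof -
  have "(norm (cis a - cis b))\<^sup>2 = (cos a - cos b)\<^sup>2 + (sin a - sin b)\<^sup>2"
    by (simp add: cmod_power2)
  also have "\<dots> = 2 - 2 * cos (a - b)"
    using sin_cos_squared_add[of a] sin_cos_squared_add[of b]
    by (simp add: cos_diff power2_eq_square algebra_simps)
  also have "\<dots> = (2 * sin (\<bar>a - b\<bar> / 2))\<^sup>2"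
  proof -
    have "cos (a - b) = 1 - 2 * (sin (\<bar>a - b\<bar> / 2))\<^sup>2"
      using cos_double_sin[of "\<bar>a - b\<bar> / 2"] by simp
    then show ?thesis by (simp add: power_mult_distrib)
  qed
  finally have sq: "(norm (cis a - cis b))\<^sup>2 = (2 * sin (\<bar>a - b\<bar> / 2))\<^sup>2" .
  have s: "57 / 100 * (\<bar>a - b\<bar> / 2) \<le> sin (\<bar>a - b\<bar> / 2)"
    by (rule sin_ge_linear) (use assms in auto)
  then have s0: "sin (\<bar>a - b\<bar> / 2) \<ge> 0" by (smt (verit) abs_ge_zero divide_nonneg_nonneg mult_nonneg_nonneg)
  then have "norm (cis a - cis b) = 2 * sin (\<bar>a - b\<bar> / 2)"
    using power2_eq_imp_eq[OF sq] s0 by simp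
  then show ?thesis using s s0 by simp
qed

locale resonant_divisor_chain = resonant_cascade \<alpha> q p + divisor_chain q
  for \<alpha> :: real and q :: "nat \<Rightarrow> nat" and p :: "nat \<Rightarrow> int"
begin

text \<open>Adding \<open>cantor z\<close> changes every phase by at most 1/10000 of a turn modulo
  1, an angle below the tolerance 1/1000.\<close>

lemma cantor_escaping: "(start_phase sm sp + cantor z, 0) \<in> escaping sm sp"
proof (rule resonant_start_escaping)
  obtain i :: int where i: "start_phase sm sp = of_int i / 4" using start_phase_multiple by blast
  show "resonant_start (start_phase sm sp) (start_phase sm sp + cantor z) 0"
    unfolding resonant_start_def
  proof
    fix k
    obtain n :: int and r where nr: "real (q k) * cantor z = of_int n + r" "0 \<le> r" "r \<le> 1 / 10000"
      using q_times_cantor by blast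
    have "2 * pi * phase k (start_phase sm sp + cantor z) 0
      = 2 * pi * start_phase sm sp + 2 * pi * r + 2 * pi * of_int (int (q k div 4) * i + n)"
      by (simp add: phase_def distrib_left q_times_quarter[OF i] nr)
    moreover have "\<bar>2 * pi * r\<bar> \<le> 1 / 1000"
    proof -
      have "pi * r \<le> 4 * (1 / 10000)" using nr pi_less_4 by (intro mult_mono) auto
      then show ?thesis using nr by simp
    qed
    ultimately show "\<exists>b (n::int). 2 * pi * phase k (start_phase sm sp + cantor z) 0
       = 2 * pi * start_phase sm sp + b + 2 * pi * of_int n \<and> \<bar>b\<bar> \<le> 1 / 1000" by blast
  qed
qed

text \<open>The family has three free parameters: a Cantor point on the section \<theta> = 0, a time
  along the base flow, and the height, which is free because escaping depends on the angles only.
  The Cantor parameter depends on the point with Hoelder exponent 1/2 by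
  \<open>cantor_separated\<close>, the other two in a Lipschitz way.\<close>

lemma HC_dimension: "5 / 2 \<le> hausdorff_dim (HC flow sm sp)"
proof -
  define c where "c = start_phase sm sp"
  define L where "L = \<bar>\<alpha>\<bar> + 1"
  \<comment> \<open>Both the time and its contribution \<open>\<alpha> * t\<close> to the first
    angle stay within 1/10 of a turn. Angle differences thus never wrap around and meet the bound
    2/5 in \<open>near\<close>.\<close>
  define x2 where "x2 = 1 / (10 * L)"
  have L1: "L \<ge> 1" by (simp add: L_def)
  define rr where "rr x = 1 / 2 + x" for x :: real
  \<comment> \<open>The \<open>arccos\<close> sets the modulus of the first coordinate to 1/2 plus
    the third parameter, so this parameter is read off from a norm. Both moduli are at least
    1/2.\<close>
  define P where "P v = cyl (c + cantor (fst v) + \<alpha> * fst (snd v)) (fst (snd v)) (ln (tan (arccos (rr (snd (snd v))))))"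
    for v :: "real \<times> real \<times> real"
  \<comment> \<open>One constant for all three coordinates: it dominates 320000 * q 0 * (2 + 2 * L)
    from the Cantor parameter as well as the factors 2 and 1 of time and modulus.\<close>
  define C where "C = 320000 * real (q 0) * (8 + 8 * L) + 8"
  have Cb: "C \<ge> 8" by (simp add: C_def L_def)
  have box: "0 \<le> fst v \<and> fst v \<le> 1 / 2 \<and> 0 \<le> fst (snd v) \<and> fst (snd v) \<le> x2 \<and> 0 \<le> snd (snd v) \<and> snd (snd v) \<le> 1 / 4"
    if "v \<in> cbox (0, 0, 0) (1 / 2, x2, 1 / 4)" for v :: "real \<times> real \<times> real"
    using that by (cases v) (auto simp: cbox_Pair_eq)
  have P_eq: "P v = (of_real (rr (snd (snd v))) * cis (2 * pi * (c + cantor (fst v) + \<alpha> * fst (snd v))),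
      of_real (sqrt (1 - (rr (snd (snd v)))\<^sup>2)) * cis (2 * pi * fst (snd v)))"
    if "v \<in> cbox (0, 0, 0) (1 / 2, x2, 1 / 4)" for v
  proof -
    have r: "1 / 2 \<le> rr (snd (snd v))" "rr (snd (snd v)) \<le> 3 / 4" using box[OF that] by (simp_all add: rr_def)
    have "0 < arccos (rr (snd (snd v)))" "arccos (rr (snd (snd v))) < pi / 2"
      using arccos_lt_bounded[of "rr (snd (snd v))"] arccos_less_arccos[of 0 "rr (snd (snd v))"] r by auto
    from cyl_of_angle[OF this] show ?thesis
      unfolding P_def using r by (simp add: cos_arccos sin_arccos)
  qed
  \<comment> \<open>Moduli of at least 1/2 allow the passage to unit vectors by
    \<open>norm_mult_sgn_diff\<close>, and 2/5 of a turn is less than 3 radians, so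
    \<open>cis_diff_lower\<close> applies.\<close>
  have near: "\<bar>x - y\<bar> \<le> 2 * d" if "norm (of_real r * cis (2 * pi * x) - of_real r' * cis (2 * pi * y)) \<le> d"
    "1 / 2 \<le> r" "1 / 2 \<le> r'" "\<bar>x - y\<bar> \<le> 2 / 5" for x y r r' d
  proof -
    have s: "sgn (complex_of_real r * cis (2 * pi * x)) = cis (2 * pi * x)" "sgn (complex_of_real r' * cis (2 * pi * y)) = cis (2 * pi * y)"
      "norm (complex_of_real r * cis (2 * pi * x)) = r"
      using that by (simp_all add: sgn_mult sgn_of_real norm_mult)
    have "r * norm (cis (2 * pi * x) - cis (2 * pi * y)) \<le> 2 * d"
      using norm_mult_sgn_diff[of "of_real r * cis (2 * pi * x)" "of_real r' * cis (2 * pi * y)"] that(1) unfolding s by linarith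
    moreover have "1 / 2 * norm (cis (2 * pi * x) - cis (2 * pi * y)) \<le> r * norm (cis (2 * pi * x) - cis (2 * pi * y))"
      using that by (intro mult_right_mono) auto
    ultimately have n: "norm (cis (2 * pi * x) - cis (2 * pi * y)) \<le> 4 * d" by linarith
    have e: "\<bar>2 * pi * x - 2 * pi * y\<bar> = 2 * (pi * \<bar>x - y\<bar>)" by (simp add: abs_mult flip: right_diff_distrib)
    have "pi * \<bar>x - y\<bar> \<le> 315 / 100 * (2 / 5)" using that pi_approx by (intro mult_mono) auto
    then have "\<bar>2 * pi * x - 2 * pi * y\<bar> \<le> 3" unfolding e by simp
    from cis_diff_lower[OF this] have "pi * \<bar>x - y\<bar> \<le> 4 * d" using n unfolding e by linarith
    moreover have "2 * \<bar>x - y\<bar> \<le> pi * \<bar>x - y\<bar>" using pi_ge_two by (intro mult_right_mono) auto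
    ultimately have "2 * \<bar>x - y\<bar> \<le> 4 * d" by (rule order_trans[rotated])
    then show ?thesis by simp
  qed
  show ?thesis
  proof (rule hausdorff_dim_ge_five_halves[of P "1 / 2" x2 "1 / 4" _ C])
    show "P ` cbox (0, 0, 0) (1 / 2, x2, 1 / 4) \<subseteq> HC flow sm sp"
    proof (intro image_subsetI)
      fix v :: "real \<times> real \<times> real"
      have "(c + cantor (fst v) + \<alpha> * fst (snd v), 0 + fst (snd v)) \<in> escaping sm sp"
        unfolding c_def by (intro escaping_flow cantor_escaping)
      then show "P v \<in> HC flow sm sp" unfolding P_def by (intro cyl_in_HC) simp
    qed
    fix v w :: "real \<times> real \<times> real"
    assume v: "v \<in> cbox (0, 0, 0) (1 / 2, x2, 1 / 4)" and w: "w \<in> cbox (0, 0, 0) (1 / 2, x2, 1 / 4)"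
    define d where "d = dist (P v) (P w)"
    have d0: "d \<ge> 0" by (simp add: d_def)
    define zv where "zv = fst v"
    define zw where "zw = fst w"
    define tv where "tv = fst (snd v)"
    define tw where "tw = fst (snd w)"
    define rv where "rv = rr (snd (snd v))"
    define rw where "rw = rr (snd (snd w))"
    have bv: "0 \<le> zv" "zv \<le> 1 / 2" "0 \<le> tv" "tv \<le> x2" "1 / 2 \<le> rv" "rv \<le> 3 / 4"
      using box[OF v] by (simp_all add: zv_def tv_def rv_def rr_def)
    have bw: "0 \<le> zw" "zw \<le> 1 / 2" "0 \<le> tw" "tw \<le> x2" "1 / 2 \<le> rw" "rw \<le> 3 / 4"
      using box[OF w] by (simp_all add: zw_def tw_def rw_def rr_def)
    have f: "norm (of_real rv * cis (2 * pi * (c + cantor zv + \<alpha> * tv)) - of_real rw * cis (2 * pi * (c + cantor zw + \<alpha> * tw))) \<le> d"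
      and g: "norm (of_real (sqrt (1 - rv\<^sup>2)) * cis (2 * pi * tv) - of_real (sqrt (1 - rw\<^sup>2)) * cis (2 * pi * tw)) \<le> d"
    proof -
      have "dist (fst (P v)) (fst (P w)) \<le> d" "dist (snd (P v)) (snd (P w)) \<le> d"
        unfolding d_def by (rule dist_fst_le dist_snd_le)+
      then show "norm (of_real rv * cis (2 * pi * (c + cantor zv + \<alpha> * tv)) - of_real rw * cis (2 * pi * (c + cantor zw + \<alpha> * tw))) \<le> d"
        "norm (of_real (sqrt (1 - rv\<^sup>2)) * cis (2 * pi * tv) - of_real (sqrt (1 - rw\<^sup>2)) * cis (2 * pi * tw)) \<le> d"
        unfolding P_eq[OF v] P_eq[OF w] fst_conv snd_conv dist_norm zv_def zw_def tv_def tw_def rv_def rw_def .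
    qed
    have "\<bar>norm (complex_of_real rv * cis (2 * pi * (c + cantor zv + \<alpha> * tv))) - norm (complex_of_real rw * cis (2 * pi * (c + cantor zw + \<alpha> * tw)))\<bar> \<le> d"
      using norm_triangle_ineq3 f by (rule order_trans)
    then have "\<bar>rv - rw\<bar> \<le> d" using bv bw by (simp add: norm_mult)
    then have R: "\<bar>snd (snd v) - snd (snd w)\<bar> \<le> d" by (simp add: rv_def rw_def rr_def)
    have sq: "1 / 2 \<le> sqrt (1 - r\<^sup>2)" if "1 / 2 \<le> r" "r \<le> 3 / 4" for r :: real
    proof (rule real_le_rsqrt)
      have "r\<^sup>2 \<le> (3 / 4)\<^sup>2" using that by (intro power_mono) auto
      then show "(1 / 2)\<^sup>2 \<le> 1 - r\<^sup>2" by (simp add: power2_eq_square)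
    qed
    have x2: "x2 \<le> 1 / 10" using L1 by (simp add: x2_def field_simps)
    have "\<bar>tv - tw\<bar> \<le> 2 / 5" using bv bw x2 by linarith
    then have T: "\<bar>tv - tw\<bar> \<le> 2 * d" by (rule near[OF g sq[OF bv(5,6)] sq[OF bw(5,6)]])
    have al: "\<bar>\<alpha> * t\<bar> \<le> L * \<bar>t\<bar>" for t unfolding abs_mult L_def by (intro mult_right_mono) auto
    have aT: "\<bar>\<alpha> * tv - \<alpha> * tw\<bar> \<le> L * \<bar>tv - tw\<bar>" using al[of "tv - tw"] by (simp add: right_diff_distrib)
    have "L * \<bar>tv - tw\<bar> \<le> L * x2" using bv bw L1 by (intro mult_left_mono) auto
    also have "\<dots> = 1 / 10" using L1 by (simp add: x2_def)
    finally have aT': "\<bar>\<alpha> * tv - \<alpha> * tw\<bar> \<le> 1 / 10" using aT by linarith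
    have "\<bar>(c + cantor zv + \<alpha> * tv) - (c + cantor zw + \<alpha> * tw)\<bar> \<le> 2 * d"
      by (rule near[OF f bv(5) bw(5)]) (use cantor_bounds[of zv] cantor_bounds[of zw] aT' in linarith)
    moreover have "L * \<bar>tv - tw\<bar> \<le> L * (2 * d)" using T L1 by (intro mult_left_mono) auto
    \<comment> \<open>The first angle mixes Cantor point and time; removing the time part, which the
      second coordinate has already bounded, isolates the Cantor difference.\<close>
    ultimately have W: "\<bar>cantor zv - cantor zw\<bar> \<le> (2 + 2 * L) * d"
      using aT by (simp add: distrib_right)
    have Z: "(zv - zw)\<^sup>2 \<le> 320000 * real (q 0) * \<bar>cantor zv - cantor zw\<bar>"
    proof (cases zv zw rule: linorder_cases)
      case less
      have "(zv - zw)\<^sup>2 = (zw - zv)\<^sup>2" by (simp add: power2_commute)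
      also have "\<dots> \<le> 320000 * real (q 0) * (cantor zw - cantor zv)"
        by (rule cantor_separated) (use less bv bw in auto)
      also have "\<dots> \<le> 320000 * real (q 0) * \<bar>cantor zv - cantor zw\<bar>" by (intro mult_left_mono) auto
      finally show ?thesis .
    next
      case greater
      have "(zv - zw)\<^sup>2 \<le> 320000 * real (q 0) * (cantor zv - cantor zw)"
        by (rule cantor_separated) (use greater bv bw in auto)
      also have "\<dots> \<le> 320000 * real (q 0) * \<bar>cantor zv - cantor zw\<bar>" by (intro mult_left_mono) auto
      finally show ?thesis .
    qed simp
    also have "\<dots> \<le> 320000 * real (q 0) * ((2 + 2 * L) * d)" by (intro mult_left_mono W) simp
    also have "\<dots> \<le> C * d"
    proof -
      have "320000 * real (q 0) * (2 + 2 * L) \<le> C"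
        unfolding C_def using L1 by (intro order_trans[OF mult_left_mono[of "2 + 2 * L" "8 + 8 * L"]]) auto
      then have "320000 * real (q 0) * (2 + 2 * L) * d \<le> C * d" using d0 by (intro mult_right_mono)
      then show ?thesis by (simp add: mult.assoc)
    qed
    \<comment> \<open>Enlarging the constant to a square lets it leave the root as
      \<open>C\<close>.\<close>
    also have "\<dots> \<le> C\<^sup>2 * d" using Cb d0 by (intro mult_right_mono) (auto simp: power2_eq_square)
    finally have "\<bar>zv - zw\<bar> \<le> sqrt (C\<^sup>2 * d)" by (metis real_le_rsqrt power2_abs)
    also have "\<dots> = C * sqrt d" using Cb by (simp add: real_sqrt_mult)
    finally have "\<bar>zv - zw\<bar> \<le> C * sqrt d" .
    moreover have "2 * d \<le> C * d" "d \<le> C * d" using mult_right_mono[of 2 C d] mult_right_mono[of 1 C d] Cb d0 by auto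
    ultimately show "\<bar>fst v - fst w\<bar> \<le> C * sqrt (dist (P v) (P w)) \<and>
      \<bar>fst (snd v) - fst (snd w)\<bar> \<le> C * dist (P v) (P w) \<and>
      \<bar>snd (snd v) - snd (snd w)\<bar> \<le> C * dist (P v) (P w)"
      using T R unfolding d_def[symmetric] zv_def zw_def tv_def tw_def by linarith
  qed (use Cb L1 in \<open>auto simp: x2_def\<close>)
qed

end

lemma irrational_realization:
  assumes "\<alpha> \<notin> \<rat>"
  shows "\<exists>F \<Psi>. admissible F \<and> is_flow \<alpha> F \<Psi> \<and> transitive_flow \<Psi> \<and>
    (\<forall>sm sp. S3 \<subseteq> closure (HC \<Psi> sm sp) \<and> 5 / 2 \<le> hausdorff_dim (HC \<Psi> sm sp))"
proof -
  obtain q p where qp: "\<And>k. near_resonance \<alpha> k (q k) (p k)" "\<And>k. q k dvd q (Suc k)"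
    "\<And>k. 800000000 * q k \<le> q (Suc k)"
    using divisibility_chain_exists[OF assms, of 800000000] by blast
  interpret resonant_cascade \<alpha> q p by standard (use assms qp in auto)
  interpret resonant_divisor_chain \<alpha> q p by standard (use q_pos qp in auto)
  show ?thesis
    using admissible_F is_flow_flow transitive_flow_flow HC_dense HC_dimension by blast
qed

text \<open>The Hoelder series is dominated by a geometric one of ratio \<rho> = 4 powr (a *
  \<gamma>) / 2, which is below 1 exactly when a * \<gamma> < 1/2. The assumed range of \<gamma>
  gives this because 2 \<le> 1 + a.\<close>

lemma Diophantine_realization:
  fixes \<alpha> a \<gamma> :: real
  assumes "1 \<le> a" "\<alpha> \<in> DC a" "0 < \<gamma>" "\<gamma> < 1 / ((1 + a) * a)"
  shows "\<exists>F \<Psi>. admissible F \<and> hoelder_on \<gamma> S3 F \<and> is_flow \<alpha> F \<Psi> \<and> transitive_flow \<Psi> \<and>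
    (\<forall>sm sp. S3 \<subseteq> closure (HC \<Psi> sm sp))"
proof -
  obtain K where K: "K > 0" "\<And>k. \<exists>q p. near_resonance \<alpha> k q p \<and> real q \<le> K * (4 powr a) ^ k"
    using Diophantine_denominator_bound[OF assms(2,1)] by blast
  then obtain q p where qp: "\<And>k. near_resonance \<alpha> k (q k) (p k)" "\<And>k. real (q k) \<le> K * (4 powr a) ^ k" by metis
  interpret resonant_cascade \<alpha> q p by standard (use assms(2) qp in \<open>auto simp: DC_def\<close>)
  have "(1 + a) * a > 0" using assms by simp
  then have "(1 + a) * a * \<gamma> < 1" using assms(4) by (simp only: pos_less_divide_eq mult.commute)
  moreover have "2 * a * \<gamma> \<le> (1 + a) * a * \<gamma>" using assms by (intro mult_right_mono) auto
  ultimately have a\<gamma>: "a * \<gamma> < 1 / 2" by linarith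
  have "1 * \<gamma> \<le> a * \<gamma>" using assms by (intro mult_right_mono) auto
  then have \<gamma>1: "\<gamma> \<le> 1" using a\<gamma> by linarith
  define L where "L = (4 + \<bar>\<alpha>\<bar>) * K"
  define \<rho> where "\<rho> = 4 powr (a * \<gamma>) / 2"
  have "\<rho> < 1"
  proof -
    have "4 powr (a * \<gamma>) < 4 powr (1 / 2)" using a\<gamma> by (intro powr_less_mono) auto
    then show ?thesis by (simp add: \<rho>_def powr_half_sqrt)
  qed
  have bound: "amp k * (real (q k) + \<bar>of_int (p k)\<bar> + 1) powr \<gamma> \<le> 4 * pi * L powr \<gamma> * \<rho> ^ k" for k
  proof -
    have q1: "real (q k) \<ge> 1" using q_pos[of k] by simp
    have "(2::real) / 4 ^ k \<le> 2 / 1" by (intro divide_left_mono) auto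
    then have "0 < drift k" "drift k \<le> 2" using drift_pos[of k] drift_le[of k] by linarith+
    then have "\<bar>of_int (p k)\<bar> \<le> \<bar>real (q k) * \<alpha>\<bar> + 2" unfolding drift_def by linarith
    then have "real (q k) + \<bar>of_int (p k)\<bar> + 1 \<le> (4 + \<bar>\<alpha>\<bar>) * real (q k)"
      unfolding distrib_right using q1 by (simp only: abs_mult abs_of_nat mult.commute[of "real (q k)"])
    also have "\<dots> \<le> (4 + \<bar>\<alpha>\<bar>) * (K * (4 powr a) ^ k)" by (intro mult_left_mono qp) simp
    finally have "(real (q k) + \<bar>of_int (p k)\<bar> + 1) powr \<gamma> \<le> (L * (4 powr a) ^ k) powr \<gamma>"
      using assms(3) by (intro powr_mono2) (auto simp: L_def mult_ac)
    also have "\<dots> = L powr \<gamma> * (4 powr (a * \<gamma>)) ^ k"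
    proof -
      have "((4 powr a) ^ k) powr \<gamma> = (4 powr (a * \<gamma>)) ^ k"
        by (simp add: powr_powr powr_realpow[symmetric] mult_ac)
      then show ?thesis using K(1) by (simp add: powr_mult L_def)
    qed
    finally have "amp k * (real (q k) + \<bar>of_int (p k)\<bar> + 1) powr \<gamma> \<le> (4 * pi / 2 ^ k) * (L powr \<gamma> * (4 powr (a * \<gamma>)) ^ k)"
      using amp_le[of k] amp_pos[of k] by (intro mult_mono) auto
    also have "\<dots> = 4 * pi * L powr \<gamma> * \<rho> ^ k" by (simp add: \<rho>_def power_divide)
    finally show ?thesis .
  qed
  have "summable (\<lambda>k. amp k * (real (q k) + \<bar>of_int (p k)\<bar> + 1) powr \<gamma>)"
  proof (rule summable_comparison_test')
    show "summable (\<lambda>k. 4 * pi * L powr \<gamma> * \<rho> ^ k)"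
      using \<open>\<rho> < 1\<close> by (intro summable_mult summable_geometric) (simp add: \<rho>_def)
    show "norm (amp k * (real (q k) + \<bar>of_int (p k)\<bar> + 1) powr \<gamma>) \<le> 4 * pi * L powr \<gamma> * \<rho> ^ k" if "k \<ge> 0" for k
      using bound[of k] amp_pos[of k] by simp
  qed
  then have "hoelder_on \<gamma> S3 F" by (rule hoelder_F[OF assms(3) \<gamma>1])
  then show ?thesis using admissible_F is_flow_flow transitive_flow_flow HC_dense by blast
qed

theorem theorem14:
  "(\<forall>\<alpha>::real. \<alpha> \<notin> \<rat> \<longrightarrow>
      (\<exists>F \<Psi>. admissible F \<and> is_flow \<alpha> F \<Psi> \<and> transitive_flow \<Psi> \<and>
        (\<forall>s_minus s_plus. S3 \<subseteq> closure (HC \<Psi> s_minus s_plus)))) \<and>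
   (\<forall>(\<alpha>::real) (a::real) (\<gamma>::real).
      1 \<le> a \<longrightarrow> \<alpha> \<in> DC a \<longrightarrow> 0 < \<gamma> \<longrightarrow> \<gamma> < 1 / ((1 + a) * a) \<longrightarrow>
      (\<exists>F \<Psi>. admissible F \<and> hoelder_on \<gamma> S3 F \<and> is_flow \<alpha> F \<Psi> \<and> transitive_flow \<Psi> \<and>
        (\<forall>s_minus s_plus. S3 \<subseteq> closure (HC \<Psi> s_minus s_plus)))) \<and>
   (AE \<alpha> in (lebesgue :: real measure).
      (\<exists>F \<Psi>. admissible F \<and> is_flow \<alpha> F \<Psi> \<and> transitive_flow \<Psi> \<and>
        (\<forall>s_minus s_plus. S3 \<subseteq> closure (HC \<Psi> s_minus s_plus) \<and>
           5 / 2 \<le> hausdorff_dim (HC \<Psi> s_minus s_plus))))"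
proof (intro conjI allI impI)
  show "\<exists>F \<Psi>. admissible F \<and> is_flow \<alpha> F \<Psi> \<and> transitive_flow \<Psi> \<and>
      (\<forall>s_minus s_plus. S3 \<subseteq> closure (HC \<Psi> s_minus s_plus))" if "\<alpha> \<notin> \<rat>" for \<alpha> :: real
    using irrational_realization[OF that] by blast
  show "\<exists>F \<Psi>. admissible F \<and> hoelder_on \<gamma> S3 F \<and> is_flow \<alpha> F \<Psi> \<and> transitive_flow \<Psi> \<and>
      (\<forall>s_minus s_plus. S3 \<subseteq> closure (HC \<Psi> s_minus s_plus))"
    if "1 \<le> a" "\<alpha> \<in> DC a" "0 < \<gamma>" "\<gamma> < 1 / ((1 + a) * a)" for \<alpha> a \<gamma> :: real
    using Diophantine_realization[OF that] .
  \<comment> \<open>The exceptional null set is that of the rational numbers.\<close>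
  have "(\<rat> :: real set) \<in> null_sets lebesgue"
    using countable_imp_null_set_lborel[OF countable_rat] by (rule null_sets_completionI)
  then show "AE \<alpha> in (lebesgue :: real measure).
      (\<exists>F \<Psi>. admissible F \<and> is_flow \<alpha> F \<Psi> \<and> transitive_flow \<Psi> \<and>
        (\<forall>s_minus s_plus. S3 \<subseteq> closure (HC \<Psi> s_minus s_plus) \<and>
           5 / 2 \<le> hausdorff_dim (HC \<Psi> s_minus s_plus)))"
    by (rule AE_I') (use irrational_realization in blast)
qed

end
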